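(* Let $C$ be an ordered field. The complete $\mathcal{L}_{\mathrm{Ham}}$-theory $T_{\mathrm{Ham}}$ of independent dense Hamel spaces over $C$ is distal.
   Context: Let $C$ be an ordered field. A $2$-ordered $C$-vector space is a $C$-vector space $G$ with two total orderings $<_0,<_1$ such that $G$ is an ordered $C$-vector space with respect to each of them (i.e., each $<_i$ is translation invariant and $\lambda>0,\ x>_i0\Rightarrow \lambda x>_i 0$). Put $G_\infty=G\cup\{\infty\}$, with $G<_0\infty$ and $G<_1\infty$. A Hamel valuation on $G$ is a map $v:G\to G_\infty$ such that for all $x,y\in G$ and $\lambda\in C^{\times}$: $v(x)=\infty$ iff $x=0$; $v(x+y)\ge_0\min_0(v(x),v(y))$; $v(\lambda x)=v(x)$; if $0<_1x<_1y$ then $v(x)\ge_0 v(y)$; $v(v(x))=v(x)$ (with $v(\infty)=\infty$); and $v(x)>_1 0$. A Hamel space over $C$ is such a pair $(G,v)$. It is independent if for all $a_0,b_0,a_1,b_1\in G\cup\{\pm\infty\}$ with $a_0<_0b_0$ and $a_1<_1b_1$ there is $z\in G$ with $a_0<_0z<_0b_0$ and $a_1<_1z<_1b_1$; it is dense if for all $a<_0b$ in $G$ there is $c\in G$ with $a<_0v(c)<_0b$. The language is $\mathcal{L}_{\mathrm{Ham}}=\{0,+,(\lambda_c)_{c\in C},<_0,<_1,v,\infty\}$, a Hamel space being viewed as a structure with universe $G_\infty$, where $\lambda_c$ is scalar multiplication by $c$, and $g+\infty=\infty+g=\infty+\infty=\lambda_c(\infty)=v(\infty)=\infty$. $T_{\mathrm{Ham}}$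 is the $\mathcal{L}_{\mathrm{Ham}}$-theory whose models are exactly the independent dense Hamel spaces over $C$. A complete theory $T$ is distal if, in a monster model, for every parameter set $A$ and every indiscernible sequence $(a_i)_{i\in I}$ with $I=I_1+(c)+I_2$, $I_1,I_2$ infinite, such that $(a_i)_{i\in I_1+I_2}$ is $A$-indiscernible, the whole sequence $(a_i)_{i\in I}$ is $A$-indiscernible. *)

theory Defs
  imports Complex_Main
begin

text \<open>Hamel spaces over an ordered field C (type 'c), with underlying group G (type 'g).
  The structure has universe G_inf = 'g option, where None plays the role of infinity.\<close>

definition less_inf :: "('g \<Rightarrow> 'g \<Rightarrow> bool) \<Rightarrow> 'g option \<Rightarrow> 'g option \<Rightarrow> bool" where
  "less_inf lt p q = (case (p, q) of (Some x, Some y) \<Rightarrow> lt x y | (Some _, None) \<Rightarrow> True | _ \<Rightarrow> False)"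

definition le_inf :: "('g \<Rightarrow> 'g \<Rightarrow> bool) \<Rightarrow> 'g option \<Rightarrow> 'g option \<Rightarrow> bool" where
  "le_inf lt p q = (less_inf lt p q \<or> p = q)"

definition min_inf :: "('g \<Rightarrow> 'g \<Rightarrow> bool) \<Rightarrow> 'g option \<Rightarrow> 'g option \<Rightarrow> 'g option" where
  "min_inf lt p q = (if le_inf lt p q then p else q)"

definition v_ext :: "('g \<Rightarrow> 'g option) \<Rightarrow> 'g option \<Rightarrow> 'g option" where
  "v_ext v p = (case p of None \<Rightarrow> None | Some x \<Rightarrow> v x)"

definition ordered_vs :: "('c::linordered_field \<Rightarrow> 'g::ab_group_add \<Rightarrow> 'g) \<Rightarrow> ('g \<Rightarrow> 'g \<Rightarrow> bool) \<Rightarrow> bool" where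
  "ordered_vs sc lt \<longleftrightarrow>
     (\<forall>x. \<not> lt x x) \<and> (\<forall>x y z. lt x y \<longrightarrow> lt y z \<longrightarrow> lt x z) \<and>
     (\<forall>x y. lt x y \<or> x = y \<or> lt y x) \<and>
     (\<forall>x y z. lt x y \<longrightarrow> lt (x + z) (y + z)) \<and>
     (\<forall>l x. 0 < l \<and> lt 0 x \<longrightarrow> lt 0 (sc l x))"

definition hamel_space ::
  "('c::linordered_field \<Rightarrow> 'g::ab_group_add \<Rightarrow> 'g) \<Rightarrow> ('g \<Rightarrow> 'g \<Rightarrow> bool) \<Rightarrow> ('g \<Rightarrow> 'g \<Rightarrow> bool)
     \<Rightarrow> ('g \<Rightarrow> 'g option) \<Rightarrow> bool" where
  "hamel_space sc lt0 lt1 v \<longleftrightarrow>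
     Vector_Spaces.vector_space sc \<and> ordered_vs sc lt0 \<and> ordered_vs sc lt1 \<and>
     (\<forall>x. v x = None \<longleftrightarrow> x = 0) \<and>
     (\<forall>x y. le_inf lt0 (min_inf lt0 (v x) (v y)) (v (x + y))) \<and>
     (\<forall>l x. l \<noteq> 0 \<longrightarrow> v (sc l x) = v x) \<and>
     (\<forall>x y. lt1 0 x \<longrightarrow> lt1 x y \<longrightarrow> le_inf lt0 (v y) (v x)) \<and>
     (\<forall>x. v_ext v (v x) = v x) \<and>
     (\<forall>x. less_inf lt1 (Some 0) (v x))"

text \<open>Independence: bounds in G \<union> {-inf, +inf}; a lower bound None means -inf,
  an upper bound None means +inf (lower bound +inf / upper bound -inf make the
  hypothesis a0 < b0 false, so they need not be considered).\<close>
definition lower_ok :: "('g \<Rightarrow> 'g \<Rightarrow> bool) \<Rightarrow> 'g option \<Rightarrow> 'g \<Rightarrow> bool" where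
  "lower_ok lt a z = (case a of None \<Rightarrow> True | Some x \<Rightarrow> lt x z)"
definition upper_ok :: "('g \<Rightarrow> 'g \<Rightarrow> bool) \<Rightarrow> 'g option \<Rightarrow> 'g \<Rightarrow> bool" where
  "upper_ok lt b z = (case b of None \<Rightarrow> True | Some x \<Rightarrow> lt z x)"
definition bounds_ok :: "('g \<Rightarrow> 'g \<Rightarrow> bool) \<Rightarrow> 'g option \<Rightarrow> 'g option \<Rightarrow> bool" where
  "bounds_ok lt a b = (case (a, b) of (Some x, Some y) \<Rightarrow> lt x y | _ \<Rightarrow> True)"

definition independent :: "('g \<Rightarrow> 'g \<Rightarrow> bool) \<Rightarrow> ('g \<Rightarrow> 'g \<Rightarrow> bool) \<Rightarrow> bool" where
  "independent lt0 lt1 \<longleftrightarrow>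
     (\<forall>a0 b0 a1 b1. bounds_ok lt0 a0 b0 \<longrightarrow> bounds_ok lt1 a1 b1 \<longrightarrow>
        (\<exists>z. lower_ok lt0 a0 z \<and> upper_ok lt0 b0 z \<and> lower_ok lt1 a1 z \<and> upper_ok lt1 b1 z))"

definition dense_hamel :: "('g \<Rightarrow> 'g \<Rightarrow> bool) \<Rightarrow> ('g \<Rightarrow> 'g option) \<Rightarrow> bool" where
  "dense_hamel lt0 v \<longleftrightarrow>
     (\<forall>a b. lt0 a b \<longrightarrow> (\<exists>c. less_inf lt0 (Some a) (v c) \<and> less_inf lt0 (v c) (Some b)))"

definition model_T_Ham ::
  "('c::linordered_field \<Rightarrow> 'g::ab_group_add \<Rightarrow> 'g) \<Rightarrow> ('g \<Rightarrow> 'g \<Rightarrow> bool) \<Rightarrow> ('g \<Rightarrow> 'g \<Rightarrow> bool)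
     \<Rightarrow> ('g \<Rightarrow> 'g option) \<Rightarrow> bool" where
  "model_T_Ham sc lt0 lt1 v \<longleftrightarrow>
     hamel_space sc lt0 lt1 v \<and> independent lt0 lt1 \<and> dense_hamel lt0 v"

datatype ('c, 'u) trm = Var nat | Cst 'u | Zero | Infty
  | Plus "('c, 'u) trm" "('c, 'u) trm" | Scal 'c "('c, 'u) trm" | Val "('c, 'u) trm"

datatype ('c, 'u) fm = Eq "('c, 'u) trm" "('c, 'u) trm" | Less0 "('c, 'u) trm" "('c, 'u) trm"
  | Less1 "('c, 'u) trm" "('c, 'u) trm" | Neg "('c, 'u) fm" | Conj "('c, 'u) fm" "('c, 'u) fm"
  | Ex nat "('c, 'u) fm"

fun params_trm :: "('c, 'u) trm \<Rightarrow> 'u set" where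
  "params_trm (Var k) = {}"
| "params_trm (Cst u) = {u}"
| "params_trm Zero = {}"
| "params_trm Infty = {}"
| "params_trm (Plus s t) = params_trm s \<union> params_trm t"
| "params_trm (Scal c t) = params_trm t"
| "params_trm (Val t) = params_trm t"

fun params_fm :: "('c, 'u) fm \<Rightarrow> 'u set" where
  "params_fm (Eq s t) = params_trm s \<union> params_trm t"
| "params_fm (Less0 s t) = params_trm s \<union> params_trm t"
| "params_fm (Less1 s t) = params_trm s \<union> params_trm t"
| "params_fm (Neg f) = params_fm f"
| "params_fm (Conj f g) = params_fm f \<union> params_fm g"
| "params_fm (Ex k f) = params_fm f"

fun eval :: "('c \<Rightarrow> 'g::ab_group_add \<Rightarrow> 'g) \<Rightarrow> ('g \<Rightarrow> 'g option) \<Rightarrow> (nat \<Rightarrow> 'g option)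
    \<Rightarrow> ('c, 'g option) trm \<Rightarrow> 'g option" where
  "eval sc v e (Var k) = e k"
| "eval sc v e (Cst u) = u"
| "eval sc v e Zero = Some 0"
| "eval sc v e Infty = None"
| "eval sc v e (Plus s t) =
     (case (eval sc v e s, eval sc v e t) of (Some x, Some y) \<Rightarrow> Some (x + y) | _ \<Rightarrow> None)"
| "eval sc v e (Scal c t) = map_option (sc c) (eval sc v e t)"
| "eval sc v e (Val t) = v_ext v (eval sc v e t)"

fun sat :: "('c \<Rightarrow> 'g::ab_group_add \<Rightarrow> 'g) \<Rightarrow> ('g \<Rightarrow> 'g \<Rightarrow> bool) \<Rightarrow> ('g \<Rightarrow> 'g \<Rightarrow> bool)
    \<Rightarrow> ('g \<Rightarrow> 'g option) \<Rightarrow> (nat \<Rightarrow> 'g option) \<Rightarrow> ('c, 'g option) fm \<Rightarrow> bool" where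
  "sat sc lt0 lt1 v e (Eq s t) = (eval sc v e s = eval sc v e t)"
| "sat sc lt0 lt1 v e (Less0 s t) = less_inf lt0 (eval sc v e s) (eval sc v e t)"
| "sat sc lt0 lt1 v e (Less1 s t) = less_inf lt1 (eval sc v e s) (eval sc v e t)"
| "sat sc lt0 lt1 v e (Neg f) = (\<not> sat sc lt0 lt1 v e f)"
| "sat sc lt0 lt1 v e (Conj f g) = (sat sc lt0 lt1 v e f \<and> sat sc lt0 lt1 v e g)"
| "sat sc lt0 lt1 v e (Ex k f) = (\<exists>u. sat sc lt0 lt1 v (e(k := u)) f)"

definition seq_env :: "nat \<Rightarrow> ('i \<Rightarrow> 'g option list) \<Rightarrow> 'i list \<Rightarrow> nat \<Rightarrow> 'g option" where
  "seq_env n a is = (\<lambda>k. if k < length is * n then a (is ! (k div n)) ! (k mod n) else None)"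

definition indiscernible ::
  "('c \<Rightarrow> 'g::ab_group_add \<Rightarrow> 'g) \<Rightarrow> ('g \<Rightarrow> 'g \<Rightarrow> bool) \<Rightarrow> ('g \<Rightarrow> 'g \<Rightarrow> bool)
     \<Rightarrow> ('g \<Rightarrow> 'g option) \<Rightarrow> 'g option set \<Rightarrow> 'i::linorder set \<Rightarrow> nat \<Rightarrow> ('i \<Rightarrow> 'g option list) \<Rightarrow> bool" where
  "indiscernible sc lt0 lt1 v A I n a \<longleftrightarrow>
     (\<forall>(\<phi> :: ('c, 'g option) fm) is js. params_fm \<phi> \<subseteq> A \<longrightarrow>
        sorted_wrt (<) is \<longrightarrow> sorted_wrt (<) js \<longrightarrow> set is \<subseteq> I \<longrightarrow> set js \<subseteq> I \<longrightarrow>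
        length is = length js \<longrightarrow>
        (sat sc lt0 lt1 v (seq_env n a is) \<phi> \<longleftrightarrow> sat sc lt0 lt1 v (seq_env n a js) \<phi>))"

end

theory Submission
  imports Defs
begin

text \<open>Quantifier elimination. Write \<open>H\<close> for the set of values \<open>v h = h\<close>. A term in \<open>h \<in> H\<close> is
  \<open>l h + s\<close> with \<open>s\<close> free of \<open>h\<close>, because \<open>v (l h + s)\<close> is \<open>h\<close> or \<open>v s\<close> unless \<open>h = v s\<close>; its
  \<open>lt1\<close>-sign is decided in the same way. So only the \<open>lt0\<close>-cut of \<open>h\<close> matters, and quantifiers over
  \<open>H\<close> are eliminated by density. For a quantifier over a general \<open>x\<close>, name the values \<open>v (x - c)\<close> by
  elements of \<open>H\<close>; what remains are \<open>lt0\<close>-inequalities and \<open>lt1\<close>-open conditions on \<open>x\<close>, which are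
  decoupled by independence.

  Distality. Grouping the sequence into blocks and fixing the terms far from \<open>c\<close>, it suffices to
  compare a single block at \<open>0\<close> with its neighbours. Along these blocks every term with parameters in
  \<open>A\<close> has the form \<open>s k + d\<close> with \<open>s\<close> parameter-free and \<open>d\<close> constant: since \<open>t k\<close> is monotone and
  \<open>v\<close> is \<open>lt1\<close>-convex, \<open>v (d - t k)\<close> is either constant or equal to \<open>v (t m - t k)\<close> for an extreme
  index \<open>m\<close>. A comparison of \<open>s k\<close> with a constant that agrees on both sides of \<open>0\<close> agrees at \<open>0\<close>,
  by monotonicity of \<open>s\<close> in both orders.\<close>

section \<open>Hamel spaces\<close>

text \<open>The obstacle in the elimination is that a condition \<open>v (x - a) = h\<close> is not
  a cut in either order, so independence alone does not realise it. It is \<open>lt1\<close>-open,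
  however: it is enough to know one point that satisfies all such conditions and has the required
  \<open>lt1\<close>-position. Such a point exists among finitely many terms in the data, and
  whether a given term qualifies is an atomic question. Independence then adjusts the
  \<open>lt0\<close>-position. No eliminated formula is ever written down: a predicate counts as
  definable once the comparisons of finitely many terms determine it. Blocks are used in the
  distality argument because there may be no room for further indices right next to
  \<open>c\<close>; the entries of the tuple that are too close to \<open>c\<close> have to move
  together with it. Replacing \<open>d\<close> by the extreme entry \<open>t m\<close> takes that
  entry out of the range of the moving index. This may happen once for every nested
  \<open>v\<close>, and so the nesting depth of the terms dictates how many blocks are
  prepared.\<close>

locale ordered_space =
  fixes sc :: "'c::linordered_field \<Rightarrow> 'g::ab_group_add \<Rightarrow> 'g"
    and lt :: "'g \<Rightarrow> 'g \<Rightarrow> bool"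
  assumes space: "Vector_Spaces.vector_space sc"
    and ordered: "ordered_vs sc lt"
begin

definition le :: "'g \<Rightarrow> 'g \<Rightarrow> bool" where "le x y \<longleftrightarrow> lt x y \<or> x = y"

sublocale vs: Vector_Spaces.vector_space sc by (rule space)

sublocale linordered_ab_group_add "(+)" 0 "(-)" uminus le lt
proof
  have irr: "\<And>x. \<not> lt x x" and tr: "\<And>x y z. lt x y \<Longrightarrow> lt y z \<Longrightarrow> lt x z"
    and tot: "\<And>x y. lt x y \<or> x = y \<or> lt y x" and ad: "\<And>x y z. lt x y \<Longrightarrow> lt (x + z) (y + z)"
    using ordered unfolding ordered_vs_def by blast+
  fix x y z :: 'g
  show "lt x y = (le x y \<and> \<not> le y x)" using irr tr by (auto simp: le_def)
  show "le x x" by (simp add: le_def)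
  show "le x y \<Longrightarrow> le y z \<Longrightarrow> le x z" using tr by (auto simp: le_def)
  show "le x y \<Longrightarrow> le y x \<Longrightarrow> x = y" using irr tr by (auto simp: le_def)
  show "le x y \<or> le y x" using tot by (auto simp: le_def)
  show "le x y \<Longrightarrow> le (z + x) (z + y)" using ad[of x y z] by (auto simp: le_def add.commute)
qed

lemma diff_right_cancel [simp]: "lt (x - z) (y - z) \<longleftrightarrow> lt x y" "le (x - z) (y - z) \<longleftrightarrow> le x y"
  using add_less_cancel_right[of x "- z" y] add_le_cancel_right[of x "- z" y] by simp_all

lemma diff_left_cancel [simp]: "lt (z - x) (z - y) \<longleftrightarrow> lt y x" "le (z - x) (z - y) \<longleftrightarrow> le y x"
  using add_less_cancel_left[of z "- x" "- y"] add_le_cancel_left[of z "- x" "- y"] by simp_all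

lemma scale_pos: "0 < l \<Longrightarrow> lt 0 x \<Longrightarrow> lt 0 (sc l x)"
  using ordered unfolding ordered_vs_def by blast

lemma scale_pos_iff: "0 < l \<Longrightarrow> lt 0 (sc l x) \<longleftrightarrow> lt 0 x"
  using scale_pos[of l x] scale_pos[of "inverse l" "sc l x"] by auto

lemma scale_neg_iff: "l < 0 \<Longrightarrow> lt 0 (sc l x) \<longleftrightarrow> lt x 0"
  using scale_pos_iff[of "- l" "- x"] by simp

lemma scale_less_iff: "0 < l \<Longrightarrow> lt (sc l x) (sc l y) \<longleftrightarrow> lt x y"
  using scale_pos_iff[of l "y - x"] by (simp add: vs.scale_right_diff_distrib)

lemma midpoint_between:
  assumes "lt x y" shows "lt x (sc (1/2) (x + y))" "lt (sc (1/2) (x + y)) y"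
proof -
  have h: "sc (1/2) z + sc (1/2) z = z" for z by (simp flip: vs.scale_left_distrib)
  have "lt (sc (1/2) x) (sc (1/2) y)" using assms by (simp add: scale_less_iff)
  then have "lt (sc (1/2) x + sc (1/2) x) (sc (1/2) x + sc (1/2) y)"
    "lt (sc (1/2) x + sc (1/2) y) (sc (1/2) y + sc (1/2) y)" by simp_all
  then show "lt x (sc (1/2) (x + y))" "lt (sc (1/2) (x + y)) y"
    by (simp_all only: h vs.scale_right_distrib)
qed

lemma linorder_inf: "class.linorder (le_inf lt) (less_inf lt)"
  by standard (auto simp: le_inf_def less_inf_def split: option.splits)

end

lemma less_inf_simps [simp]:
  "less_inf lt (Some x) (Some y) = lt x y"
  "less_inf lt (Some x) None = True"
  "less_inf lt None p = False"
  by (auto simp: less_inf_def)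

section \<open>Values, signs and realisation of cuts in a model\<close>

locale hamel_model =
  fixes sc :: "'c::linordered_field \<Rightarrow> 'g::ab_group_add \<Rightarrow> 'g"
    and lt0 lt1 :: "'g \<Rightarrow> 'g \<Rightarrow> bool"
    and v :: "'g \<Rightarrow> 'g option"
  assumes model: "model_T_Ham sc lt0 lt1 v"
begin

lemma hamel: "hamel_space sc lt0 lt1 v" and indep: "independent lt0 lt1" and dense: "dense_hamel lt0 v"
  using model by (auto simp: model_T_Ham_def)

sublocale o0: ordered_space sc lt0
  using hamel by (auto simp: hamel_space_def intro: ordered_space.intro)

sublocale o1: ordered_space sc lt1
  using hamel by (auto simp: hamel_space_def intro: ordered_space.intro)

sublocale i0: linorder "le_inf lt0" "less_inf lt0" by (rule o0.linorder_inf)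

sublocale i1: linorder "le_inf lt1" "less_inf lt1" by (rule o1.linorder_inf)

lemma v_None_iff [simp]: "v x = None \<longleftrightarrow> x = 0"
  using hamel by (auto simp: hamel_space_def)

lemma v_zero [simp]: "v 0 = None"
  by simp

lemma v_scale [simp]: "l \<noteq> 0 \<Longrightarrow> v (sc l x) = v x"
  using hamel by (auto simp: hamel_space_def)

lemma v_minus [simp]: "v (- x) = v x"
  using v_scale[of "-1" x] by (simp del: v_scale)

lemma v_diff_commute: "v (x - y) = v (y - x)"
  using v_minus[of "x - y"] by (simp del: v_minus)

lemma v_idem: "v x = Some h \<Longrightarrow> v h = Some h"
  using hamel unfolding hamel_space_def v_ext_def by (metis option.simps(5))

lemma v_pos: "v x = Some h \<Longrightarrow> lt1 0 h"
  using hamel unfolding hamel_space_def by (metis less_inf_simps(1))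

lemma v_add_ge: assumes "le_inf lt0 p (v x)" "le_inf lt0 p (v y)" shows "le_inf lt0 p (v (x + y))"
proof -
  have "le_inf lt0 (min_inf lt0 (v x) (v y)) (v (x + y))"
    using hamel by (auto simp: hamel_space_def)
  then show ?thesis using assms i0.order_trans unfolding min_inf_def by (metis (full_types))
qed

text \<open>A sum of larger value than \<open>x\<close> would force a larger value on
  \<open>x = (x + y) - y\<close> as well.\<close>

lemma v_add_less:
  assumes "less_inf lt0 (v x) (v y)" shows "v (x + y) = v x"
proof (rule i0.order.antisym)
  show "le_inf lt0 (v x) (v (x + y))" using assms by (intro v_add_ge) auto
  show "le_inf lt0 (v (x + y)) (v x)"
  proof (rule ccontr)
    assume "\<not> ?thesis"
    then have "less_inf lt0 (v x) (v (x + y))" by simp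
    moreover have "le_inf lt0 (i0.min (v (x + y)) (v y)) (v (x + y + - y))"
      by (rule v_add_ge) (simp_all only: i0.min.cobounded1 i0.min.cobounded2 v_minus)
    ultimately show False using assms by (simp add: i0.min_def split: if_splits)
  qed
qed

lemma v_antimono: assumes "lt1 0 x" "o1.le x y" shows "le_inf lt0 (v y) (v x)"
  using hamel assms unfolding hamel_space_def o1.le_def by auto

text \<open>Nonnegative summands cannot cancel: \<open>y\<close> lies below \<open>x + y\<close> for
  \<open>lt1\<close>, which bounds the value from above by convexity, and the ultrametric inequality
  bounds it from below.\<close>

lemma v_add_pos:
  assumes "o1.le 0 x" "o1.le 0 y" "v y = p" "le_inf lt0 p (v x)" shows "v (x + y) = p"
proof (cases "y = 0")
  case True
  then have "p = None" using assms(3) by auto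
  then have "v x = None" using assms(4) by (cases "v x") (auto simp: le_inf_def)
  then show ?thesis using True assms by auto
next
  case False
  then have "lt1 0 y" using assms by (auto simp: o1.le_def)
  moreover have "o1.le y (x + y)" using assms by simp
  ultimately have "le_inf lt0 (v (x + y)) p" using v_antimono assms by blast
  moreover have "le_inf lt0 p (v (x + y))" using assms by (intro v_add_ge) auto
  ultimately show ?thesis by simp
qed

text \<open>If \<open>x\<close> is positive and \<open>x + y\<close> is not, then \<open>x\<close>
  lies between \<open>0\<close> and \<open>- y\<close> for \<open>lt1\<close>, and by convexity the
  value of \<open>y\<close> is at most that of \<open>x\<close>.\<close>

lemma pos_add_iff:
  assumes "less_inf lt0 (v x) (v y)" shows "lt1 0 (x + y) \<longleftrightarrow> lt1 0 x"
proof -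
  have *: "lt1 0 (x + y)" if "lt1 0 x" "less_inf lt0 (v x) (v y)" for x y
  proof (rule ccontr)
    assume "\<not> ?thesis"
    then have "o1.le (x + y) 0" by simp
    then have "o1.le (x + y + - y) (0 + - y)" by (rule o1.add_right_mono)
    then have "o1.le x (- y)" by simp
    then have "le_inf lt0 (v (- y)) (v x)" using v_antimono that by blast
    then show False using that by simp
  qed
  have "x \<noteq> 0" using assms by auto
  show ?thesis
  proof (cases "lt1 0 x")
    case True then show ?thesis using *[OF _ assms] by simp
  next
    case False
    then have "lt1 0 (- x)" using \<open>x \<noteq> 0\<close> by auto
    then have "lt1 0 (- x + - y)" using assms by (intro *) simp_all
    then have "lt1 0 (- (x + y))" by (simp add: add.commute)
    then have "lt1 (x + y) 0" by (simp only: o1.neg_0_less_iff_less)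
    then show ?thesis using False o1.less_asym by blast
  qed
qed

text \<open>Halving and doubling the distance from \<open>s\<close> to \<open>x\<close> does not
  change its value, and convexity makes the value constant in between.\<close>

lemma v_eq_open:
  assumes "v (x - s) = Some h"
  shows "\<exists>a b. lt1 a x \<and> lt1 x b \<and> (\<forall>z. lt1 a z \<and> lt1 z b \<longrightarrow> v (z - s) = Some h)"
proof -
  have pos: "\<exists>a b. lt1 a x \<and> lt1 x b \<and> (\<forall>z. lt1 a z \<and> lt1 z b \<longrightarrow> v (z - s) = Some h)"
    if "lt1 s x" "v (x - s) = Some h" for x s
  proof (intro exI conjI allI impI)
    let ?a = "sc (1/2) (s + x)" and ?b = "x + (x - s)"
    show 1: "lt1 ?a x" and 2: "lt1 x ?b" using that o1.midpoint_between by auto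
    fix z assume z: "lt1 ?a z \<and> lt1 z ?b"
    have h: "?a - s = sc (1/2) (x - s)"
    proof -
      have "s = sc (1/2) s + sc (1/2) s" by (simp flip: o0.vs.scale_left_distrib)
      then have "?a - s = sc (1/2) s + sc (1/2) x - (sc (1/2) s + sc (1/2) s)"
        by (simp add: o0.vs.scale_right_distrib)
      then show ?thesis by (simp add: o0.vs.scale_right_diff_distrib)
    qed
    have d: "?b - s = sc 2 (x - s)"
    proof -
      have "sc (1 + 1) (x - s) = (x - s) + (x - s)"
        by (simp only: o0.vs.scale_left_distrib o0.vs.scale_one)
      then show ?thesis by (simp add: algebra_simps)
    qed
    have "lt1 0 (?a - s)" using that o1.midpoint_between by simp
    then have "le_inf lt0 (v (z - s)) (v (?a - s))" using z by (intro v_antimono) (auto simp: o1.le_def)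
    moreover have "lt1 s z" using z that o1.midpoint_between(1) o1.less_trans by blast
    then have "le_inf lt0 (v (?b - s)) (v (z - s))" using z by (intro v_antimono) (auto simp: o1.le_def)
    ultimately show "v (z - s) = Some h" using that(2) unfolding h d by simp
  qed
  have "x \<noteq> s" using assms by auto
  show ?thesis
  proof (cases "lt1 s x")
    case True then show ?thesis using pos assms by blast
  next
    case False
    then have "lt1 (- s) (- x)" using \<open>x \<noteq> s\<close> by auto
    moreover have "v (- x - - s) = Some h" using assms v_diff_commute by (metis minus_diff_minus v_minus)
    ultimately obtain a b where ab: "lt1 a (- x)" "lt1 (- x) b"
      and z: "\<And>z. lt1 a z \<Longrightarrow> lt1 z b \<Longrightarrow> v (z - - s) = Some h" using pos by blast
    show ?thesis
    proof (intro exI conjI allI impI)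
      show "lt1 (- b) x" using ab(2) by (rule o1.minus_less_iff[THEN iffD1])
      show "lt1 x (- a)" using ab(1) by (rule o1.less_minus_iff[THEN iffD1])
      fix z assume "lt1 (- b) z \<and> lt1 z (- a)"
      then have "lt1 a (- z)" "lt1 (- z) b"
        by (auto intro: o1.less_minus_iff[THEN iffD1] o1.minus_less_iff[THEN iffD1])
      then have "v (- z - - s) = Some h" by (rule z)
      then show "v (z - s) = Some h" by (metis minus_diff_minus v_minus)
    qed
  qed
qed

lemma indep_finite:
  assumes "finite A0" "finite B0" "finite A1" "finite B1"
    and "\<And>x y. x \<in> A0 \<Longrightarrow> y \<in> B0 \<Longrightarrow> lt0 x y" "\<And>x y. x \<in> A1 \<Longrightarrow> y \<in> B1 \<Longrightarrow> lt1 x y"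
  shows "\<exists>z. (\<forall>x\<in>A0. lt0 x z) \<and> (\<forall>y\<in>B0. lt0 z y) \<and> (\<forall>x\<in>A1. lt1 x z) \<and> (\<forall>y\<in>B1. lt1 z y)"
proof -
  \<comment> \<open>\<open>None\<close> stands for the empty set, hence for a missing bound; a
    nonempty finite set is represented by its extreme element.\<close>
  have L0: "\<exists>a. (a = None \<longleftrightarrow> A = {}) \<and> (\<forall>m. a = Some m \<longrightarrow> m \<in> A \<and> (\<forall>x\<in>A. o0.le x m))"
    if "finite A" for A
    using that by (cases "A = {}") (auto intro!: exI[of _ "Some (o0.Max A)"] o0.Max_in)
  have U0: "\<exists>a. (a = None \<longleftrightarrow> A = {}) \<and> (\<forall>m. a = Some m \<longrightarrow> m \<in> A \<and> (\<forall>x\<in>A. o0.le m x))"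
    if "finite A" for A
    using that by (cases "A = {}") (auto intro!: exI[of _ "Some (o0.Min A)"] o0.Min_in)
  have L1: "\<exists>a. (a = None \<longleftrightarrow> A = {}) \<and> (\<forall>m. a = Some m \<longrightarrow> m \<in> A \<and> (\<forall>x\<in>A. o1.le x m))"
    if "finite A" for A
    using that by (cases "A = {}") (auto intro!: exI[of _ "Some (o1.Max A)"] o1.Max_in)
  have U1: "\<exists>a. (a = None \<longleftrightarrow> A = {}) \<and> (\<forall>m. a = Some m \<longrightarrow> m \<in> A \<and> (\<forall>x\<in>A. o1.le m x))"
    if "finite A" for A
    using that by (cases "A = {}") (auto intro!: exI[of _ "Some (o1.Min A)"] o1.Min_in)
  obtain a0 where a0: "a0 = None \<longleftrightarrow> A0 = {}" "\<And>m. a0 = Some m \<Longrightarrow> m \<in> A0 \<and> (\<forall>x\<in>A0. o0.le x m)"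
    using L0[OF assms(1)] by blast
  obtain b0 where b0: "b0 = None \<longleftrightarrow> B0 = {}" "\<And>m. b0 = Some m \<Longrightarrow> m \<in> B0 \<and> (\<forall>x\<in>B0. o0.le m x)"
    using U0[OF assms(2)] by blast
  obtain a1 where a1: "a1 = None \<longleftrightarrow> A1 = {}" "\<And>m. a1 = Some m \<Longrightarrow> m \<in> A1 \<and> (\<forall>x\<in>A1. o1.le x m)"
    using L1[OF assms(3)] by blast
  obtain b1 where b1: "b1 = None \<longleftrightarrow> B1 = {}" "\<And>m. b1 = Some m \<Longrightarrow> m \<in> B1 \<and> (\<forall>x\<in>B1. o1.le m x)"
    using U1[OF assms(4)] by blast
  have "bounds_ok lt0 a0 b0" "bounds_ok lt1 a1 b1"
    using a0(2) b0(2) a1(2) b1(2) assms(5,6) by (auto simp: bounds_ok_def split: option.splits)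
  then obtain z where "lower_ok lt0 a0 z" "upper_ok lt0 b0 z" "lower_ok lt1 a1 z" "upper_ok lt1 b1 z"
    using indep unfolding independent_def by blast
  note z = this
  have "lt0 x z" if "x \<in> A0" for x
    using that a0 z(1) by (cases a0) (auto simp: lower_ok_def intro: o0.le_less_trans)
  moreover have "lt0 z x" if "x \<in> B0" for x
    using that b0 z(2) by (cases b0) (auto simp: upper_ok_def intro: o0.less_le_trans)
  moreover have "lt1 x z" if "x \<in> A1" for x
    using that a1 z(3) by (cases a1) (auto simp: lower_ok_def intro: o1.le_less_trans)
  moreover have "lt1 z x" if "x \<in> B1" for x
    using that b1 z(4) by (cases b1) (auto simp: upper_ok_def intro: o1.less_le_trans)
  ultimately show ?thesis by blast
qed

text \<open>Density speaks about two given elements of the group, so a pair \<open>z\<close>,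
  \<open>z'\<close> is first placed inside the cut. This also covers cuts that are unbounded on a
  side.\<close>

lemma dense_finite:
  assumes "finite A0" "finite B0" "\<And>x y. x \<in> A0 \<Longrightarrow> y \<in> B0 \<Longrightarrow> lt0 x y"
  shows "\<exists>h. v h = Some h \<and> (\<forall>x\<in>A0. lt0 x h) \<and> (\<forall>y\<in>B0. lt0 h y)"
proof -
  obtain z where z: "\<forall>x\<in>A0. lt0 x z" "\<forall>y\<in>B0. lt0 z y"
    using indep_finite[of A0 B0 "{}" "{}"] assms by auto
  obtain z' where z': "lt0 z z'" "\<forall>y\<in>B0. lt0 z' y"
    using indep_finite[of "{z}" B0 "{}" "{}"] assms z by auto
  obtain c where c: "less_inf lt0 (Some z) (v c)" "less_inf lt0 (v c) (Some z')"
    using dense z'(1) unfolding dense_hamel_def by blast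
  then obtain h where h: "v c = Some h" by (cases "v c") auto
  with c have "lt0 z h" "lt0 h z'" by auto
  then show ?thesis using z z' v_idem[OF h] o0.less_trans by (intro exI[of _ h]) blast
qed

end

section \<open>Linear equations and inequalities in one unknown\<close>

context ordered_space begin

lemma scaled_sum_less_iff: "lt (sc l x + a) (sc l' x + b) \<longleftrightarrow> lt 0 ((b - a) - sc (l - l') x)"
proof -
  have "(b - a) - sc (l - l') x = (sc l' x + b) - (sc l x + a)"
    by (simp add: vs.scale_left_diff_distrib)
  then show ?thesis by (simp only: diff_gt_0_iff_gt)
qed

lemma scaled_sum_eq_iff: "sc l x + a = sc l' x + b \<longleftrightarrow> sc (l - l') x = b - a"
  by (auto simp: vs.scale_left_diff_distrib algebra_simps)

lemma scale_eq_iff: "l \<noteq> 0 \<Longrightarrow> sc l x = d \<longleftrightarrow> x = sc (1 / l) d"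
  by auto

lemma diff_scale_pos_iff:
  assumes "l \<noteq> 0"
  shows "lt 0 (d - sc l x) \<longleftrightarrow> (if 0 < l then lt x (sc (1 / l) d) else lt (sc (1 / l) d) x)"
proof -
  have "d - sc l x = sc l (sc (1 / l) d - x)" using assms by (simp add: vs.scale_right_diff_distrib)
  then show ?thesis using assms scale_pos_iff[of l] scale_neg_iff[of l]
    by (cases "0 < l") (auto simp del: vs.scale_scale)
qed

end

context hamel_model begin

lemma half_add: "sc (1/2) z + sc (1/2) z = z"
  by (simp flip: o0.vs.scale_left_distrib)

lemma half_sum_diff: "sc (1/2) (p + q) - a = sc (1/2) ((p - a) + (q - a))"
proof -
  have "sc (1/2) ((p - a) + (q - a)) = sc (1/2) (p + q) - (sc (1/2) a + sc (1/2) a)"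
    by (simp add: o0.vs.scale_right_diff_distrib o0.vs.scale_right_distrib)
  then show ?thesis by (simp add: half_add)
qed

text \<open>Let \<open>k\<close> be the \<open>lt0\<close>-largest prescribed value. The constraints with smaller values, and the
  position relative to the points at distance less than \<open>k\<close>, only depend on the ball of value
  \<open>k\<close> around \<open>x\<close>. Inside it one takes the midpoint of the two neighbours of \<open>x\<close>, or moves
  past the only neighbour by \<open>k\<close>.\<close>

lemma constrained_candidate:
  assumes "finite R" "finite \<Gamma>" "\<Gamma> \<noteq> {}" "x \<notin> R" "\<And>a h. (a, h) \<in> \<Gamma> \<Longrightarrow> v (x - a) = Some h"
  defines "P \<equiv> R \<union> fst ` \<Gamma>"
  shows "\<exists>y. ((\<exists>p\<in>P. \<exists>q\<in>P. y = sc (1/2) (p + q)) \<or> (\<exists>p\<in>P. \<exists>h\<in>snd ` \<Gamma>. y = p + h \<or> y = p - h))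
    \<and> (\<forall>r\<in>R. (lt1 r y \<longleftrightarrow> lt1 r x) \<and> r \<noteq> y) \<and> (\<forall>a h. (a, h) \<in> \<Gamma> \<longrightarrow> v (y - a) = Some h)"
proof -
  define k where "k = o0.Max (snd ` \<Gamma>)"
  have "k \<in> snd ` \<Gamma>" unfolding k_def using assms(2,3) by (intro o0.Max_in) auto
  moreover have "o0.le h k" if "(a, h) \<in> \<Gamma>" for a h
    unfolding k_def using assms(2) that by (intro o0.Max_ge) (auto intro: rev_image_eqI)
  ultimately have k: "k \<in> snd ` \<Gamma>" "\<And>a h. (a, h) \<in> \<Gamma> \<Longrightarrow> o0.le h k" by blast+
  obtain c where c: "(c, k) \<in> \<Gamma>" using k(1) by auto
  have vk: "v k = Some k" and kpos: "lt1 0 k" using assms(5)[OF c] v_idem v_pos by auto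
  define B where "B = {p \<in> P. le_inf lt0 (Some k) (v (p - x))}"
  have finP: "finite P" using assms by simp
  have xP: "x \<notin> P" using assms(4) assms(5)[of x] by (auto simp: P_def)
  have cB: "a \<in> B" if "(a, k) \<in> \<Gamma>" for a
    using assms(5)[OF that] that by (auto simp: B_def P_def image_iff v_diff_commute[of a x] intro: bexI[of _ "(a, k)"])
  define L where "L = {p \<in> B. lt1 p x}"
  define U where "U = {p \<in> B. lt1 x p}"
  have fin: "finite L" "finite U" using finP by (auto simp: L_def U_def B_def)
  have LU: "L \<union> U = B" using xP unfolding L_def U_def B_def using o1.less_linear by blast
  have ball: "le_inf lt0 (Some k) (v (p - a))" if "p \<in> B" "(a, k) \<in> \<Gamma>" for p a
  proof -
    have "le_inf lt0 (Some k) (v ((p - x) + (x - a)))"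
      using that assms(5)[OF that(2)] by (intro v_add_ge) (auto simp: B_def)
    then show ?thesis by simp
  qed
  have "\<exists>y. ((\<exists>p\<in>P. \<exists>q\<in>P. y = sc (1/2) (p + q)) \<or> (\<exists>p\<in>P. \<exists>h\<in>snd ` \<Gamma>. y = p + h \<or> y = p - h))
    \<and> le_inf lt0 (Some k) (v (y - x)) \<and> (\<forall>p\<in>L. lt1 p y) \<and> (\<forall>p\<in>U. lt1 y p)
    \<and> (\<forall>a. (a, k) \<in> \<Gamma> \<longrightarrow> v (y - a) = Some k)"
  proof -
    consider "L \<noteq> {}" "U \<noteq> {}" | "L \<noteq> {}" "U = {}" | "L = {}" "U \<noteq> {}" using LU cB[OF c] by blast
    then show ?thesis
    proof cases
      case 1
      define p where "p = o1.Max L"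
      define q where "q = o1.Min U"
      have p: "p \<in> L" "\<And>z. z \<in> L \<Longrightarrow> o1.le z p" using fin 1 by (auto simp: p_def o1.Max_in)
      have q: "q \<in> U" "\<And>z. z \<in> U \<Longrightarrow> o1.le q z" using fin 1 by (auto simp: q_def o1.Min_in)
      have px: "lt1 p x" "lt1 x q" "p \<in> B" "q \<in> B" "p \<in> P" "q \<in> P"
        using p(1) q(1) by (auto simp: L_def U_def B_def)
      let ?y = "sc (1/2) (p + q)"
      have pq: "lt1 p ?y" "lt1 ?y q" using o1.midpoint_between[of p q] px o1.less_trans by blast+
      have "v (?y - a) = Some k" if a: "(a, k) \<in> \<Gamma>" for a
      proof -
        have aB: "a \<in> L \<or> a \<in> U" using cB[OF a] LU by auto
        have nb: "le_inf lt0 (Some k) (v (p - a))" "le_inf lt0 (Some k) (v (q - a))"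
          using ball px a by auto
        have va: "v (x - a) = Some k" using assms(5) a .
        show ?thesis
        \<comment> \<open>For \<open>a\<close> in \<open>L\<close> both \<open>p - a\<close> and
          \<open>q - a\<close> are nonnegative, and \<open>q - a\<close> exceeds
          \<open>x - a\<close>, so that its value is exactly \<open>k\<close>. Since nonnegative
          summands do not cancel, the midpoint inherits this value. The case of \<open>U\<close> is
          the mirror image.\<close>
        proof (cases "a \<in> L")
          case True
          then have "lt1 a x" "o1.le a p" using p(2) by (auto simp: L_def)
          then have "le_inf lt0 (v (q - a)) (v (x - a))" using px by (intro v_antimono) (auto simp: o1.le_def)
          then have "v (q - a) = Some k" using nb va by (simp add: i0.order.antisym)
          moreover have "o1.le 0 (p - a)" "o1.le 0 (q - a)" using \<open>o1.le a p\<close> o1.less_trans[OF \<open>lt1 a x\<close> px(2)]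
            by (auto simp: o1.le_def)
          ultimately have "v ((p - a) + (q - a)) = Some k" using nb by (intro v_add_pos) auto
          then show ?thesis by (simp add: half_sum_diff)
        next
          case False
          then have "lt1 x a" "o1.le q a" using q(2) aB by (auto simp: U_def)
          then have "le_inf lt0 (v (a - p)) (v (a - x))"
            using px by (intro v_antimono) (auto simp: o1.le_def)
          then have "v (a - p) = Some k" using nb va by (simp add: i0.order.antisym v_diff_commute[of a])
          moreover have "o1.le 0 (a - p)" "o1.le 0 (a - q)" using \<open>o1.le q a\<close> o1.less_trans[OF px(1) \<open>lt1 x a\<close>]
            by (auto simp: o1.le_def)
          ultimately have "v ((a - q) + (a - p)) = Some k" using nb
            by (intro v_add_pos) (auto simp: v_diff_commute[of a])
          moreover have "(a - q) + (a - p) = - ((p - a) + (q - a))" by simp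
          ultimately have "v ((p - a) + (q - a)) = Some k" by (metis v_minus)
          then show ?thesis by (simp add: half_sum_diff)
        qed
      qed
      moreover have "le_inf lt0 (Some k) (v (?y - x))"
      proof -
        have "le_inf lt0 (Some k) (v ((p - x) + (q - x)))"
          using px by (intro v_add_ge) (auto simp: B_def)
        then show ?thesis by (simp add: half_sum_diff)
      qed
      moreover have "lt1 z ?y" if "z \<in> L" for z using p(2)[OF that] pq o1.le_less_trans by blast
      moreover have "lt1 ?y z" if "z \<in> U" for z using q(2)[OF that] pq o1.less_le_trans by blast
      ultimately show ?thesis using px(5,6) by (intro exI[of _ ?y]) blast
    next
      case 2
      define p where "p = o1.Max L"
      have p: "p \<in> L" "\<And>z. z \<in> L \<Longrightarrow> o1.le z p" using fin 2 by (auto simp: p_def o1.Max_in)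
      have px: "p \<in> B" "p \<in> P" using p(1) by (auto simp: L_def B_def)
      have "v (p + k - a) = Some k" if a: "(a, k) \<in> \<Gamma>" for a
      proof -
        \<comment> \<open>With \<open>U\<close> empty every centre of value \<open>k\<close> lies at
          or below \<open>p\<close>, so \<open>p - a\<close> is nonnegative and cannot cancel
          against the positive \<open>k\<close>, which has value \<open>k\<close> itself.\<close>
        have "a \<in> L" using cB[OF a] LU 2 by auto
        then have "o1.le 0 (p - a)" using p(2) by simp
        then have "v ((p - a) + k) = Some k"
          using ball[OF px(1) a] vk kpos by (intro v_add_pos) (auto simp: o1.le_def)
        then show ?thesis by (simp add: algebra_simps)
      qed
      moreover have "le_inf lt0 (Some k) (v (p + k - x))"
      proof -
        have "le_inf lt0 (Some k) (v ((p - x) + k))"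
          using px vk by (intro v_add_ge) (auto simp: B_def)
        then show ?thesis by (simp add: algebra_simps)
      qed
      moreover have "lt1 z (p + k)" if "z \<in> L" for z
        using p(2)[OF that] kpos by (meson o1.le_less_trans o1.less_add_same_cancel1)
      ultimately show ?thesis using px(2) k(1) 2 by (intro exI[of _ "p + k"]) auto
    next
      case 3
      define p where "p = o1.Min U"
      have p: "p \<in> U" "\<And>z. z \<in> U \<Longrightarrow> o1.le p z" using fin 3 by (auto simp: p_def o1.Min_in)
      have px: "p \<in> B" "p \<in> P" using p(1) by (auto simp: U_def B_def)
      have "v (p - k - a) = Some k" if a: "(a, k) \<in> \<Gamma>" for a
      proof -
        have "a \<in> U" using cB[OF a] LU 3 by auto
        then have "o1.le 0 (a - p)" using p(2) by simp
        then have "v ((a - p) + k) = Some k"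
          using ball[OF px(1) a] vk kpos by (intro v_add_pos) (auto simp: o1.le_def v_diff_commute[of a])
        moreover have "(a - p) + k = - (p - k - a)" by simp
        ultimately show ?thesis by (metis v_minus)
      qed
      moreover have "le_inf lt0 (Some k) (v (p - k - x))"
      proof -
        have "le_inf lt0 (Some k) (v ((p - x) + - k))"
          using px vk by (intro v_add_ge) (auto simp: B_def)
        then show ?thesis by (simp add: algebra_simps)
      qed
      moreover have "lt1 (p - k) z" if "z \<in> U" for z
      proof -
        have "lt1 (p - k) (p - 0)" using kpos by (rule o1.diff_strict_left_mono)
        then show ?thesis using p(2)[OF that] by (simp add: o1.less_le_trans)
      qed
      ultimately show ?thesis using px(2) k(1) 3 by (intro exI[of _ "p - k"]) auto
    qed
  qed
  then obtain y where y: "(\<exists>p\<in>P. \<exists>q\<in>P. y = sc (1/2) (p + q)) \<or> (\<exists>p\<in>P. \<exists>h\<in>snd ` \<Gamma>. y = p + h \<or> y = p - h)"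
    and yx: "le_inf lt0 (Some k) (v (y - x))" and yL: "\<And>p. p \<in> L \<Longrightarrow> lt1 p y" and yU: "\<And>p. p \<in> U \<Longrightarrow> lt1 y p"
    and yk: "\<And>a. (a, k) \<in> \<Gamma> \<Longrightarrow> v (y - a) = Some k" by blast
  have "(lt1 r y \<longleftrightarrow> lt1 r x) \<and> r \<noteq> y" if r: "r \<in> R" for r
  proof (cases "r \<in> B")
    case True
    then consider "r \<in> L" | "r \<in> U" using LU by blast
    then show ?thesis
    proof cases
      case 1 then show ?thesis using yL[OF 1] by (auto simp: L_def)
    next
      case 2 then show ?thesis using yU[OF 2] o1.less_asym by (auto simp: U_def)
    qed
  next
    case False
    then have "\<not> le_inf lt0 (Some k) (v (r - x))" using r by (auto simp: B_def P_def)
    then have "less_inf lt0 (v (x - r)) (Some k)" by (simp add: v_diff_commute[of r])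
    then have *: "less_inf lt0 (v (x - r)) (v (y - x))" using yx i0.less_le_trans by blast
    have "lt1 0 ((x - r) + (y - x)) \<longleftrightarrow> lt1 0 (x - r)" by (rule pos_add_iff[OF *])
    moreover have "r \<noteq> y" using * by (auto simp: v_diff_commute)
    ultimately show ?thesis by simp
  qed
  moreover have "v (y - a) = Some h" if ah: "(a, h) \<in> \<Gamma>" for a h
  proof (cases "h = k")
    case True then show ?thesis using yk ah by auto
  next
    case False
    then have "lt0 h k" using k(2)[OF ah] by (auto simp: o0.le_def)
    then have "less_inf lt0 (v (x - a)) (Some k)" using assms(5)[OF ah] by simp
    then have *: "less_inf lt0 (v (x - a)) (v (y - x))" using yx i0.less_le_trans by blast
    show ?thesis using v_add_less[OF *] assms(5)[OF ah] by simp
  qed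
  ultimately show ?thesis using y by (intro exI[of _ y]) blast
qed

end

section \<open>Quantifier elimination\<close>

primrec qf :: "('c, 'u) fm \<Rightarrow> bool" where
  "qf (Eq s t) = True"
| "qf (Less0 s t) = True"
| "qf (Less1 s t) = True"
| "qf (Neg f) = qf f"
| "qf (Conj f g) = (qf f \<and> qf g)"
| "qf (Ex k f) = False"

primrec vars_trm :: "('c, 'u) trm \<Rightarrow> nat set" where
  "vars_trm (Var k) = {k}"
| "vars_trm (Cst u) = {}"
| "vars_trm Zero = {}"
| "vars_trm Infty = {}"
| "vars_trm (Plus s t) = vars_trm s \<union> vars_trm t"
| "vars_trm (Scal c t) = vars_trm t"
| "vars_trm (Val t) = vars_trm t"

primrec vars_fm :: "('c, 'u) fm \<Rightarrow> nat set" where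
  "vars_fm (Eq s t) = vars_trm s \<union> vars_trm t"
| "vars_fm (Less0 s t) = vars_trm s \<union> vars_trm t"
| "vars_fm (Less1 s t) = vars_trm s \<union> vars_trm t"
| "vars_fm (Neg f) = vars_fm f"
| "vars_fm (Conj f g) = vars_fm f \<union> vars_fm g"
| "vars_fm (Ex k f) = insert k (vars_fm f)"

definition oplus :: "'g::ab_group_add option \<Rightarrow> 'g option \<Rightarrow> 'g option" where
  "oplus p q = (case (p, q) of (Some x, Some y) \<Rightarrow> Some (x + y) | _ \<Rightarrow> None)"

lemma oplus_simps [simp]:
  "oplus None q = None" "oplus p None = None" "oplus (Some x) (Some y) = Some (x + y)"
  by (auto simp: oplus_def split: option.splits)

declare eval.simps(5) [simp del]

lemma eval_Plus [simp]: "eval sc v e (Plus s t) = oplus (eval sc v e s) (eval sc v e t)"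
  by (simp add: eval.simps(5) oplus_def)

lemma finite_vars_trm: "finite (vars_trm t)" by (induction t) auto

lemma finite_vars_fm: "finite (vars_fm f)" by (induction f) (auto simp: finite_vars_trm)

lemma eval_cong: "(\<And>k. k \<in> vars_trm t \<Longrightarrow> e k = e' k) \<Longrightarrow> eval sc v e t = eval sc v e' t"
  by (induction t) auto

lemma sat_cong:
  "qf f \<Longrightarrow> (\<And>k. k \<in> vars_fm f \<Longrightarrow> e k = e' k) \<Longrightarrow> sat sc lt0 lt1 v e f = sat sc lt0 lt1 v e' f"
proof (induction f)
  case (Eq s t) then show ?case using eval_cong[of s e e'] eval_cong[of t e e'] by simp
next
  case (Less0 s t) then show ?case using eval_cong[of s e e'] eval_cong[of t e e'] by simp
next
  case (Less1 s t) then show ?case using eval_cong[of s e e'] eval_cong[of t e e'] by simp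
qed auto

text \<open>The measure of the elimination. At 0 the variable enters only linearly, which is the
  base case; naming an innermost value lowers it.\<close>

primrec val_count :: "nat \<Rightarrow> ('c, 'u) trm \<Rightarrow> nat" where
  "val_count x (Var k) = 0"
| "val_count x (Cst u) = 0"
| "val_count x Zero = 0"
| "val_count x Infty = 0"
| "val_count x (Plus s t) = val_count x s + val_count x t"
| "val_count x (Scal c t) = val_count x t"
| "val_count x (Val t) = val_count x t + (if x \<in> vars_trm t then 1 else 0)"

primrec val_count_fm :: "nat \<Rightarrow> ('c, 'u) fm \<Rightarrow> nat" where
  "val_count_fm x (Eq s t) = val_count x s + val_count x t"
| "val_count_fm x (Less0 s t) = val_count x s + val_count x t"
| "val_count_fm x (Less1 s t) = val_count x s + val_count x t"
| "val_count_fm x (Neg f) = val_count_fm x f"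
| "val_count_fm x (Conj f g) = val_count_fm x f + val_count_fm x g"
| "val_count_fm x (Ex k f) = val_count_fm x f"

abbreviation (input) diff_trm :: "('c::linordered_field, 'u) trm \<Rightarrow> ('c, 'u) trm \<Rightarrow> ('c, 'u) trm" where
  "diff_trm s t \<equiv> Plus s (Scal (- 1) t)"

section \<open>Definability through finitely many comparisons\<close>

context hamel_model begin

abbreviation ev where "ev \<equiv> eval sc v"
abbreviation st where "st \<equiv> sat sc lt0 lt1 v"

text \<open>Definability is attached to predicates on environments, so that the elimination can
  reason semantically and leave the formulas implicit.\<close>

definition qf_definable :: "'g option set \<Rightarrow> ((nat \<Rightarrow> 'g option) \<Rightarrow> bool) \<Rightarrow> bool" where
  "qf_definable A P \<longleftrightarrow> (\<exists>f :: ('c, 'g option) fm. qf f \<and> params_fm f \<subseteq> A \<and> (\<forall>e. st e f = P e))"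

lemma qf_definableI:
  fixes f :: "('c, 'g option) fm"
  shows "qf f \<Longrightarrow> params_fm f \<subseteq> A \<Longrightarrow> (\<And>e. st e f = P e) \<Longrightarrow> qf_definable A P"
  unfolding qf_definable_def by blast

lemma qf_definable_sat:
  fixes f :: "('c, 'g option) fm"
  shows "qf f \<Longrightarrow> params_fm f \<subseteq> A \<Longrightarrow> qf_definable A (\<lambda>e. st e f)"
  unfolding qf_definable_def by blast

lemma qf_definable_not: "qf_definable A P \<Longrightarrow> qf_definable A (\<lambda>e. \<not> P e)"
  unfolding qf_definable_def by (metis params_fm.simps(4) qf.simps(4) sat.simps(4))

lemma qf_definable_conj: "qf_definable A P \<Longrightarrow> qf_definable A Q \<Longrightarrow> qf_definable A (\<lambda>e. P e \<and> Q e)"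
  unfolding qf_definable_def by (metis Un_least params_fm.simps(5) qf.simps(5) sat.simps(5))

lemma qf_definable_disj: "qf_definable A P \<Longrightarrow> qf_definable A Q \<Longrightarrow> qf_definable A (\<lambda>e. P e \<or> Q e)"
  using qf_definable_not[OF qf_definable_conj[OF qf_definable_not qf_definable_not]] by simp

lemma qf_definable_const: "qf_definable A (\<lambda>e. b)"
  by (cases b; rule qf_definableI[of "if b then Eq Zero Zero else Less0 Infty Zero"]) auto

lemma qf_definable_if:
  "qf_definable A P \<Longrightarrow> qf_definable A Q \<Longrightarrow> qf_definable A R
    \<Longrightarrow> qf_definable A (\<lambda>e. if P e then Q e else R e)"
  using qf_definable_disj[OF qf_definable_conj[of A P Q] qf_definable_conj[OF qf_definable_not[of A P]], of R]
  by (simp add: if_bool_eq_disj)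

lemma qf_definable_ball:
  "finite F \<Longrightarrow> (\<And>f. f \<in> F \<Longrightarrow> qf_definable A (P f)) \<Longrightarrow> qf_definable A (\<lambda>e. \<forall>f\<in>F. P f e)"
  by (induction F rule: finite_induct) (simp_all add: qf_definable_const qf_definable_conj)

lemma qf_definable_bex:
  "finite F \<Longrightarrow> (\<And>f. f \<in> F \<Longrightarrow> qf_definable A (P f)) \<Longrightarrow> qf_definable A (\<lambda>e. \<exists>f\<in>F. P f e)"
  by (induction F rule: finite_induct) (simp_all add: qf_definable_const qf_definable_disj)

text \<open>Equality of quantifier-free types, restricted to the atoms between terms of
  \<open>S\<close>.\<close>

definition agree :: "('c, 'g option) trm set \<Rightarrow> (nat \<Rightarrow> 'g option) \<Rightarrow> (nat \<Rightarrow> 'g option) \<Rightarrow> bool" where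
  "agree S e e' \<longleftrightarrow> (\<forall>s\<in>S. \<forall>t\<in>S. (ev e s = ev e t \<longleftrightarrow> ev e' s = ev e' t) \<and>
     (less_inf lt0 (ev e s) (ev e t) \<longleftrightarrow> less_inf lt0 (ev e' s) (ev e' t)) \<and>
     (less_inf lt1 (ev e s) (ev e t) \<longleftrightarrow> less_inf lt1 (ev e' s) (ev e' t)))"

lemma agreeD:
  assumes "agree S e e'" "s \<in> S" "t \<in> S"
  shows "ev e s = ev e t \<longleftrightarrow> ev e' s = ev e' t"
    "less_inf lt0 (ev e s) (ev e t) \<longleftrightarrow> less_inf lt0 (ev e' s) (ev e' t)"
    "less_inf lt1 (ev e s) (ev e t) \<longleftrightarrow> less_inf lt1 (ev e' s) (ev e' t)"
  using assms unfolding agree_def by blast+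

lemma agree_None: "agree S e e' \<Longrightarrow> Infty \<in> S \<Longrightarrow> s \<in> S \<Longrightarrow> ev e s = None \<longleftrightarrow> ev e' s = None"
  using agreeD(1)[of S e e' s Infty] by simp

lemma agree_mono: "agree S e e' \<Longrightarrow> T \<subseteq> S \<Longrightarrow> agree T e e'"
  unfolding agree_def by blast

text \<open>The finitely many atoms between terms of \<open>S\<close> admit finitely many truth
  patterns, and \<open>P\<close> is the disjunction over those patterns that some environment
  satisfying \<open>P\<close> realises.\<close>

lemma qf_definable_finitely_determined:
  fixes S :: "('c, 'g option) trm set"
  assumes "finite S" "\<And>s. s \<in> S \<Longrightarrow> params_trm s \<subseteq> A" "\<And>e e'. agree S e e' \<Longrightarrow> P e \<Longrightarrow> P e'"
  shows "qf_definable A P"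
proof -
  define At where "At = (\<lambda>(s, t). Eq s t) ` (S \<times> S) \<union> (\<lambda>(s, t). Less0 s t) ` (S \<times> S) \<union> (\<lambda>(s, t). Less1 s t) ` (S \<times> S)"
  \<comment> \<open>Membership in \<open>Good\<close> does not depend on \<open>e\<close>, so it
    enters the formula as a truth constant and need not be computed.\<close>
  define Good where "Good = {T. \<exists>e. P e \<and> T = {f \<in> At. st e f}}"
  have at: "qf f" "params_fm f \<subseteq> A" if "f \<in> At" for f
    using that assms(2) unfolding At_def by (auto, blast+)
  have fin: "finite At" using assms(1) by (simp add: At_def)
  have agr: "agree S e e'" if "\<And>f. f \<in> At \<Longrightarrow> st e f = st e' f" for e e'
    unfolding agree_def
  proof (intro ballI)
    fix s t assume "s \<in> S" "t \<in> S"
    then have "Eq s t \<in> At" "Less0 s t \<in> At" "Less1 s t \<in> At" by (auto simp: At_def)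
    from this[THEN that] show "(ev e s = ev e t \<longleftrightarrow> ev e' s = ev e' t) \<and>
     (less_inf lt0 (ev e s) (ev e t) \<longleftrightarrow> less_inf lt0 (ev e' s) (ev e' t)) \<and>
     (less_inf lt1 (ev e s) (ev e t) \<longleftrightarrow> less_inf lt1 (ev e' s) (ev e' t))" by simp
  qed
  have "P e \<longleftrightarrow> (\<exists>T\<in>Pow At. T \<in> Good \<and> (\<forall>f\<in>At. f \<in> T \<longleftrightarrow> st e f))" for e
  proof
    assume "P e"
    then show "\<exists>T\<in>Pow At. T \<in> Good \<and> (\<forall>f\<in>At. f \<in> T \<longleftrightarrow> st e f)"
      by (intro bexI[of _ "{f \<in> At. st e f}"]) (auto simp: Good_def)
  next
    assume "\<exists>T\<in>Pow At. T \<in> Good \<and> (\<forall>f\<in>At. f \<in> T \<longleftrightarrow> st e f)"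
    then obtain e' where "P e'" "\<forall>f\<in>At. st e' f \<longleftrightarrow> st e f" by (auto simp: Good_def)
    then show "P e" using assms(3) agr by blast
  qed
  moreover have "qf_definable A (\<lambda>e. \<exists>T\<in>Pow At. T \<in> Good \<and> (\<forall>f\<in>At. f \<in> T \<longleftrightarrow> st e f))"
  proof (intro qf_definable_bex qf_definable_conj qf_definable_const qf_definable_ball)
    fix T f assume f: "f \<in> At"
    show "qf_definable A (\<lambda>e. f \<in> T \<longleftrightarrow> st e f)"
      using qf_definable_sat[OF at[OF f]] qf_definable_not[OF qf_definable_sat[OF at[OF f]]]
      by (cases "f \<in> T") simp_all
  qed (use fin in auto)
  ultimately show ?thesis by (simp only: qf_definable_def)
qed

lemma subst_trm_exists:
  fixes t u :: "('c, 'g option) trm"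
  shows "\<exists>t'. params_trm t' \<subseteq> params_trm t \<union> params_trm u \<and> (\<forall>e. ev e t' = ev (e(j := ev e u)) t)"
proof (induction t)
  case (Var k) show ?case by (rule exI[of _ "if k = j then u else Var k"]) auto
next
  case (Plus s t)
  then obtain s' t' where "params_trm s' \<subseteq> params_trm s \<union> params_trm u" "\<forall>e. ev e s' = ev (e(j := ev e u)) s"
    "params_trm t' \<subseteq> params_trm t \<union> params_trm u" "\<forall>e. ev e t' = ev (e(j := ev e u)) t" by blast
  then show ?case by (intro exI[of _ "Plus s' t'"] conjI allI) ((simp only: eval.simps sat.simps; fail) | fastforce)+
next
  case (Scal c t)
  then obtain t' where "params_trm t' \<subseteq> params_trm t \<union> params_trm u" "\<forall>e. ev e t' = ev (e(j := ev e u)) t" by blast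
  then show ?case by (intro exI[of _ "Scal c t'"] conjI allI) ((simp only: eval.simps sat.simps; fail) | fastforce)+
next
  case (Val t)
  then obtain t' where "params_trm t' \<subseteq> params_trm t \<union> params_trm u" "\<forall>e. ev e t' = ev (e(j := ev e u)) t" by blast
  then show ?case by (intro exI[of _ "Val t'"] conjI allI) ((simp only: eval.simps sat.simps; fail) | fastforce)+
qed (auto intro: exI[of _ "Cst _"] exI[of _ Zero] exI[of _ Infty])

lemma subst_fm_exists:
  fixes f :: "('c, 'g option) fm" and u :: "('c, 'g option) trm"
  assumes "qf f"
  shows "\<exists>f'. qf f' \<and> params_fm f' \<subseteq> params_fm f \<union> params_trm u \<and> (\<forall>e. st e f' = st (e(j := ev e u)) f)"
  using assms
proof (induction f)
  case (Eq s t)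
  obtain s' t' where "params_trm s' \<subseteq> params_trm s \<union> params_trm u" "\<forall>e. ev e s' = ev (e(j := ev e u)) s"
    "params_trm t' \<subseteq> params_trm t \<union> params_trm u" "\<forall>e. ev e t' = ev (e(j := ev e u)) t"
    using subst_trm_exists by metis
  then show ?case by (intro exI[of _ "Eq s' t'"] conjI allI) ((simp only: eval.simps sat.simps; fail) | fastforce)+
next
  case (Less0 s t)
  obtain s' t' where "params_trm s' \<subseteq> params_trm s \<union> params_trm u" "\<forall>e. ev e s' = ev (e(j := ev e u)) s"
    "params_trm t' \<subseteq> params_trm t \<union> params_trm u" "\<forall>e. ev e t' = ev (e(j := ev e u)) t"
    using subst_trm_exists by metis
  then show ?case by (intro exI[of _ "Less0 s' t'"] conjI allI) ((simp only: eval.simps sat.simps; fail) | fastforce)+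
next
  case (Less1 s t)
  obtain s' t' where "params_trm s' \<subseteq> params_trm s \<union> params_trm u" "\<forall>e. ev e s' = ev (e(j := ev e u)) s"
    "params_trm t' \<subseteq> params_trm t \<union> params_trm u" "\<forall>e. ev e t' = ev (e(j := ev e u)) t"
    using subst_trm_exists by metis
  then show ?case by (intro exI[of _ "Less1 s' t'"] conjI allI) ((simp only: eval.simps sat.simps; fail) | fastforce)+
next
  case (Neg f)
  obtain f' where "qf f'" "params_fm f' \<subseteq> params_fm f \<union> params_trm u" "\<forall>e. st e f' = st (e(j := ev e u)) f"
    using Neg.IH Neg.prems by (metis qf.simps(4))
  then show ?case by (intro exI[of _ "Neg f'"] conjI allI) ((simp only: eval.simps sat.simps; fail) | fastforce)+
next
  case (Conj f g)
  obtain f' g' where "qf f'" "params_fm f' \<subseteq> params_fm f \<union> params_trm u" "\<forall>e. st e f' = st (e(j := ev e u)) f"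
    "qf g'" "params_fm g' \<subseteq> params_fm g \<union> params_trm u" "\<forall>e. st e g' = st (e(j := ev e u)) g"
    using Conj.IH Conj.prems by (metis qf.simps(5))
  then show ?case by (intro exI[of _ "Conj f' g'"] conjI allI) ((simp only: eval.simps sat.simps; fail) | fastforce)+
qed auto

lemma qf_definable_subst:
  fixes u :: "('c, 'g option) trm"
  assumes "qf_definable A P" "params_trm u \<subseteq> A" shows "qf_definable A (\<lambda>e. P (e(j := ev e u)))"
proof -
  obtain f :: "('c, 'g option) fm" where f: "qf f" "params_fm f \<subseteq> A" "\<forall>e. st e f = P e"
    using assms unfolding qf_definable_def by blast
  obtain f' where "qf f'" "params_fm f' \<subseteq> params_fm f \<union> params_trm u" "\<forall>e. st e f' = st (e(j := ev e u)) f"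
    using subst_fm_exists[OF f(1)] by blast
  then show ?thesis using f assms by (intro qf_definableI[of f']) auto
qed

section \<open>Linear expressions and quantifiers over the value set\<close>

definition lin :: "'c \<Rightarrow> 'g \<Rightarrow> 'g option \<Rightarrow> 'g option" where
  "lin l x p = map_option (\<lambda>a. sc l x + a) p"

lemma lin_simps [simp]: "lin l x None = None" "lin l x (Some a) = Some (sc l x + a)" "lin 0 x p = p"
  by (cases p; simp add: lin_def)+

definition same_position ::
  "('c, 'g option) trm set \<Rightarrow> (nat \<Rightarrow> 'g option) \<Rightarrow> 'g \<Rightarrow> (nat \<Rightarrow> 'g option) \<Rightarrow> 'g \<Rightarrow> bool" where
  "same_position S e x e' x' \<longleftrightarrow> agree S e e' \<and>
     (\<forall>w\<in>S. (ev e w = Some x \<longleftrightarrow> ev e' w = Some x') \<and>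
       (less_inf lt0 (ev e w) (Some x) \<longleftrightarrow> less_inf lt0 (ev e' w) (Some x')))"

lemma same_positionD:
  assumes "same_position S e x e' x'" "w \<in> S"
  shows "ev e w = Some x \<longleftrightarrow> ev e' w = Some x'"
    "less_inf lt0 (ev e w) (Some x) \<longleftrightarrow> less_inf lt0 (ev e' w) (Some x')"
    "less_inf lt0 (Some x) (ev e w) \<longleftrightarrow> less_inf lt0 (Some x') (ev e' w)"
proof -
  show 1: "ev e w = Some x \<longleftrightarrow> ev e' w = Some x'"
    "less_inf lt0 (ev e w) (Some x) \<longleftrightarrow> less_inf lt0 (ev e' w) (Some x')"
    using assms unfolding same_position_def by blast+
  show "less_inf lt0 (Some x) (ev e w) \<longleftrightarrow> less_inf lt0 (Some x') (ev e' w)"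
    using 1 i0.less_linear[of "Some x" "ev e w"] i0.less_linear[of "Some x'" "ev e' w"] i0.less_asym
      i0.less_irrefl by metis
qed

lemma same_position_mono: "same_position S e x e' x' \<Longrightarrow> T \<subseteq> S \<Longrightarrow> same_position T e x e' x'"
  unfolding same_position_def using agree_mono by blast

lemma same_position_agree: "same_position S e x e' x' \<Longrightarrow> agree S e e'"
  by (simp add: same_position_def)

text \<open>The solution for \<open>x\<close> of \<open>l x + s = l' x + s'\<close>.\<close>

abbreviation (input) root_trm :: "'c \<Rightarrow> ('c, 'g option) trm \<Rightarrow> 'c \<Rightarrow> ('c, 'g option) trm \<Rightarrow> ('c, 'g option) trm" where
  "root_trm l s l' s' \<equiv> Scal (1 / (l - l')) (diff_trm s' s)"

text \<open>Two lines of different slopes compare at \<open>x\<close> as \<open>x\<close> compares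
  with their point of intersection; the sign of \<open>l - l'\<close> fixes the direction.\<close>

lemma lin_root:
  assumes "ev e s = Some a" "ev e s' = Some b" "l \<noteq> l'"
  shows "lin l x (ev e s) = lin l' x (ev e s') \<longleftrightarrow> ev e (root_trm l s l' s') = Some x"
    "less_inf lt0 (lin l x (ev e s)) (lin l' x (ev e s')) \<longleftrightarrow>
      (if l' < l then less_inf lt0 (Some x) (ev e (root_trm l s l' s'))
       else less_inf lt0 (ev e (root_trm l s l' s')) (Some x))"
    "less_inf lt1 (lin l x (ev e s)) (lin l' x (ev e s')) \<longleftrightarrow>
      (if l' < l then less_inf lt1 (Some x) (ev e (root_trm l s l' s'))
       else less_inf lt1 (ev e (root_trm l s l' s')) (Some x))"
  using assms o0.scale_eq_iff[of "l - l'" x "b - a"]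
    o0.diff_scale_pos_iff[of "l - l'" "b - a" x] o1.diff_scale_pos_iff[of "l - l'" "b - a" x]
  by (auto simp: o0.scaled_sum_eq_iff o0.scaled_sum_less_iff o1.scaled_sum_less_iff simp del: o0.vs.scale_cancel_left)

text \<open>For equal slopes the unknown cancels and the type of \<open>s\<close>, \<open>s'\<close>
  decides; for different slopes the position relative to the intersection term decides.\<close>

lemma lin_atoms_agree0:
  assumes S: "same_position S e x e' x'" "s \<in> S" "s' \<in> S" "Infty \<in> S" "root_trm l s l' s' \<in> S"
  shows "lin l x (ev e s) = lin l' x (ev e s') \<longleftrightarrow> lin l x' (ev e' s) = lin l' x' (ev e' s')" (is ?E)
    "less_inf lt0 (lin l x (ev e s)) (lin l' x (ev e s')) \<longleftrightarrow> less_inf lt0 (lin l x' (ev e' s)) (lin l' x' (ev e' s'))" (is ?L)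
proof -
  have ag: "agree S e e'" using S by (auto simp: same_position_def)
  note N = agree_None[OF ag S(4) S(2)] agree_None[OF ag S(4) S(3)]
  have "?E \<and> ?L"
  proof (cases "ev e s = None \<or> ev e s' = None")
    case True
    then show ?thesis using N by (cases "ev e s"; cases "ev e s'"; cases "ev e' s"; cases "ev e' s'") auto
  next
    case False
    then obtain a b a' b' where ab: "ev e s = Some a" "ev e s' = Some b" "ev e' s = Some a'" "ev e' s' = Some b'"
      using N by fastforce
    show ?thesis
    proof (cases "l = l'")
      case True
      then show ?thesis using ab agreeD[OF ag S(2) S(3)] by simp
    next
      case False
      show ?thesis
        using lin_root[OF ab(1,2) False] lin_root[OF ab(3,4) False] same_positionD[OF S(1) S(5)] by simp
    qed
  qed
  then show ?E ?L by blast+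
qed

lemma agree_Some: "agree S e e' \<Longrightarrow> Infty \<in> S \<Longrightarrow> s \<in> S \<Longrightarrow> ev e s = Some a \<Longrightarrow> \<exists>a'. ev e' s = Some a'"
  using agree_None[of S e e' s] by (cases "ev e' s") auto

text \<open>For an element \<open>h\<close> of the value set, the value and the \<open>lt1\<close>-sign of \<open>l h + s\<close> are
  decided by comparing \<open>h\<close> with the value of \<open>s\<close>.\<close>

definition val_linear ::
  "'g option set \<Rightarrow> nat \<Rightarrow> ('c, 'g option) trm \<Rightarrow> ('c, 'g option) trm set \<Rightarrow> ('c \<times> ('c, 'g option) trm) set \<Rightarrow> bool" where
  "val_linear A j t S L \<longleftrightarrow> finite S \<and> finite L \<and> (\<forall>s\<in>S. params_trm s \<subseteq> A) \<and> (\<forall>s\<in>snd ` L. params_trm s \<subseteq> A) \<and>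
    (\<forall>e h e' h'. v h = Some h \<longrightarrow> v h' = Some h' \<longrightarrow> same_position S e h e' h' \<longrightarrow>
      (\<exists>(l, s)\<in>L. ev (e(j := Some h)) t = lin l h (ev e s) \<and> ev (e'(j := Some h')) t = lin l h' (ev e' s)))"

lemma val_linearD:
  assumes "val_linear A j t S L"
  shows "finite S" "finite L" "\<forall>s\<in>S. params_trm s \<subseteq> A" "\<forall>s\<in>snd ` L. params_trm s \<subseteq> A"
    "\<And>e h e' h'. v h = Some h \<Longrightarrow> v h' = Some h' \<Longrightarrow> same_position S e h e' h' \<Longrightarrow>
      \<exists>l s. (l, s) \<in> L \<and> ev (e(j := Some h)) t = lin l h (ev e s) \<and> ev (e'(j := Some h')) t = lin l h' (ev e' s)"
  using assms unfolding val_linear_def by blast+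

text \<open>Both environments must use the same member of \<open>L\<close>, because a later
  comparison of two terms has to become the same comparison on both sides.\<close>

lemma val_trm_linear:
  fixes t :: "('c, 'g option) trm"
  assumes "params_trm t \<subseteq> A"
  shows "\<exists>S L. val_linear A j t S L"
  using assms
proof (induction t)
  case (Var i)
  show ?case
  proof (cases "i = j")
    case True then show ?thesis by (intro exI[of _ "{}"] exI[of _ "{(1, Zero)}"]) (auto simp: val_linear_def)
  next
    case False then show ?thesis by (intro exI[of _ "{}"] exI[of _ "{(0, Var i)}"]) (auto simp: val_linear_def)
  qed
next
  case (Cst u) then show ?case by (intro exI[of _ "{}"] exI[of _ "{(0, Cst u)}"]) (auto simp: val_linear_def)
next
  case Zero then show ?case by (intro exI[of _ "{}"] exI[of _ "{(0, Zero)}"]) (auto simp: val_linear_def)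
next
  case Infty then show ?case by (intro exI[of _ "{}"] exI[of _ "{(0, Infty)}"]) (auto simp: val_linear_def)
next
  case (Plus t1 t2)
  then have "params_trm t1 \<subseteq> A" "params_trm t2 \<subseteq> A" by simp_all
  note IH = Plus.IH(1)[OF this(1)] Plus.IH(2)[OF this(2)]
  obtain S1 L1 S2 L2 where IH: "val_linear A j t1 S1 L1" "val_linear A j t2 S2 L2" using IH by blast
  note 1 = val_linearD[OF IH(1)] and 2 = val_linearD[OF IH(2)]
  have sum: "oplus (lin l h p) (lin l' h q) = lin (l + l') h (oplus p q)" for l l' h p q
    by (cases p; cases q) (auto simp: o0.vs.scale_left_distrib)
  show ?case unfolding val_linear_def
  proof (intro exI conjI allI impI)
    let ?L = "(\<lambda>((l, s), (l', s')). (l + l', Plus s s')) ` (L1 \<times> L2)"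
    show "finite (S1 \<union> S2)" "finite ?L" "\<forall>s\<in>S1 \<union> S2. params_trm s \<subseteq> A" "\<forall>s\<in>snd ` ?L. params_trm s \<subseteq> A"
      using 1(1-4) 2(1-4) by (auto; fastforce)+
    fix e h e' h' assume h: "v h = Some h" "v h' = Some h'" "same_position (S1 \<union> S2) e h e' h'"
    obtain l s where ls: "(l, s) \<in> L1" "ev (e(j := Some h)) t1 = lin l h (ev e s)" "ev (e'(j := Some h')) t1 = lin l h' (ev e' s)"
      using 1(5)[OF h(1,2) same_position_mono[OF h(3)]] by blast
    obtain l' s' where ls': "(l', s') \<in> L2" "ev (e(j := Some h)) t2 = lin l' h (ev e s')" "ev (e'(j := Some h')) t2 = lin l' h' (ev e' s')"
      using 2(5)[OF h(1,2) same_position_mono[OF h(3)]] by blast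
    show "\<exists>(l, s)\<in>?L. ev (e(j := Some h)) (Plus t1 t2) = lin l h (ev e s) \<and> ev (e'(j := Some h')) (Plus t1 t2) = lin l h' (ev e' s)"
      using ls ls' by (intro bexI[of _ "(l + l', Plus s s')"]) (auto simp: sum intro: rev_image_eqI)
  qed
next
  case (Scal c t)
  then have "params_trm t \<subseteq> A" by simp
  note IH = Scal.IH[OF this]
  obtain S L where IH: "val_linear A j t S L" using IH by blast
  note 1 = val_linearD[OF IH]
  have sca: "map_option (sc c) (lin l h p) = lin (c * l) h (map_option (sc c) p)" for l h p
    by (cases p) (auto simp: o0.vs.scale_right_distrib)
  show ?case unfolding val_linear_def
  proof (intro exI conjI allI impI)
    let ?L = "(\<lambda>(l, s). (c * l, Scal c s)) ` L"
    show "finite S" "finite ?L" "\<forall>s\<in>S. params_trm s \<subseteq> A" "\<forall>s\<in>snd ` ?L. params_trm s \<subseteq> A"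
      using 1(1-4) by (auto; fastforce)+
    fix e h e' h' assume h: "v h = Some h" "v h' = Some h'" "same_position S e h e' h'"
    obtain l s where ls: "(l, s) \<in> L" "ev (e(j := Some h)) t = lin l h (ev e s)" "ev (e'(j := Some h')) t = lin l h' (ev e' s)"
      using 1(5)[OF h] by blast
    then show "\<exists>(l, s)\<in>?L. ev (e(j := Some h)) (Scal c t) = lin l h (ev e s) \<and> ev (e'(j := Some h')) (Scal c t) = lin l h' (ev e' s)"
      by (intro bexI[of _ "(c * l, Scal c s)"]) (auto simp: sca intro: rev_image_eqI)
  qed
next
  case (Val t)
  then have "params_trm t \<subseteq> A" by simp
  note IH = Val.IH[OF this]
  obtain S L where IH: "val_linear A j t S L" using IH by blast
  note 1 = val_linearD[OF IH]
  \<comment> \<open>If \<open>h\<close> differs from the value of \<open>s\<close>, then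
    \<open>l h + s\<close> has the \<open>lt0\<close>-smaller of the two as its value, for nonzero
    \<open>l\<close>. If they coincide, \<open>Val s\<close> can be written for \<open>h\<close>,
    which gives \<open>?sub l s\<close>, a term without \<open>h\<close>.\<close>
  let ?S = "S \<union> snd ` L \<union> Val ` snd ` L \<union> {Infty}"
  let ?sub = "\<lambda>l s. Val (Plus (Scal l (Val s)) s)"
  let ?L = "{(1, Zero), (0, Infty)} \<union> (\<lambda>(l, s). (0, Val s)) ` L \<union> (\<lambda>(l, s). (0, ?sub l s)) ` L"
  show ?case unfolding val_linear_def
  proof (intro exI conjI allI impI)
    show "finite ?S" "finite ?L" using 1(1,2) by auto
    show "\<forall>s\<in>?S. params_trm s \<subseteq> A" "\<forall>s\<in>snd ` ?L. params_trm s \<subseteq> A"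
      using 1(3,4) by (auto; fastforce)+
    fix e h e' h' assume h: "v h = Some h" "v h' = Some h'" "same_position ?S e h e' h'"
    obtain l s where ls: "(l, s) \<in> L" "ev (e(j := Some h)) t = lin l h (ev e s)" "ev (e'(j := Some h')) t = lin l h' (ev e' s)"
      using 1(5)[OF h(1,2) same_position_mono[OF h(3)]] by blast
    have inS: "s \<in> ?S" "Val s \<in> ?S" "Infty \<in> ?S" using ls(1) by force+
    have inL: "(1, Zero) \<in> ?L" "(0, Infty) \<in> ?L" "(0, Val s) \<in> ?L" "(0, ?sub l s) \<in> ?L"
      using ls(1) by (auto intro: rev_image_eqI)
    let ?goal = "\<lambda>m u. v_ext v (lin l h (ev e s)) = lin m h (ev e u) \<and> v_ext v (lin l h' (ev e' s)) = lin m h' (ev e' u)"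
    have "\<exists>(m, u)\<in>?L. ?goal m u"
    proof (cases "l = 0 \<or> ev e s = None")
      case True
      then show ?thesis
      proof
        assume "l = 0" then show ?thesis using inL(3) by (intro bexI[of _ "(0, Val s)"]) auto
      next
        assume "ev e s = None"
        then show ?thesis using inL(2) agree_None[OF same_position_agree[OF h(3)] inS(3,1)]
          by (intro bexI[of _ "(0, Infty)"]) (auto simp: v_ext_def)
      qed
    next
      case False
      then obtain a where a: "ev e s = Some a" and l: "l \<noteq> 0" by auto
      obtain a' where a': "ev e' s = Some a'" using agree_Some[OF same_position_agree[OF h(3)] inS(3,1) a] by blast
      note pos = same_positionD[OF h(3) inS(2), simplified, unfolded a a' v_ext_def, simplified]
      consider "v a = Some h" | "less_inf lt0 (v a) (Some h)" | "less_inf lt0 (Some h) (v a)"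
        using i0.less_linear by blast
      then show ?thesis
      proof cases
        case 1
        then show ?thesis using pos(1) a a' by (intro bexI[OF _ inL(4)]) (auto simp: v_ext_def)
      next
        case 2
        then have "less_inf lt0 (v a) (v (sc l h))" "less_inf lt0 (v a') (v (sc l h'))" using pos(2) h(1,2) l by auto
        then have "v (sc l h + a) = v a" "v (sc l h' + a') = v a'"
          using v_add_less by (metis add.commute)+
        then show ?thesis using a a' by (intro bexI[OF _ inL(3)]) (auto simp: v_ext_def)
      next
        case 3
        then have "less_inf lt0 (v (sc l h)) (v a)" "less_inf lt0 (v (sc l h')) (v a')" using pos(3) h(1,2) l by auto
        then have "v (sc l h + a) = Some h" "v (sc l h' + a') = Some h'"
          using v_add_less h(1,2) l by auto
        then show ?thesis using a a' by (intro bexI[OF _ inL(1)]) (auto simp: v_ext_def)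
      qed
    qed
    then show "\<exists>(m, u)\<in>?L. ev (e(j := Some h)) (Val t) = lin m h (ev e u) \<and> ev (e'(j := Some h')) (Val t) = lin m h' (ev e' u)"
      using ls by simp
  qed
qed

text \<open>The sign in question is that of \<open>(s' - s) + (l' - l) h\<close>. If the summands
  have different values, the one of smaller value decides; \<open>h\<close> is
  \<open>lt1\<close>-positive, so its summand has the sign of \<open>l' - l\<close>. If the values
  coincide, \<open>h\<close> is the value of \<open>s' - s\<close> and can be replaced by that
  term.\<close>

lemma val_linear_less1_agree:
  fixes s s' :: "('c, 'g option) trm"
  assumes S: "same_position S e h e' h'" "s \<in> S" "s' \<in> S" "Infty \<in> S" "Zero \<in> S"
    "diff_trm s' s \<in> S" "Val (diff_trm s' s) \<in> S" "Plus (diff_trm s' s) (Scal (l' - l) (Val (diff_trm s' s))) \<in> S"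
    and h: "v h = Some h" "v h' = Some h'"
  shows "less_inf lt1 (lin l h (ev e s)) (lin l' h (ev e s')) \<longleftrightarrow>
    less_inf lt1 (lin l h' (ev e' s)) (lin l' h' (ev e' s'))"
proof -
  have ag: "agree S e e'" using S by (auto simp: same_position_def)
  note N = agree_None[OF ag S(4) S(2)] agree_None[OF ag S(4) S(3)]
  show ?thesis
  proof (cases "ev e s = None \<or> ev e s' = None")
    case True
    then show ?thesis using N by (cases "ev e s"; cases "ev e s'"; cases "ev e' s"; cases "ev e' s'") auto
  next
    case False
    then obtain a b a' b' where ab: "ev e s = Some a" "ev e s' = Some b" "ev e' s = Some a'" "ev e' s' = Some b'"
      using N by fastforce
    have D: "ev e (diff_trm s' s) = Some (b - a)" "ev e' (diff_trm s' s) = Some (b' - a')" using ab by simp_all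
    have eq: "less_inf lt1 (lin l h (ev e s)) (lin l' h (ev e s')) \<longleftrightarrow> lt1 0 ((b - a) + sc (l' - l) h)"
      "less_inf lt1 (lin l h' (ev e' s)) (lin l' h' (ev e' s')) \<longleftrightarrow> lt1 0 ((b' - a') + sc (l' - l) h')"
      using ab by (simp_all add: o1.scaled_sum_less_iff) (simp_all add: o0.vs.scale_left_diff_distrib algebra_simps)
    have hpos: "lt1 0 h" "lt1 0 h'" using v_pos h by blast+
    have pos: "v (b - a) = Some h \<longleftrightarrow> v (b' - a') = Some h'"
      "less_inf lt0 (v (b - a)) (Some h) \<longleftrightarrow> less_inf lt0 (v (b' - a')) (Some h')"
      "less_inf lt0 (Some h) (v (b - a)) \<longleftrightarrow> less_inf lt0 (Some h') (v (b' - a'))"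
      using same_positionD[OF S(1) S(7)] unfolding eval.simps(7) D v_ext_def option.case by blast+
    have z: "lt1 0 (b - a) \<longleftrightarrow> lt1 0 (b' - a')" using agreeD(3)[OF ag S(5) S(6)] D by simp
    show ?thesis
    proof (cases "l = l'")
      case True then show ?thesis using z unfolding eq by simp
    next
      case False
      consider "v (b - a) = Some h" | "less_inf lt0 (v (b - a)) (Some h)" | "less_inf lt0 (Some h) (v (b - a))"
        using i0.less_linear by blast
      then show ?thesis
      proof cases
        case 1
        then show ?thesis unfolding eq using agreeD(3)[OF ag S(5) S(8)] ab pos(1) by (simp add: v_ext_def)
      next
        case 2
        then have "less_inf lt0 (v (b - a)) (v (sc (l' - l) h))" "less_inf lt0 (v (b' - a')) (v (sc (l' - l) h'))"
          using pos h False by simp_all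
        then show ?thesis unfolding eq using pos_add_iff z by simp
      next
        case 3
        then have "less_inf lt0 (v (sc (l' - l) h)) (v (b - a))" "less_inf lt0 (v (sc (l' - l) h')) (v (b' - a'))"
          using pos h False by simp_all
        then have "lt1 0 ((b - a) + sc (l' - l) h) \<longleftrightarrow> lt1 0 (sc (l' - l) h)"
          "lt1 0 ((b' - a') + sc (l' - l) h') \<longleftrightarrow> lt1 0 (sc (l' - l) h')"
          using pos_add_iff by (metis add.commute)+
        moreover have "lt1 0 (sc (l' - l) h) \<longleftrightarrow> lt1 0 (sc (l' - l) h')"
          using hpos False o1.less_asym o1.scale_pos_iff[of "l' - l"] o1.scale_neg_iff[of "l' - l"]
          by (cases "l < l'") auto
        ultimately show ?thesis unfolding eq by simp
      qed
    qed
  qed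
qed

lemma val_atoms_agree:
  fixes t t' :: "('c, 'g option) trm"
  assumes "params_trm t \<subseteq> A" "params_trm t' \<subseteq> A"
  shows "\<exists>S. finite S \<and> (\<forall>s\<in>S. params_trm s \<subseteq> A) \<and>
    (\<forall>e h e' h'. v h = Some h \<longrightarrow> v h' = Some h' \<longrightarrow> same_position S e h e' h' \<longrightarrow>
      agree {t, t'} (e(j := Some h)) (e'(j := Some h')))"
proof -
  define same where "same t t' e e' \<longleftrightarrow> (ev e t = ev e t' \<longleftrightarrow> ev e' t = ev e' t') \<and>
      (less_inf lt0 (ev e t) (ev e t') \<longleftrightarrow> less_inf lt0 (ev e' t) (ev e' t')) \<and>
      (less_inf lt1 (ev e t) (ev e t') \<longleftrightarrow> less_inf lt1 (ev e' t) (ev e' t'))" for t t' e e'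
  have one: "\<exists>S. finite S \<and> (\<forall>s\<in>S. params_trm s \<subseteq> A) \<and>
    (\<forall>e h e' h'. v h = Some h \<longrightarrow> v h' = Some h' \<longrightarrow> same_position S e h e' h' \<longrightarrow>
      same t t' (e(j := Some h)) (e'(j := Some h')))"
    if par: "params_trm t \<subseteq> A" "params_trm t' \<subseteq> A" for t t' :: "('c, 'g option) trm"
  proof -
    obtain S1 L1 S2 L2 where "val_linear A j t S1 L1" "val_linear A j t' S2 L2"
      using val_trm_linear par by meson
    note 1 = val_linearD[OF this(1)] and 2 = val_linearD[OF this(2)]
    let ?D = "\<lambda>s s'. diff_trm s' s :: ('c, 'g option) trm"
    let ?LL = "L1 \<times> L2"
    \<comment> \<open>Three families: intersection points for the \<open>lt0\<close>-position,
      differences whose values are compared with \<open>h\<close>, and the sums that decide the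
      \<open>lt1\<close>-sign when \<open>h\<close> is such a value.\<close>
    define X where "X = (\<lambda>((l, s), (l', s')). root_trm l s l' s') ` ?LL"
    define Y where "Y = (\<lambda>((l, s), (l', s')). ?D s s') ` ?LL"
    define Z where "Z = (\<lambda>((l, s), (l', s')). Plus (?D s s') (Scal (l' - l) (Val (?D s s')))) ` ?LL"
    let ?S = "S1 \<union> S2 \<union> snd ` L1 \<union> snd ` L2 \<union> {Infty, Zero} \<union> X \<union> Y \<union> Val ` Y \<union> Z"
    show ?thesis unfolding same_def
    proof (intro exI[of _ ?S] conjI allI impI)
      show "finite ?S" using 1(1,2) 2(1,2) by (simp add: X_def Y_def Z_def)
      have par: "params_trm s \<subseteq> A" if "(l, s) \<in> L1 \<or> (l, s) \<in> L2" for l s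
        using 1(4) 2(4) that by force
      have "params_trm s \<subseteq> A" if "s \<in> X \<union> Y \<union> Z" for s
        using that par unfolding X_def Y_def Z_def by fastforce
      then show "\<forall>s\<in>?S. params_trm s \<subseteq> A" using 1(3,4) 2(3,4) by fastforce
      fix e h e' h' assume h: "v h = Some h" "v h' = Some h'" "same_position ?S e h e' h'"
      obtain l s where ls: "(l, s) \<in> L1" "ev (e(j := Some h)) t = lin l h (ev e s)" "ev (e'(j := Some h')) t = lin l h' (ev e' s)"
        using 1(5)[OF h(1,2) same_position_mono[OF h(3)]] by blast
      obtain l' s' where ls': "(l', s') \<in> L2" "ev (e(j := Some h)) t' = lin l' h (ev e s')" "ev (e'(j := Some h')) t' = lin l' h' (ev e' s')"
        using 2(5)[OF h(1,2) same_position_mono[OF h(3)]] by blast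
      have "root_trm l s l' s' \<in> X" using ls(1) ls'(1) unfolding X_def by (intro rev_image_eqI[of "((l, s), (l', s'))"]) auto
      moreover have "?D s s' \<in> Y" using ls(1) ls'(1) unfolding Y_def by (intro rev_image_eqI[of "((l, s), (l', s'))"]) auto
      moreover have "Plus (?D s s') (Scal (l' - l) (Val (?D s s'))) \<in> Z"
        using ls(1) ls'(1) unfolding Z_def by (intro rev_image_eqI[of "((l, s), (l', s'))"]) auto
      moreover have "s \<in> snd ` L1" "s' \<in> snd ` L2" using ls(1) ls'(1) by (auto intro: rev_image_eqI)
      ultimately have inS: "s \<in> ?S" "s' \<in> ?S" "Infty \<in> ?S" "Zero \<in> ?S" "root_trm l s l' s' \<in> ?S" "?D s s' \<in> ?S" "Val (?D s s') \<in> ?S"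
        "Plus (?D s s') (Scal (l' - l) (Val (?D s s'))) \<in> ?S"
        by blast+
      show "ev (e(j := Some h)) t = ev (e(j := Some h)) t' \<longleftrightarrow> ev (e'(j := Some h')) t = ev (e'(j := Some h')) t'"
        "less_inf lt0 (ev (e(j := Some h)) t) (ev (e(j := Some h)) t') \<longleftrightarrow> less_inf lt0 (ev (e'(j := Some h')) t) (ev (e'(j := Some h')) t')"
        unfolding ls(2,3) ls'(2,3) using lin_atoms_agree0[OF h(3) inS(1,2,3,5)] by blast+
      show "less_inf lt1 (ev (e(j := Some h)) t) (ev (e(j := Some h)) t') \<longleftrightarrow> less_inf lt1 (ev (e'(j := Some h')) t) (ev (e'(j := Some h')) t')"
        unfolding ls(2,3) ls'(2,3) by (rule val_linear_less1_agree[OF h(3) inS(1,2,3,4,6,7,8) h(1,2)])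
    qed
  qed
  have irr: "\<not> less_inf lt0 p p" "\<not> less_inf lt1 p p" for p by (cases p; simp)+
  obtain S1 S2 where S: "finite S1" "finite S2" "\<forall>s\<in>S1 \<union> S2. params_trm s \<subseteq> A"
    "\<And>e h e' h'. v h = Some h \<Longrightarrow> v h' = Some h' \<Longrightarrow> same_position S1 e h e' h' \<Longrightarrow>
      same t t' (e(j := Some h)) (e'(j := Some h'))"
    "\<And>e h e' h'. v h = Some h \<Longrightarrow> v h' = Some h' \<Longrightarrow> same_position S2 e h e' h' \<Longrightarrow>
      same t' t (e(j := Some h)) (e'(j := Some h'))"
    using one[OF assms] one[OF assms(2,1)] by (metis UnE)
  show ?thesis
  proof (intro exI[of _ "S1 \<union> S2"] conjI allI impI)
    show "finite (S1 \<union> S2)" "\<forall>s\<in>S1 \<union> S2. params_trm s \<subseteq> A" using S(1-3) by auto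
    fix e h e' h' assume h: "v h = Some h" "v h' = Some h'" and pos: "same_position (S1 \<union> S2) e h e' h'"
    show "agree {t, t'} (e(j := Some h)) (e'(j := Some h'))"
      using S(4)[OF h same_position_mono[OF pos]] S(5)[OF h same_position_mono[OF pos]]
      unfolding agree_def same_def by (simp add: irr)
  qed
qed

primrec trms_fm :: "('c, 'g option) fm \<Rightarrow> ('c, 'g option) trm set" where
  "trms_fm (Eq s t) = {s, t}"
| "trms_fm (Less0 s t) = {s, t}"
| "trms_fm (Less1 s t) = {s, t}"
| "trms_fm (Neg f) = trms_fm f"
| "trms_fm (Conj f g) = trms_fm f \<union> trms_fm g"
| "trms_fm (Ex k f) = trms_fm f"

lemma finite_trms_fm: "finite (trms_fm f)" by (induction f) auto

lemma params_trms_fm: "t \<in> trms_fm f \<Longrightarrow> params_trm t \<subseteq> params_fm f" by (induction f) auto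

lemma val_count_trms_fm: "t \<in> trms_fm f \<Longrightarrow> val_count k t \<le> val_count_fm k f" by (induction f) auto

lemma sat_agree: "qf f \<Longrightarrow> agree (trms_fm f) e e' \<Longrightarrow> st e f = st e' f"
  by (induction f) (auto simp: agree_def)

lemma agree_pairs: "(\<And>s t. s \<in> T \<Longrightarrow> t \<in> T \<Longrightarrow> agree {s, t} e e') \<Longrightarrow> agree T e e'"
  unfolding agree_def by simp

text \<open>The truth value at \<open>h\<close> depends only on the cut of \<open>h\<close> among
  finitely many terms. A cut filled in one environment is filled in every environment of the same
  type: by the corresponding term if a term names \<open>h\<close>, and by density
  otherwise.\<close>

lemma qf_definable_ex_val:
  assumes "qf_definable A P"
  shows "qf_definable A (\<lambda>e. \<exists>h. v h = Some h \<and> P (e(j := Some h)))"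
proof -
  obtain f :: "('c, 'g option) fm" where f: "qf f" "params_fm f \<subseteq> A" "\<And>e. st e f = P e"
    using assms unfolding qf_definable_def by blast
  let ?T = "trms_fm f"
  define Q where "Q = (\<lambda>p S. finite S \<and> (\<forall>s\<in>S. params_trm s \<subseteq> A) \<and>
    (\<forall>e h e' h'. v h = Some h \<longrightarrow> v h' = Some h' \<longrightarrow> same_position S e h e' h' \<longrightarrow>
      agree {fst p, snd p} (e(j := Some h)) (e'(j := Some h'))))"
  have "\<forall>p\<in>?T \<times> ?T. \<exists>S. Q p S"
    unfolding Q_def
  proof (intro ballI val_atoms_agree)
    fix p assume "p \<in> ?T \<times> ?T"
    then show "params_trm (fst p) \<subseteq> A" "params_trm (snd p) \<subseteq> A"
      using subset_trans[OF params_trms_fm f(2)] by (auto simp only: mem_Times_iff)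
  qed
  then obtain F where F: "\<forall>p\<in>?T \<times> ?T. Q p (F p)" by (rule bchoice[THEN exE])
  define S where "S = \<Union> (F ` (?T \<times> ?T))"
  have "finite (F p) \<and> (\<forall>s\<in>F p. params_trm s \<subseteq> A)" if "p \<in> ?T \<times> ?T" for p
    using F[rule_format, OF that] unfolding Q_def by (elim conjE) (intro conjI)
  then have S: "finite S" "\<And>s. s \<in> S \<Longrightarrow> params_trm s \<subseteq> A"
    using finite_trms_fm[of f] unfolding S_def by (simp, blast)
  have fS: "st (e(j := Some h)) f = st (e'(j := Some h')) f"
    if h: "v h = Some h" "v h' = Some h'" and pos: "same_position S e h e' h'" for e h e' h'
  proof (rule sat_agree[OF f(1) agree_pairs])
    fix s t assume st: "s \<in> ?T" "t \<in> ?T"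
    then have "same_position (F (s, t)) e h e' h'" using pos by (elim same_position_mono) (auto simp: S_def)
    moreover have "Q (s, t) (F (s, t))" using F st by blast
    ultimately show "agree {s, t} (e(j := Some h)) (e'(j := Some h'))" using h unfolding Q_def fst_conv snd_conv by blast
  qed
  \<comment> \<open>The values of the terms are included in order to transfer
    \<open>v w = w\<close>: a term that names an element of the value set for \<open>e\<close> then
    does so for \<open>e'\<close>.\<close>
  let ?S = "S \<union> Val ` S \<union> {Infty}"
  show ?thesis
  proof (rule qf_definable_finitely_determined)
    show "finite ?S" "\<And>s. s \<in> ?S \<Longrightarrow> params_trm s \<subseteq> A" using S by (simp, fastforce)
    fix e e' assume ag: "agree ?S e e'" and "\<exists>h. v h = Some h \<and> P (e(j := Some h))"
    then obtain h where h: "v h = Some h" "P (e(j := Some h))" by blast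
    have agS: "agree S e e'" using ag by (rule agree_mono) auto
    have "\<exists>h'. v h' = Some h' \<and> same_position S e h e' h'"
    proof (cases "\<exists>w\<in>S. ev e w = Some h")
      case True
      then obtain w where w: "w \<in> S" "ev e w = Some h" by blast
      obtain h' where h': "ev e' w = Some h'" using agree_Some[OF ag _ _ w(2)] w(1) by auto
      have "v h' = Some h'" using agreeD(1)[OF ag, of "Val w" w] w h h' by (auto simp: v_ext_def)
      moreover have "same_position S e h e' h'"
        unfolding same_position_def using agS agreeD[OF agS _ w(1)] unfolding w(2) h' by blast
      ultimately show ?thesis by blast
    next
      case False
      \<comment> \<open>Terms that evaluate to infinity lie above everything and impose no
        condition, so only the finite ones bound the cut.\<close>
      let ?A0 = "{r. \<exists>w\<in>S. less_inf lt0 (ev e w) (Some h) \<and> ev e' w = Some r}"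
      let ?B0 = "{r. \<exists>w\<in>S. less_inf lt0 (Some h) (ev e w) \<and> ev e' w = Some r}"
      have sub: "?A0 \<subseteq> the ` (ev e' ` S)" "?B0 \<subseteq> the ` (ev e' ` S)" by force+
      have fin: "finite ?A0" "finite ?B0" using S(1) sub by (auto intro: finite_subset)
      have "lt0 x y" if xy: "x \<in> ?A0" "y \<in> ?B0" for x y
      proof -
        obtain w1 w2 where w: "w1 \<in> S" "less_inf lt0 (ev e w1) (Some h)" "ev e' w1 = Some x"
          "w2 \<in> S" "less_inf lt0 (Some h) (ev e w2)" "ev e' w2 = Some y" using xy by blast
        then have "less_inf lt0 (ev e w1) (ev e w2)" using i0.less_trans by blast
        then show ?thesis using agreeD(2)[OF agS w(1,4)] w by simp
      qed
      then obtain h' where h': "v h' = Some h'" "\<forall>x\<in>?A0. lt0 x h'" "\<forall>y\<in>?B0. lt0 h' y"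
        using dense_finite[OF fin] by blast
      have "same_position S e h e' h'"
        unfolding same_position_def
      proof (intro conjI ballI agS)
        fix w assume w: "w \<in> S"
        then have ne: "ev e w \<noteq> Some h" using False by blast
        have none: "ev e w = None \<longleftrightarrow> ev e' w = None" using agree_None[OF ag _ ] w by simp
        consider "less_inf lt0 (ev e w) (Some h)" | "less_inf lt0 (Some h) (ev e w)" using ne i0.less_linear by blast
        then have "ev e' w \<noteq> Some h' \<and> (less_inf lt0 (ev e w) (Some h) \<longleftrightarrow> less_inf lt0 (ev e' w) (Some h'))"
        proof cases
          case 1
          then obtain r where r: "ev e' w = Some r" using none by (cases "ev e' w") auto
          then have "lt0 r h'" using h'(2) 1 w by blast
          then show ?thesis using 1 r by auto
        next
          case 2
          show ?thesis
          proof (cases "ev e' w")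
            case None then show ?thesis using 2 none by auto
          next
            case (Some r)
            then have "lt0 h' r" using h'(3) 2 w by blast
            then show ?thesis using 2 Some o0.less_asym i0.less_asym by auto
          qed
        qed
        then show "ev e w = Some h \<longleftrightarrow> ev e' w = Some h'"
          "less_inf lt0 (ev e w) (Some h) \<longleftrightarrow> less_inf lt0 (ev e' w) (Some h')" using ne by blast+
      qed
      then show ?thesis using h' by blast
    qed
    then obtain h' where h': "v h' = Some h'" "same_position S e h e' h'" by blast
    then have "P (e'(j := Some h'))" using fS[OF h(1) h'] h(2) f(3) by blast
    then show "\<exists>h. v h = Some h \<and> P (e'(j := Some h))" using h' by blast
  qed
qed

section \<open>Quantifiers over elements with prescribed values\<close>

lemma flat_linear:
  fixes t :: "('c, 'g option) trm"
  assumes "val_count k t = 0"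
  shows "\<exists>l s. params_trm s \<subseteq> params_trm t \<and> vars_trm s \<subseteq> vars_trm t - {k} \<and>
    (\<forall>e x. ev (e(k := Some x)) t = lin l x (ev e s))"
  using assms
proof (induction t)
  case (Var i)
  show ?case
    by (cases "i = k"; rule exI[of _ "if i = k then 1 else 0"], rule exI[of _ "if i = k then Zero else Var i"]) auto
next
  case (Cst u) then show ?case by (intro exI[of _ 0] exI[of _ "Cst u"]) auto
next
  case Zero then show ?case by (intro exI[of _ 0] exI[of _ Zero]) auto
next
  case Infty then show ?case by (intro exI[of _ 0] exI[of _ Infty]) auto
next
  case (Plus t1 t2)
  then have "val_count k t1 = 0" "val_count k t2 = 0" by simp_all
  from Plus.IH(1)[OF this(1)] Plus.IH(2)[OF this(2)]
  obtain l s l' s' where s: "params_trm s \<subseteq> params_trm t1" "vars_trm s \<subseteq> vars_trm t1 - {k}"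
    "\<forall>e x. ev (e(k := Some x)) t1 = lin l x (ev e s)"
    "params_trm s' \<subseteq> params_trm t2" "vars_trm s' \<subseteq> vars_trm t2 - {k}"
    "\<forall>e x. ev (e(k := Some x)) t2 = lin l' x (ev e s')" by blast
  have sum: "oplus (lin l h p) (lin l' h q) = lin (l + l') h (oplus p q)" for l l' h p q
    by (cases p; cases q) (auto simp: o0.vs.scale_left_distrib)
  show ?case using s(1,2,4,5)
    by (intro exI[of _ "l + l'"] exI[of _ "Plus s s'"] conjI allI) (auto simp only: s(3,6) eval_Plus sum params_trm.simps vars_trm.simps)
next
  case (Scal c t)
  then have "val_count k t = 0" by simp
  from Scal.IH[OF this] obtain l s where s: "params_trm s \<subseteq> params_trm t" "vars_trm s \<subseteq> vars_trm t - {k}"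
    "\<forall>e x. ev (e(k := Some x)) t = lin l x (ev e s)" by blast
  have sca: "map_option (sc c) (lin l h p) = lin (c * l) h (map_option (sc c) p)" for l h p
    by (cases p) (auto simp: o0.vs.scale_right_distrib)
  show ?case using s(1,2)
    by (intro exI[of _ "c * l"] exI[of _ "Scal c s"] conjI allI) (auto simp only: s(3) eval.simps sca params_trm.simps vars_trm.simps)
next
  case (Val t)
  then have k: "k \<notin> vars_trm t" by (simp split: if_splits)
  have "ev (e(k := Some x)) t = ev e t" for e x using k by (intro eval_cong) auto
  then show ?case using k
    by (intro exI[of _ 0] exI[of _ "Val t"] conjI allI) (auto simp only: eval.simps lin_simps params_trm.simps vars_trm.simps)
qed

text \<open>For a general element the \<open>lt1\<close>-cut has to be recorded separately; for
  elements of the value set it could be read off from \<open>lt0\<close>-data.\<close>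

definition same_position2 ::
  "('c, 'g option) trm set \<Rightarrow> (nat \<Rightarrow> 'g option) \<Rightarrow> 'g \<Rightarrow> (nat \<Rightarrow> 'g option) \<Rightarrow> 'g \<Rightarrow> bool" where
  "same_position2 S e x e' x' \<longleftrightarrow> same_position S e x e' x' \<and>
     (\<forall>w\<in>S. less_inf lt1 (ev e w) (Some x) \<longleftrightarrow> less_inf lt1 (ev e' w) (Some x'))"

lemma same_position2_mono: "same_position2 S e x e' x' \<Longrightarrow> T \<subseteq> S \<Longrightarrow> same_position2 T e x e' x'"
  unfolding same_position2_def using same_position_mono by blast

lemma flat_atoms_agree:
  fixes t t' :: "('c, 'g option) trm"
  assumes "params_trm t \<subseteq> A" "params_trm t' \<subseteq> A" "val_count k t = 0" "val_count k t' = 0"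
  shows "\<exists>S. finite S \<and> (\<forall>s\<in>S. params_trm s \<subseteq> A) \<and>
    (\<forall>e x e' x'. same_position2 S e x e' x' \<longrightarrow> agree {t, t'} (e(k := Some x)) (e'(k := Some x')))"
proof -
  obtain l s where s: "params_trm s \<subseteq> params_trm t" "\<And>e x. ev (e(k := Some x)) t = lin l x (ev e s)"
    using flat_linear[OF assms(3)] by blast
  obtain l' s' where s': "params_trm s' \<subseteq> params_trm t'" "\<And>e x. ev (e(k := Some x)) t' = lin l' x (ev e s')"
    using flat_linear[OF assms(4)] by blast
  \<comment> \<open>Agreement compares the two terms in either order, and each order brings its own
    intersection term.\<close>
  let ?S = "{s, s', Infty, root_trm l s l' s', root_trm l' s' l s}"
  show ?thesis
  proof (intro exI[of _ ?S] conjI allI impI)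
    show "finite ?S" "\<forall>s\<in>?S. params_trm s \<subseteq> A" using s(1) s'(1) assms(1,2) by auto
    fix e x e' x' assume pos2: "same_position2 ?S e x e' x'"
    then have pos: "same_position ?S e x e' x'" by (simp add: same_position2_def)
    have ag: "agree ?S e e'" using pos same_position_agree by blast
    have less1: "less_inf lt1 (ev e w) (Some x) \<longleftrightarrow> less_inf lt1 (ev e' w) (Some x')"
      "less_inf lt1 (Some x) (ev e w) \<longleftrightarrow> less_inf lt1 (Some x') (ev e' w)" if "w \<in> ?S" for w
    proof -
      show 1: "less_inf lt1 (ev e w) (Some x) \<longleftrightarrow> less_inf lt1 (ev e' w) (Some x')"
        using pos2 that unfolding same_position2_def by blast
      show "less_inf lt1 (Some x) (ev e w) \<longleftrightarrow> less_inf lt1 (Some x') (ev e' w)"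
        using 1 same_positionD(1)[OF pos that] i1.less_linear i1.less_asym by metis
    qed
    have L1: "less_inf lt1 (lin m x (ev e u)) (lin m' x (ev e u')) \<longleftrightarrow> less_inf lt1 (lin m x' (ev e' u)) (lin m' x' (ev e' u'))"
      if u: "u \<in> ?S" "u' \<in> ?S" "root_trm m u m' u' \<in> ?S" for m u m' u'
    proof -
      note N = agree_None[OF ag _ u(1)] agree_None[OF ag _ u(2)]
      show ?thesis
      proof (cases "ev e u = None \<or> ev e u' = None")
        case True
        then show ?thesis using N by (cases "ev e u"; cases "ev e u'"; cases "ev e' u"; cases "ev e' u'") auto
      next
        case False
        then obtain a b a' b' where ab: "ev e u = Some a" "ev e u' = Some b" "ev e' u = Some a'" "ev e' u' = Some b'"
          using N by fastforce
        show ?thesis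
        proof (cases "m = m'")
          case True
          then show ?thesis using ab agreeD(3)[OF ag u(1,2)] by simp
        next
          case False
          show ?thesis using lin_root(3)[OF ab(1,2) False, of x] lin_root(3)[OF ab(3,4) False, of x'] less1[OF u(3)] by (simp only:)
        qed
      qed
    qed
    have irr: "\<not> less_inf lt0 p p" "\<not> less_inf lt1 p p" for p by (cases p; simp)+
    have inS: "s \<in> ?S" "s' \<in> ?S" "Infty \<in> ?S" "root_trm l s l' s' \<in> ?S" "root_trm l' s' l s \<in> ?S" by blast+
    show "agree {t, t'} (e(k := Some x)) (e'(k := Some x'))"
      using lin_atoms_agree0[OF pos inS(1,2,3,4)] lin_atoms_agree0[OF pos inS(2,1,3,5)]
        L1[OF inS(1,2,4)] L1[OF inS(2,1,5)]
      unfolding agree_def ball_simps s(2) s'(2) by (simp only: irr simp_thms ball_simps) 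
  qed
qed

text \<open>The prescribed values are finite, so \<open>x\<close> is never one of the centres. That
  case is always treated apart.\<close>

definition val_constraints ::
  "(('c, 'g option) trm \<times> ('c, 'g option) trm) set \<Rightarrow> (nat \<Rightarrow> 'g option) \<Rightarrow> 'g \<Rightarrow> bool" where
  "val_constraints \<Gamma> e x \<longleftrightarrow> (\<forall>s g. (s, g) \<in> \<Gamma> \<longrightarrow> (\<exists>a h. ev e s = Some a \<and> ev e g = Some h \<and> v (x - a) = Some h))"

text \<open>For an element named by a term the constraints become atomic, and hence can be carried
  from one environment to another.\<close>

lemma val_constraints_trm:
  fixes c :: "('c, 'g option) trm"
  assumes "ev e c = Some x"
  shows "val_constraints \<Gamma> e x \<longleftrightarrow>
    (\<forall>s g. (s, g) \<in> \<Gamma> \<longrightarrow> ev e (Val (diff_trm c s)) = ev e g \<and> ev e g \<noteq> None)"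
proof -
  have "(\<exists>a h. ev e s = Some a \<and> ev e g = Some h \<and> v (x - a) = Some h) \<longleftrightarrow>
    ev e (Val (diff_trm c s)) = ev e g \<and> ev e g \<noteq> None" for s g :: "('c, 'g option) trm"
    using assms by (cases "ev e s"; cases "ev e g") (auto simp: v_ext_def)
  then show ?thesis unfolding val_constraints_def by (simp only: )
qed

text \<open>A finite intersection of the intervals from \<open>v_eq_open\<close>, kept as sets of
  bounds in the format of \<open>indep_finite\<close>.\<close>

lemma val_constraints_open:
  assumes "finite \<Gamma>" "val_constraints \<Gamma> e y"
  shows "\<exists>P Q. finite P \<and> finite Q \<and> (\<forall>p\<in>P. lt1 p y) \<and> (\<forall>q\<in>Q. lt1 y q) \<and>
    (\<forall>z. (\<forall>p\<in>P. lt1 p z) \<longrightarrow> (\<forall>q\<in>Q. lt1 z q) \<longrightarrow> val_constraints \<Gamma> e z)"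
  using assms
proof (induction \<Gamma> rule: finite_induct)
  case empty
  show ?case by (intro exI[of _ "{}"]) (auto simp: val_constraints_def)
next
  case (insert g \<Gamma>)
  have c: "val_constraints (insert g \<Gamma>) e z \<longleftrightarrow> val_constraints {g} e z \<and> val_constraints \<Gamma> e z" for z
    by (cases g) (auto simp: val_constraints_def)
  obtain P Q where PQ: "finite P" "finite Q" "\<forall>p\<in>P. lt1 p y" "\<forall>q\<in>Q. lt1 y q"
    "\<And>z. \<forall>p\<in>P. lt1 p z \<Longrightarrow> \<forall>q\<in>Q. lt1 z q \<Longrightarrow> val_constraints \<Gamma> e z"
    using insert.IH insert.prems c by metis
  obtain a h where ah: "ev e (fst g) = Some a" "ev e (snd g) = Some h" "v (y - a) = Some h"
    using insert.prems c unfolding val_constraints_def by (cases g) auto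
  obtain p q where pq: "lt1 p y" "lt1 y q" "\<And>z. lt1 p z \<Longrightarrow> lt1 z q \<Longrightarrow> v (z - a) = Some h"
    using v_eq_open[OF ah(3)] by blast
  have "val_constraints {g} e z" if "lt1 p z" "lt1 z q" for z
    using pq(3)[OF that] ah unfolding val_constraints_def by (cases g) auto
  then show ?case using PQ pq(1,2) unfolding c
    by (intro exI[of _ "insert p P"] exI[of _ "insert q Q"]) auto
qed

lemma finite_pairwise_agree:
  fixes T :: "('c, 'g option) trm set"
  assumes "finite T" "\<And>s t. s \<in> T \<Longrightarrow> t \<in> T \<Longrightarrow> \<exists>S. finite S \<and> (\<forall>s\<in>S. params_trm s \<subseteq> A) \<and>
    (\<forall>e x e' x'. same_position2 S e x e' x' \<longrightarrow> agree {s, t} (e(k := Some x)) (e'(k := Some x')))"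
  shows "\<exists>S. finite S \<and> (\<forall>s\<in>S. params_trm s \<subseteq> A) \<and>
    (\<forall>e x e' x'. same_position2 S e x e' x' \<longrightarrow> agree T (e(k := Some x)) (e'(k := Some x')))"
proof -
  define Q where "Q = (\<lambda>p S. finite S \<and> (\<forall>s\<in>S. params_trm s \<subseteq> A) \<and>
    (\<forall>e x e' x'. same_position2 S e x e' x' \<longrightarrow> agree {fst p, snd p} (e(k := Some x)) (e'(k := Some x'))))"
  have "\<forall>p\<in>T \<times> T. \<exists>S. Q p S"
    unfolding Q_def by (intro ballI assms(2)) (simp_all only: mem_Times_iff)
  then obtain F where F: "\<forall>p\<in>T \<times> T. Q p (F p)" by (rule bchoice[THEN exE])
  define S where "S = \<Union> (F ` (T \<times> T))"
  have "finite (F p) \<and> (\<forall>s\<in>F p. params_trm s \<subseteq> A)" if "p \<in> T \<times> T" for p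
    using F[rule_format, OF that] unfolding Q_def by (elim conjE) (intro conjI)
  then have "finite S" "\<forall>s\<in>S. params_trm s \<subseteq> A"
    using assms(1) unfolding S_def by (simp, blast)
  moreover have "agree T (e(k := Some x)) (e'(k := Some x'))" if pos: "same_position2 S e x e' x'" for e x e' x'
  proof (rule agree_pairs)
    fix s t assume st: "s \<in> T" "t \<in> T"
    then have "same_position2 (F (s, t)) e x e' x'" using pos by (elim same_position2_mono) (auto simp: S_def)
    moreover have "Q (s, t) (F (s, t))" using F st by blast
    ultimately show "agree {s, t} (e(k := Some x)) (e'(k := Some x'))" unfolding Q_def fst_conv snd_conv by blast
  qed
  ultimately show ?thesis by blast
qed

text \<open>Since \<open>x\<close> enters \<open>f\<close> linearly, its cuts in both orders and the
  constraints decide everything. For a solution \<open>x\<close> at \<open>e\<close> that no term of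
  \<open>S\<close> names, some point \<open>y\<close> named by a term satisfies the constraints and
  lies in the \<open>lt1\<close>-cut of \<open>x\<close>. The counterpart \<open>y'\<close> at
  \<open>e'\<close> has an \<open>lt1\<close>-neighbourhood with the same properties, and
  independence finds in it a point of the required \<open>lt0\<close>-cut. Nonemptiness of
  \<open>\<Gamma>\<close> supplies the ball in which \<open>y\<close> is chosen.\<close>

lemma qf_definable_ex_flat:
  fixes f :: "('c, 'g option) fm"
  assumes f: "qf f" "params_fm f \<subseteq> A" "val_count_fm k f = 0"
    and \<Gamma>: "finite \<Gamma>" "\<Gamma> \<noteq> {}" "\<And>s g. (s, g) \<in> \<Gamma> \<Longrightarrow> params_trm s \<subseteq> A \<and> params_trm g \<subseteq> A"
  shows "qf_definable A (\<lambda>e. \<exists>x. st (e(k := Some x)) f \<and> val_constraints \<Gamma> e x)"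
proof -
  have "\<exists>S. finite S \<and> (\<forall>s\<in>S. params_trm s \<subseteq> A) \<and>
    (\<forall>e x e' x'. same_position2 S e x e' x' \<longrightarrow> agree (trms_fm f) (e(k := Some x)) (e'(k := Some x')))"
  proof (rule finite_pairwise_agree[OF finite_trms_fm])
    have *: "params_trm s \<subseteq> A" "val_count k s = 0" if "s \<in> trms_fm f" for s
      using subset_trans[OF params_trms_fm[OF that] f(2)] val_count_trms_fm[OF that, of k] f(3) by auto
    fix s t assume st: "s \<in> trms_fm f" "t \<in> trms_fm f"
    show "\<exists>S. finite S \<and> (\<forall>s\<in>S. params_trm s \<subseteq> A) \<and>
      (\<forall>e x e' x'. same_position2 S e x e' x' \<longrightarrow> agree {s, t} (e(k := Some x)) (e'(k := Some x')))"
      by (rule flat_atoms_agree[OF *(1)[OF st(1)] *(1)[OF st(2)] *(2)[OF st(1)] *(2)[OF st(2)]])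
  qed
  then obtain S where S: "finite S" "\<forall>s\<in>S. params_trm s \<subseteq> A"
    "\<And>e x e' x'. same_position2 S e x e' x' \<Longrightarrow> agree (trms_fm f) (e(k := Some x)) (e'(k := Some x'))" by blast
  have fS: "st (e(k := Some x)) f = st (e'(k := Some x')) f" if "same_position2 S e x e' x'" for e x e' x'
    using sat_agree[OF f(1) S(3)[OF that]] .
  define P where "P = S \<union> fst ` \<Gamma>"
  define G where "G = snd ` \<Gamma>"
  \<comment> \<open>The shapes offered by \<open>constrained_candidate\<close>: midpoints, and
    translates by a prescribed value in both directions.\<close>
  define C where "C = (\<lambda>(p, q). Scal (1/2) (Plus p q)) ` (P \<times> P) \<union> (\<lambda>(p, g). Plus p g) ` (P \<times> G)
    \<union> (\<lambda>(p, g). diff_trm p g) ` (P \<times> G)"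
  \<comment> \<open>These terms express the constraints at a candidate, or at a term of
    \<open>S\<close> that happens to name \<open>x\<close>.\<close>
  define D where "D = (\<lambda>(c, s). Val (diff_trm c s)) ` ((C \<union> S) \<times> fst ` \<Gamma>)"
  let ?S = "P \<union> G \<union> C \<union> D \<union> {Infty}"
  have parG: "\<And>g. g \<in> G \<Longrightarrow> params_trm g \<subseteq> A" and parP: "\<And>p. p \<in> P \<Longrightarrow> params_trm p \<subseteq> A"
    using \<Gamma>(3) S(2) by (auto simp: G_def P_def) (metis subsetD)+
  have parC: "params_trm c \<subseteq> A" if "c \<in> C" for c using that parG parP unfolding C_def by fastforce
  have parD: "params_trm c \<subseteq> A" if D: "c \<in> D" for c
  proof -
    obtain p where p: "p \<in> (C \<union> S) \<times> fst ` \<Gamma>" "c = Val (diff_trm (fst p) (snd p))"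
      using D unfolding D_def case_prod_beta by (rule imageE) blast
    then have "fst p \<in> C \<or> fst p \<in> P" "snd p \<in> P" unfolding P_def mem_Times_iff by blast+
    then show ?thesis using p(2) parC[of "fst p"] parP[of "fst p"] parP[of "snd p"] by auto
  qed
  show ?thesis
  proof (rule qf_definable_finitely_determined)
    show "finite ?S" using S(1) \<Gamma>(1) by (simp add: P_def G_def C_def D_def)
    show "params_trm s \<subseteq> A" if "s \<in> ?S" for s
      using that parG[of s] parP[of s] parC[of s] parD[of s] by (elim UnE) simp_all
    fix e e' assume ag: "agree ?S e e'" and "\<exists>x. st (e(k := Some x)) f \<and> val_constraints \<Gamma> e x"
    then obtain x where x: "st (e(k := Some x)) f" "val_constraints \<Gamma> e x" by blast
    have agS: "agree S e e'" using ag by (rule agree_mono) (auto simp: P_def)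
    have transfer: "\<exists>y'. ev e' c = Some y' \<and> val_constraints \<Gamma> e' y'"
      if c: "c \<in> C \<union> S" "ev e c = Some y" "val_constraints \<Gamma> e y" for c y
    proof -
      obtain y' where y': "ev e' c = Some y'" using agree_Some[OF ag _ _ c(2)] c(1) by (auto simp: P_def)
      have "ev e' (Val (diff_trm c s)) = ev e' g \<and> ev e' g \<noteq> None" if sg: "(s, g) \<in> \<Gamma>" for s g
      proof -
        have "s \<in> fst ` \<Gamma>" "g \<in> G" using sg by (auto simp: G_def intro: rev_image_eqI)
        then have "Val (diff_trm c s) \<in> D" using c(1) unfolding D_def by (intro rev_image_eqI[of "(c, s)"]) auto
        then show ?thesis
          using agreeD(1)[OF ag, of "Val (diff_trm c s)" g] agree_None[OF ag, of g] \<open>g \<in> G\<close>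
            c(3) sg unfolding val_constraints_trm[OF c(2)] by blast
      qed
      then have "val_constraints \<Gamma> e' y'" unfolding val_constraints_trm[OF y'] by blast
      then show ?thesis using y' by blast
    qed
    have "\<exists>x'. same_position2 S e x e' x' \<and> val_constraints \<Gamma> e' x'"
    proof (cases "\<exists>w\<in>S. ev e w = Some x")
      case True
      then obtain w where w: "w \<in> S" "ev e w = Some x" by blast
      then obtain x' where x': "ev e' w = Some x'" "val_constraints \<Gamma> e' x'" using transfer x(2) by blast
      have "same_position2 S e x e' x'"
        unfolding same_position2_def same_position_def
        using agS agreeD[OF agS _ w(1)] unfolding w(2) x'(1) by blast
      then show ?thesis using x' by blast
    next
      case False
      define R where "R = {r. \<exists>w\<in>S. ev e w = Some r}"
      define \<Delta> where "\<Delta> = {(a, h). \<exists>s g. (s, g) \<in> \<Gamma> \<and> ev e s = Some a \<and> ev e g = Some h}"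
      have "R \<subseteq> the ` (ev e ` S)" unfolding R_def by force
      then have finR: "finite R" using S(1) by (auto intro: finite_subset)
      have "\<Delta> \<subseteq> (\<lambda>(s, g). (the (ev e s), the (ev e g))) ` \<Gamma>" unfolding \<Delta>_def by force
      then have fin\<Delta>: "finite \<Delta>" using \<Gamma>(1) by (auto intro: finite_subset)
      have ne\<Delta>: "\<Delta> \<noteq> {}" using \<Gamma>(2) x(2) unfolding \<Delta>_def val_constraints_def by fastforce
      have xR: "x \<notin> R" using False by (auto simp: R_def)
      have x\<Delta>: "v (x - a) = Some h" if "(a, h) \<in> \<Delta>" for a h
        using that x(2) unfolding \<Delta>_def val_constraints_def by fastforce
      obtain y where y: "(\<exists>p\<in>R \<union> fst ` \<Delta>. \<exists>q\<in>R \<union> fst ` \<Delta>. y = sc (1/2) (p + q)) \<or>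
          (\<exists>p\<in>R \<union> fst ` \<Delta>. \<exists>h\<in>snd ` \<Delta>. y = p + h \<or> y = p - h)"
        and yR: "\<forall>r\<in>R. (lt1 r y \<longleftrightarrow> lt1 r x) \<and> r \<noteq> y"
        and y\<Delta>: "\<forall>a h. (a, h) \<in> \<Delta> \<longrightarrow> v (y - a) = Some h"
        by (rule exE[OF constrained_candidate[OF finR fin\<Delta> ne\<Delta> xR]]) (erule x\<Delta>, elim conjE, rule that)
      have \<Delta>P: "(\<exists>t\<in>P. ev e t = Some a) \<and> (\<exists>t\<in>G. ev e t = Some h)" if ah: "(a, h) \<in> \<Delta>" for a h
      proof -
        obtain s g where sg: "(s, g) \<in> \<Gamma>" "ev e s = Some a" "ev e g = Some h" using ah unfolding \<Delta>_def by blast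
        then have "s \<in> P" "g \<in> G" unfolding P_def G_def by (auto intro: rev_image_eqI)
        then show ?thesis using sg by blast
      qed
      then have inP: "\<exists>t\<in>P. ev e t = Some p" if "p \<in> R \<union> fst ` \<Delta>" for p
        using that unfolding P_def R_def by auto
      have inG: "\<exists>t\<in>G. ev e t = Some h" if "h \<in> snd ` \<Delta>" for h
        using that \<Delta>P by auto
      have "\<exists>c\<in>C. ev e c = Some y"
        using y
      proof (elim disjE bexE)
        fix p q assume "p \<in> R \<union> fst ` \<Delta>" "q \<in> R \<union> fst ` \<Delta>" and yy: "y = sc (1/2) (p + q)"
        then obtain s t where st: "s \<in> P" "t \<in> P" "ev e s = Some p" "ev e t = Some q" using inP by metis
        then show ?thesis unfolding C_def by (intro bexI[of _ "Scal (1/2) (Plus s t)"]) (auto simp: yy)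
      next
        fix p h assume "p \<in> R \<union> fst ` \<Delta>" "h \<in> snd ` \<Delta>" and yy: "y = p + h"
        then obtain s t where st: "s \<in> P" "t \<in> G" "ev e s = Some p" "ev e t = Some h" using inP inG by metis
        then show ?thesis unfolding C_def by (intro bexI[of _ "Plus s t"]) (auto simp: yy)
      next
        fix p h assume "p \<in> R \<union> fst ` \<Delta>" "h \<in> snd ` \<Delta>" and yy: "y = p - h"
        then obtain s t where st: "s \<in> P" "t \<in> G" "ev e s = Some p" "ev e t = Some h" using inP inG by metis
        then show ?thesis unfolding C_def by (intro bexI[of _ "diff_trm s t"]) (auto simp: yy)
      qed
      then obtain c where c: "c \<in> C" "ev e c = Some y" by blast
      have "val_constraints \<Gamma> e y" unfolding val_constraints_def
      proof (intro allI impI)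
        fix s g assume sg: "(s, g) \<in> \<Gamma>"
        then obtain a h where ah: "ev e s = Some a" "ev e g = Some h" using x(2) unfolding val_constraints_def by blast
        then have "(a, h) \<in> \<Delta>" using sg unfolding \<Delta>_def by blast
        then show "\<exists>a h. ev e s = Some a \<and> ev e g = Some h \<and> v (y - a) = Some h" using y\<Delta> ah by blast
      qed
      then obtain y' where y': "ev e' c = Some y'" "val_constraints \<Gamma> e' y'" using transfer c by blast
      have cS: "c \<in> ?S" and SS: "\<And>w. w \<in> S \<Longrightarrow> w \<in> ?S" using c by (auto simp: P_def)
      have lt1y: "less_inf lt1 (ev e w) (Some x) \<longleftrightarrow> less_inf lt1 (ev e' w) (Some y')" "ev e' w \<noteq> Some y'" if w: "w \<in> S" for w
      proof -
        have 1: "less_inf lt1 (ev e w) (Some x) \<longleftrightarrow> less_inf lt1 (ev e w) (Some y)" and 2: "ev e w \<noteq> Some y"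
          using yR w by (cases "ev e w"; auto simp: R_def)+
        show "less_inf lt1 (ev e w) (Some x) \<longleftrightarrow> less_inf lt1 (ev e' w) (Some y')" "ev e' w \<noteq> Some y'"
          using 1 2 agreeD[OF ag SS[OF w] cS] unfolding c(2) y'(1) by blast+
      qed
      obtain U W where UW: "finite U" "finite W" "\<forall>p\<in>U. lt1 p y'" "\<forall>q\<in>W. lt1 y' q"
        "\<And>z. \<forall>p\<in>U. lt1 p z \<Longrightarrow> \<forall>q\<in>W. lt1 z q \<Longrightarrow> val_constraints \<Gamma> e' z"
        using val_constraints_open[OF \<Gamma>(1) y'(2)] by blast
      define R' where "R' = {r. \<exists>w\<in>S. ev e' w = Some r}"
      have "R' \<subseteq> the ` (ev e' ` S)" unfolding R'_def by force
      then have finR': "finite R'" using S(1) by (auto intro: finite_subset)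
      let ?A0 = "{r. \<exists>w\<in>S. less_inf lt0 (ev e w) (Some x) \<and> ev e' w = Some r}"
      let ?B0 = "{r. \<exists>w\<in>S. less_inf lt0 (Some x) (ev e w) \<and> ev e' w = Some r}"
      \<comment> \<open>For \<open>lt0\<close> the bounds describe the cut of \<open>x\<close>; for
        \<open>lt1\<close> they describe the cut of \<open>y'\<close>, narrowed to the neighbourhood
        on which the constraints persist.\<close>
      let ?A1 = "U \<union> {r \<in> R'. lt1 r y'}" and ?B1 = "W \<union> {r \<in> R'. lt1 y' r}"
      have "?A0 \<subseteq> R'" "?B0 \<subseteq> R'" unfolding R'_def by blast+
      then have fin: "finite ?A0" "finite ?B0" "finite ?A1" "finite ?B1"
        using finR' UW(1,2) by (auto intro: finite_subset)
      have AB0: "lt0 a b" if ab: "a \<in> ?A0" "b \<in> ?B0" for a b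
      proof -
        obtain w1 w2 where w: "w1 \<in> S" "less_inf lt0 (ev e w1) (Some x)" "ev e' w1 = Some a"
          "w2 \<in> S" "less_inf lt0 (Some x) (ev e w2)" "ev e' w2 = Some b" using ab by blast
        then have "less_inf lt0 (ev e w1) (ev e w2)" using i0.less_trans by blast
        then show ?thesis using agreeD(2)[OF agS w(1,4)] w by simp
      qed
      have AB1: "lt1 a b" if "a \<in> ?A1" "b \<in> ?B1" for a b
      proof -
        have "lt1 a y'" "lt1 y' b" using that UW(3,4) by blast+
        then show ?thesis using o1.less_trans by blast
      qed
      obtain z where z: "\<forall>a\<in>?A0. lt0 a z" "\<forall>b\<in>?B0. lt0 z b" "\<forall>a\<in>?A1. lt1 a z" "\<forall>b\<in>?B1. lt1 z b"
        by (rule exE[OF indep_finite[OF fin]]) (erule (1) AB0, erule (1) AB1, elim conjE, rule that)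
      have "val_constraints \<Gamma> e' z" using UW(5) z(3,4) by blast
      moreover have "same_position2 S e x e' z"
        unfolding same_position2_def same_position_def
      proof (intro conjI ballI agS)
        fix w assume w: "w \<in> S"
        then have ne: "ev e w \<noteq> Some x" using False by blast
        have none: "ev e w = None \<longleftrightarrow> ev e' w = None" using agree_None[OF ag _ SS[OF w]] by simp
        consider "less_inf lt0 (ev e w) (Some x)" | "less_inf lt0 (Some x) (ev e w)" using ne i0.less_linear by blast
        then have "ev e' w \<noteq> Some z \<and> (less_inf lt0 (ev e w) (Some x) \<longleftrightarrow> less_inf lt0 (ev e' w) (Some z))"
        proof cases
          case 1
          then obtain r where r: "ev e' w = Some r" using none by (cases "ev e' w") auto
          then have "lt0 r z" using z(1) 1 w by blast
          then show ?thesis using 1 r by auto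
        next
          case 2
          show ?thesis
          proof (cases "ev e' w")
            case None then show ?thesis using 2 none by auto
          next
            case (Some r)
            then have "lt0 z r" using z(2) 2 w by blast
            then show ?thesis using 2 Some o0.less_asym i0.less_asym by auto
          qed
        qed
        then show "ev e w = Some x \<longleftrightarrow> ev e' w = Some z"
          "less_inf lt0 (ev e w) (Some x) \<longleftrightarrow> less_inf lt0 (ev e' w) (Some z)" using ne by blast+
        show "less_inf lt1 (ev e w) (Some x) \<longleftrightarrow> less_inf lt1 (ev e' w) (Some z)"
          unfolding lt1y(1)[OF w]
        proof (cases "ev e' w")
          case (Some r)
          then have r: "r \<in> R'" using w by (auto simp: R'_def)
          consider "lt1 r y'" | "lt1 y' r" using lt1y(2)[OF w] Some o1.less_linear by blast
          then show "less_inf lt1 (ev e' w) (Some y') \<longleftrightarrow> less_inf lt1 (ev e' w) (Some z)"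
          proof cases
            case 1
            then have "lt1 r z" using z(3) r by blast
            then show ?thesis using 1 Some by simp
          next
            case 2
            then have "lt1 z r" using z(4) r by blast
            then show ?thesis using 2 Some o1.less_asym by auto
          qed
        qed simp
      qed
      ultimately show ?thesis by blast
    qed
    then obtain x' where "same_position2 S e x e' x'" "val_constraints \<Gamma> e' x'" by blast
    then show "\<exists>x. st (e'(k := Some x)) f \<and> val_constraints \<Gamma> e' x" using fS x(1) by blast
  qed
qed

section \<open>Naming the values that involve the bound variable\<close>

lemma replace_val_trm:
  fixes t :: "('c, 'g option) trm"
  assumes "0 < val_count k t" "j \<notin> vars_trm t" "j \<noteq> k"
  shows "\<exists>u t'. val_count k u = 0 \<and> val_count k t' < val_count k t \<and> vars_trm u \<subseteq> vars_trm t \<and>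
    params_trm u \<subseteq> params_trm t \<and> params_trm t' \<subseteq> params_trm t \<and>
    (\<forall>e. ev e t = ev (e(j := v_ext v (ev e u))) t')"
  using assms
proof (induction t)
  case (Plus s t)
  have j: "ev (e(j := w)) s = ev e s" "ev (e(j := w)) t = ev e t" for e w
    using Plus.prems(2) by (auto intro!: eval_cong)
  show ?case
  proof (cases "0 < val_count k s")
    case True
    then obtain u s' where u: "val_count k u = 0" "val_count k s' < val_count k s" "vars_trm u \<subseteq> vars_trm s"
      "params_trm u \<subseteq> params_trm s" "params_trm s' \<subseteq> params_trm s"
      "\<forall>e. ev e s = ev (e(j := v_ext v (ev e u))) s'"
      using Plus.IH(1) Plus.prems(2,3) by (metis Un_iff vars_trm.simps(5))
    have E: "\<forall>e. ev e (Plus s t) = ev (e(j := v_ext v (ev e u))) (Plus s' t)"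
      using u(6) j by (simp only: eval_Plus) metis
    show ?thesis by (intro exI[of _ u] exI[of _ "Plus s' t"] conjI E) (use u(1-5) in auto)
  next
    case False
    then have "0 < val_count k t" using Plus.prems by simp
    then obtain u t' where u: "val_count k u = 0" "val_count k t' < val_count k t" "vars_trm u \<subseteq> vars_trm t"
      "params_trm u \<subseteq> params_trm t" "params_trm t' \<subseteq> params_trm t"
      "\<forall>e. ev e t = ev (e(j := v_ext v (ev e u))) t'"
      using Plus.IH(2) Plus.prems(2,3) by (metis Un_iff vars_trm.simps(5))
    have E: "\<forall>e. ev e (Plus s t) = ev (e(j := v_ext v (ev e u))) (Plus s t')"
      using u(6) j by (simp only: eval_Plus) metis
    show ?thesis by (intro exI[of _ u] exI[of _ "Plus s t'"] conjI E) (use u(1-5) in auto)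
  qed
next
  case (Scal c t)
  then obtain u t' where u: "val_count k u = 0" "val_count k t' < val_count k t" "vars_trm u \<subseteq> vars_trm t"
    "params_trm u \<subseteq> params_trm t" "params_trm t' \<subseteq> params_trm t"
    "\<forall>e. ev e t = ev (e(j := v_ext v (ev e u))) t'"
    using Scal.IH Scal.prems by (metis val_count.simps(6) vars_trm.simps(6))
  have E: "\<forall>e. ev e (Scal c t) = ev (e(j := v_ext v (ev e u))) (Scal c t')"
    using u(6) by (simp only: eval.simps) metis
  show ?case by (intro exI[of _ u] exI[of _ "Scal c t'"] conjI E) (use u(1-5) in auto)
next
  case (Val t)
  show ?case
  proof (cases "0 < val_count k t")
    case True
    then obtain u t' where u: "val_count k u = 0" "val_count k t' < val_count k t" "vars_trm u \<subseteq> vars_trm t"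
      "params_trm u \<subseteq> params_trm t" "params_trm t' \<subseteq> params_trm t"
      "\<forall>e. ev e t = ev (e(j := v_ext v (ev e u))) t'"
      using Val.IH Val.prems by (metis vars_trm.simps(7))
    have "k \<in> vars_trm t" using True by (induction t) (auto split: if_splits)
    then have V: "val_count k (Val t') < val_count k (Val t)" using u(2) by simp
    have E: "\<forall>e. ev e (Val t) = ev (e(j := v_ext v (ev e u))) (Val t')"
      using u(6) by (simp only: eval.simps) metis
    show ?thesis by (intro exI[of _ u] exI[of _ "Val t'"] conjI E V) (use u(1,3-5) in auto)
  next
    \<comment> \<open>An innermost value has been reached: its argument is linear in the variable
      \<open>k\<close>, and the fresh variable \<open>j\<close> stands for the whole of
      \<open>Val t\<close>.\<close>
    case False
    have E: "\<forall>e. ev e (Val t) = ev (e(j := v_ext v (ev e t))) (Var j)" by simp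
    show ?thesis by (intro exI[of _ t] exI[of _ "Var j"] conjI E) (use False Val.prems in auto)
  qed
qed auto

text \<open>A single occurrence is renamed at a time; the rest of the formula does not notice the
  update at \<open>j\<close>, because \<open>j\<close> is fresh.\<close>

lemma replace_val_fm:
  fixes f :: "('c, 'g option) fm"
  assumes "qf f" "0 < val_count_fm k f" "j \<notin> vars_fm f" "j \<noteq> k"
  shows "\<exists>u f'. qf f' \<and> val_count k u = 0 \<and> val_count_fm k f' < val_count_fm k f \<and> vars_trm u \<subseteq> vars_fm f \<and>
    params_trm u \<subseteq> params_fm f \<and> params_fm f' \<subseteq> params_fm f \<and>
    (\<forall>e. st e f = st (e(j := v_ext v (ev e u))) f')"
proof -
  have atom: "\<exists>u s' t'. val_count k u = 0 \<and> val_count k s' + val_count k t' < val_count k s + val_count k t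
      \<and> vars_trm u \<subseteq> vars_trm s \<union> vars_trm t \<and> params_trm u \<subseteq> params_trm s \<union> params_trm t
      \<and> params_trm s' \<union> params_trm t' \<subseteq> params_trm s \<union> params_trm t
      \<and> (\<forall>e. ev e s = ev (e(j := v_ext v (ev e u))) s' \<and> ev e t = ev (e(j := v_ext v (ev e u))) t')"
    if st: "0 < val_count k s + val_count k t" "j \<notin> vars_trm s \<union> vars_trm t" for s t :: "('c, 'g option) trm"
  proof -
    have j: "ev (e(j := w)) s = ev e s" "ev (e(j := w)) t = ev e t" for e w
      using st(2) by (auto intro!: eval_cong)
    show ?thesis
    proof (cases "0 < val_count k s")
      case True
      then obtain u s' where u: "val_count k u = 0" "val_count k s' < val_count k s" "vars_trm u \<subseteq> vars_trm s"
        "params_trm u \<subseteq> params_trm s" "params_trm s' \<subseteq> params_trm s"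
        "\<forall>e. ev e s = ev (e(j := v_ext v (ev e u))) s'"
        using replace_val_trm[of k s j] st(2) assms(4) by (metis Un_iff)
      have E: "\<forall>e. ev e s = ev (e(j := v_ext v (ev e u))) s' \<and> ev e t = ev (e(j := v_ext v (ev e u))) t"
        using j u(6) by metis
      show ?thesis by (intro exI[of _ u] exI[of _ s'] exI[of _ t] conjI E) (use u(1-5) in auto)
    next
      case False
      then obtain u t' where u: "val_count k u = 0" "val_count k t' < val_count k t" "vars_trm u \<subseteq> vars_trm t"
        "params_trm u \<subseteq> params_trm t" "params_trm t' \<subseteq> params_trm t"
        "\<forall>e. ev e t = ev (e(j := v_ext v (ev e u))) t'"
        using replace_val_trm[of k t j] st assms(4) by (metis Un_iff add_is_0 gr0I)
      have E: "\<forall>e. ev e s = ev (e(j := v_ext v (ev e u))) s \<and> ev e t = ev (e(j := v_ext v (ev e u))) t'"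
        using j u(6) by metis
      show ?thesis by (intro exI[of _ u] exI[of _ s] exI[of _ t'] conjI E) (use u(1-5) in auto)
    qed
  qed
  show ?thesis using assms(1-3)
  proof (induction f)
    case (Eq s t)
    then have "0 < val_count k s + val_count k t" "j \<notin> vars_trm s \<union> vars_trm t" by simp_all
    from atom[OF this] obtain u s' t' where u: "val_count k u = 0" "val_count k s' + val_count k t' < val_count k s + val_count k t"
      "vars_trm u \<subseteq> vars_trm s \<union> vars_trm t" "params_trm u \<subseteq> params_trm s \<union> params_trm t"
      "params_trm s' \<union> params_trm t' \<subseteq> params_trm s \<union> params_trm t"
      "\<forall>e. ev e s = ev (e(j := v_ext v (ev e u))) s' \<and> ev e t = ev (e(j := v_ext v (ev e u))) t'" by blast
    then have E: "\<forall>e. st e (Eq s t) = st (e(j := v_ext v (ev e u))) (Eq s' t')" by (simp only: sat.simps) metis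
    show ?case by (intro exI[of _ u] exI[of _ "Eq s' t'"] conjI E) (use u(1-5) in auto)
  next
    case (Less0 s t)
    then have "0 < val_count k s + val_count k t" "j \<notin> vars_trm s \<union> vars_trm t" by simp_all
    from atom[OF this] obtain u s' t' where u: "val_count k u = 0" "val_count k s' + val_count k t' < val_count k s + val_count k t"
      "vars_trm u \<subseteq> vars_trm s \<union> vars_trm t" "params_trm u \<subseteq> params_trm s \<union> params_trm t"
      "params_trm s' \<union> params_trm t' \<subseteq> params_trm s \<union> params_trm t"
      "\<forall>e. ev e s = ev (e(j := v_ext v (ev e u))) s' \<and> ev e t = ev (e(j := v_ext v (ev e u))) t'" by blast
    then have E: "\<forall>e. st e (Less0 s t) = st (e(j := v_ext v (ev e u))) (Less0 s' t')" by (simp only: sat.simps) metis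
    show ?case by (intro exI[of _ u] exI[of _ "Less0 s' t'"] conjI E) (use u(1-5) in auto)
  next
    case (Less1 s t)
    then have "0 < val_count k s + val_count k t" "j \<notin> vars_trm s \<union> vars_trm t" by simp_all
    from atom[OF this] obtain u s' t' where u: "val_count k u = 0" "val_count k s' + val_count k t' < val_count k s + val_count k t"
      "vars_trm u \<subseteq> vars_trm s \<union> vars_trm t" "params_trm u \<subseteq> params_trm s \<union> params_trm t"
      "params_trm s' \<union> params_trm t' \<subseteq> params_trm s \<union> params_trm t"
      "\<forall>e. ev e s = ev (e(j := v_ext v (ev e u))) s' \<and> ev e t = ev (e(j := v_ext v (ev e u))) t'" by blast
    then have E: "\<forall>e. st e (Less1 s t) = st (e(j := v_ext v (ev e u))) (Less1 s' t')" by (simp only: sat.simps) metis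
    show ?case by (intro exI[of _ u] exI[of _ "Less1 s' t'"] conjI E) (use u(1-5) in auto)
  next
    case (Neg f)
    then obtain u f' where u: "qf f'" "val_count k u = 0" "val_count_fm k f' < val_count_fm k f" "vars_trm u \<subseteq> vars_fm f"
      "params_trm u \<subseteq> params_fm f" "params_fm f' \<subseteq> params_fm f"
      "\<forall>e. st e f = st (e(j := v_ext v (ev e u))) f'"
      using Neg.IH by (metis qf.simps(4) val_count_fm.simps(4) vars_fm.simps(4))
    then have E: "\<forall>e. st e (Neg f) = st (e(j := v_ext v (ev e u))) (Neg f')" by (simp only: sat.simps) metis
    show ?case by (intro exI[of _ u] exI[of _ "Neg f'"] conjI E) (use u(1-6) in auto)
  next
    case (Conj f g)
    have q: "qf f" "qf g" "j \<notin> vars_fm f" "j \<notin> vars_fm g" using Conj.prems by simp_all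
    have j: "st (e(j := w)) f = st e f" "st (e(j := w)) g = st e g" for e w
      using q by (auto intro!: sat_cong)
    show ?case
    proof (cases "0 < val_count_fm k f")
      case True
      then obtain u f' where u: "qf f'" "val_count k u = 0" "val_count_fm k f' < val_count_fm k f" "vars_trm u \<subseteq> vars_fm f"
        "params_trm u \<subseteq> params_fm f" "params_fm f' \<subseteq> params_fm f"
        "\<forall>e. st e f = st (e(j := v_ext v (ev e u))) f'"
        using Conj.IH(1) q by metis
      then have E: "\<forall>e. st e (Conj f g) = st (e(j := v_ext v (ev e u))) (Conj f' g)"
        using j by (simp only: sat.simps) metis
      show ?thesis by (intro exI[of _ u] exI[of _ "Conj f' g"] conjI E) (use u(1-6) q in auto)
    next
      case False
      then have "0 < val_count_fm k g" using Conj.prems by simp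
      then obtain u g' where u: "qf g'" "val_count k u = 0" "val_count_fm k g' < val_count_fm k g" "vars_trm u \<subseteq> vars_fm g"
        "params_trm u \<subseteq> params_fm g" "params_fm g' \<subseteq> params_fm g"
        "\<forall>e. st e g = st (e(j := v_ext v (ev e u))) g'"
        using Conj.IH(2) q by metis
      then have E: "\<forall>e. st e (Conj f g) = st (e(j := v_ext v (ev e u))) (Conj f g')"
        using j by (simp only: sat.simps) metis
      show ?thesis by (intro exI[of _ u] exI[of _ "Conj f g'"] conjI E) (use u(1-6) q in auto)
    qed
  qed auto
qed

lemma val_constraints_cong:
  assumes "\<And>s g i. (s, g) \<in> \<Gamma> \<Longrightarrow> i \<in> vars_trm s \<union> vars_trm g \<Longrightarrow> e i = e' i"
  shows "val_constraints \<Gamma> e x \<longleftrightarrow> val_constraints \<Gamma> e' x"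
proof -
  have "ev e s = ev e' s \<and> ev e g = ev e' g" if "(s, g) \<in> \<Gamma>" for s g
    using assms[OF that] by (auto intro!: eval_cong)
  then show ?thesis unfolding val_constraints_def by metis
qed

text \<open>The innermost value \<open>v (x - c)\<close> involving \<open>x\<close> is replaced by a new variable ranging over the
  value set, at the price of one more constraint on \<open>x\<close>.\<close>

lemma qf_definable_ex_constrained:
  fixes f :: "('c, 'g option) fm"
  assumes "qf f" "params_fm f \<subseteq> A"
    and "finite \<Gamma>" "\<Gamma> \<noteq> {}" "\<And>s g. (s, g) \<in> \<Gamma> \<Longrightarrow> params_trm s \<subseteq> A \<and> params_trm g \<subseteq> A"
  shows "qf_definable A (\<lambda>e. \<exists>x. st (e(k := Some x)) f \<and> val_constraints \<Gamma> e x)"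
  using assms
proof (induction "val_count_fm k f" arbitrary: f \<Gamma> rule: less_induct)
  case less
  note prems = less.prems
  show ?case
  proof (cases "val_count_fm k f = 0")
    case True
    then show ?thesis using qf_definable_ex_flat[OF prems(1,2) _ prems(3,4)] prems(5) by blast
  next
    case False
    define B where "B = insert k (vars_fm f \<union> (\<Union>(s, g)\<in>\<Gamma>. vars_trm s \<union> vars_trm g))"
    have "finite B" using prems(3) finite_vars_fm[of f] finite_vars_trm by (auto simp: B_def)
    then obtain j where j: "j \<notin> B" using ex_new_if_finite infinite_UNIV_nat by blast
    then have j: "j \<notin> vars_fm f" "j \<noteq> k" "\<And>s g. (s, g) \<in> \<Gamma> \<Longrightarrow> j \<notin> vars_trm s \<union> vars_trm g"
      by (auto simp: B_def)
    have \<Gamma>j: "val_constraints \<Gamma> (e(j := w)) x \<longleftrightarrow> val_constraints \<Gamma> e x" for e w x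
      using j(3) by (intro val_constraints_cong) auto
    obtain u f' where u: "qf f'" "val_count k u = 0" "val_count_fm k f' < val_count_fm k f" "vars_trm u \<subseteq> vars_fm f"
      "params_trm u \<subseteq> params_fm f" "params_fm f' \<subseteq> params_fm f"
      "\<And>e. st e f = st (e(j := v_ext v (ev e u))) f'"
      using replace_val_fm[of f k j] prems(1) False j(1,2) by (metis neq0_conv)
    obtain l s where s: "params_trm s \<subseteq> params_trm u" "vars_trm s \<subseteq> vars_trm u - {k}"
      "\<And>e x. ev (e(k := Some x)) u = lin l x (ev e s)" using flat_linear[OF u(2)] by blast
    have sA: "params_trm s \<subseteq> A" and f'A: "params_fm f' \<subseteq> A" using s(1) u(5,6) prems(2) by auto
    have js: "j \<notin> vars_trm s" using s(2) u(4) j(1) by auto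
    have f: "st (e(k := Some x)) f = st (e(j := v_ext v (lin l x (ev e s)), k := Some x)) f'" for e x
      unfolding u(7)[of "e(k := Some x)"] s(3) using j(2) by (simp add: fun_upd_twist)
    \<comment> \<open>The centre is chosen so that \<open>l x + s = l (x - c)\<close>, which makes
      the named value \<open>v (x - c)\<close>. For \<open>l = 0\<close> the division yields 0 and
      \<open>c\<close> has no such meaning; that case is split off below.\<close>
    define c where "c = Scal (- 1 / l) s"
    let ?\<Gamma> = "insert (c, Var j) \<Gamma>"
    \<comment> \<open>Three cases: \<open>\<Phi>\<close> when the named value does not depend on
      \<open>x\<close>, \<open>\<Theta>\<close> for \<open>x = c\<close>, where it is infinite, and
      \<open>\<Psi>\<close> for all other \<open>x\<close>, where it is an element of the value set
      and yields a new constraint.\<close>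
    define \<Phi> where "\<Phi> e \<longleftrightarrow> (\<exists>x. st (e(k := Some x)) f' \<and> val_constraints \<Gamma> e x)" for e
    define \<Psi> where "\<Psi> e \<longleftrightarrow> (\<exists>x. st (e(k := Some x)) f' \<and> val_constraints ?\<Gamma> e x)" for e
    define \<Theta> where "\<Theta> e \<longleftrightarrow> st (e(k := ev e c)) f \<and>
      (\<forall>p\<in>\<Gamma>. ev e (Val (diff_trm c (fst p))) = ev e (snd p) \<and> \<not> ev e (snd p) = ev e Infty)" for e
    have cA: "params_trm c \<subseteq> A" using sA by (simp add: c_def)
    have def\<Phi>: "qf_definable A \<Phi>"
      unfolding \<Phi>_def using less.hyps[OF u(3,1) f'A prems(3,4)] prems(5) by blast
    have def\<Psi>: "qf_definable A \<Psi>"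
      unfolding \<Psi>_def using prems(3,5) cA by (intro less.hyps[OF u(3,1) f'A]) auto
    have eqd: "qf_definable A (\<lambda>e. ev e a = ev e b)" if "params_trm a \<subseteq> A" "params_trm b \<subseteq> A"
      for a b :: "('c, 'g option) trm"
      using qf_definable_sat[of "Eq a b" A] that by simp
    have def\<Theta>: "qf_definable A \<Theta>"
      unfolding \<Theta>_def
    proof (intro qf_definable_conj qf_definable_ball qf_definable_not eqd prems(3))
      show "qf_definable A (\<lambda>e. st (e(k := ev e c)) f)"
        by (rule qf_definable_subst[OF qf_definable_sat[OF prems(1,2)] cA])
      fix p assume "p \<in> \<Gamma>"
      then show "params_trm (Val (diff_trm c (fst p))) \<subseteq> A" "params_trm (snd p) \<subseteq> A" "params_trm (snd p) \<subseteq> A"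
        using prems(5)[of "fst p" "snd p"] cA by auto
      show "params_trm (Infty :: ('c, 'g option) trm) \<subseteq> A" by simp
    qed
    have "(\<exists>x. st (e(k := Some x)) f \<and> val_constraints \<Gamma> e x) \<longleftrightarrow>
      (if l = 0 \<or> ev e s = ev e Infty then \<Phi> (e(j := ev e (Val s)))
       else \<Theta> e \<or> (\<exists>h. v h = Some h \<and> \<Psi> (e(j := Some h))))" for e
    proof (cases "l = 0 \<or> ev e s = ev e Infty")
      case True
      then have "lin l x (ev e s) = ev e s" for x by auto
      then show ?thesis using True unfolding \<Phi>_def \<Gamma>j f by simp
    next
      case False
      then obtain b where b: "ev e s = Some b" and l: "l \<noteq> 0" by auto
      define a where "a = sc (- 1 / l) b"
      have ea: "ev e c = Some a" using b by (simp add: c_def a_def)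
      have ea': "ev (e(j := w)) c = Some a" for w
      proof -
        have "ev (e(j := w)) c = ev e c" using js by (intro eval_cong) (auto simp: c_def)
        then show ?thesis using ea by simp
      qed
      have val: "v_ext v (lin l x (ev e s)) = v (x - a)" for x
      proof -
        have "sc l (x - a) = sc l x + b" using l by (simp add: a_def o0.vs.scale_right_diff_distrib o0.vs.scale_right_distrib)
        then have "v (sc l x + b) = v (x - a)" using v_scale[OF l, of "x - a"] by simp
        then show ?thesis by (simp add: b v_ext_def)
      qed
      have \<Theta>: "\<Theta> e \<longleftrightarrow> st (e(k := Some a)) f \<and> val_constraints \<Gamma> e a"
        unfolding \<Theta>_def val_constraints_trm[OF ea] ea by auto
      have \<Psi>: "\<Psi> (e(j := Some h)) \<longleftrightarrow>
        (\<exists>x. st (e(j := Some h, k := Some x)) f' \<and> v (x - a) = Some h \<and> val_constraints \<Gamma> e x)" for h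
      proof -
        have "val_constraints ?\<Gamma> (e(j := Some h)) x \<longleftrightarrow> v (x - a) = Some h \<and> val_constraints \<Gamma> (e(j := Some h)) x" for x
          using ea'[of "Some h"] unfolding val_constraints_def by auto
        then show ?thesis unfolding \<Psi>_def \<Gamma>j by simp
      qed
      have "(\<exists>x. st (e(k := Some x)) f \<and> val_constraints \<Gamma> e x) \<longleftrightarrow>
        \<Theta> e \<or> (\<exists>h. v h = Some h \<and> \<Psi> (e(j := Some h)))"
      proof
        assume "\<exists>x. st (e(k := Some x)) f \<and> val_constraints \<Gamma> e x"
        then obtain x where x: "st (e(k := Some x)) f" "val_constraints \<Gamma> e x" by blast
        show "\<Theta> e \<or> (\<exists>h. v h = Some h \<and> \<Psi> (e(j := Some h)))"
        proof (cases "x = a")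
          case True then show ?thesis using x \<Theta> by blast
        next
          case False
          then obtain h where h: "v (x - a) = Some h" by (cases "v (x - a)") auto
          then have "\<Psi> (e(j := Some h))" using x unfolding \<Psi> f val by auto
          then show ?thesis using v_idem[OF h] by blast
        qed
      next
        assume "\<Theta> e \<or> (\<exists>h. v h = Some h \<and> \<Psi> (e(j := Some h)))"
        then show "\<exists>x. st (e(k := Some x)) f \<and> val_constraints \<Gamma> e x"
        proof
          assume "\<Theta> e" then show ?thesis unfolding \<Theta> by blast
        next
          assume "\<exists>h. v h = Some h \<and> \<Psi> (e(j := Some h))"
          then obtain h x where "st (e(j := Some h, k := Some x)) f'" "v (x - a) = Some h" "val_constraints \<Gamma> e x"
            unfolding \<Psi> by blast
          then show ?thesis unfolding f val by (intro exI[of _ x]) simp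
        qed
      qed
      then show ?thesis by (simp only: False if_False)
    qed
    moreover have "qf_definable A (\<lambda>e. if l = 0 \<or> ev e s = ev e Infty then \<Phi> (e(j := ev e (Val s)))
       else \<Theta> e \<or> (\<exists>h. v h = Some h \<and> \<Psi> (e(j := Some h))))"
    proof (intro qf_definable_if qf_definable_disj qf_definable_const eqd sA def\<Theta>)
      show "qf_definable A (\<lambda>e. \<Phi> (e(j := ev e (Val s))))" using sA by (intro qf_definable_subst[OF def\<Phi>]) simp
      show "qf_definable A (\<lambda>e. \<exists>h. v h = Some h \<and> \<Psi> (e(j := Some h)))" by (rule qf_definable_ex_val[OF def\<Psi>])
    qed simp
    ultimately show ?thesis by (simp only: )
  qed
qed

theorem quantifier_elimination:
  fixes f :: "('c, 'g option) fm"
  shows "qf_definable (params_fm f) (\<lambda>e. st e f)"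
proof (induction f)
  case (Neg f)
  then show ?case using qf_definable_not by simp
next
  case (Conj f g)
  have "qf_definable (params_fm f \<union> params_fm g) (\<lambda>e. st e f)" "qf_definable (params_fm f \<union> params_fm g) (\<lambda>e. st e g)"
    using Conj.IH unfolding qf_definable_def by blast+
  then show ?case using qf_definable_conj by simp
next
  case (Ex k f)
  let ?A = "params_fm f"
  obtain g :: "('c, 'g option) fm" where g: "qf g" "params_fm g \<subseteq> ?A" "\<And>e. st e g = st e f"
    using Ex.IH unfolding qf_definable_def by blast
  obtain j where "j \<notin> insert k (vars_fm g)"
    using ex_new_if_finite[OF infinite_UNIV_nat, of "insert k (vars_fm g)"] finite_vars_fm[of g] by auto
  then have j: "j \<noteq> k" "j \<notin> vars_fm g" by auto
  \<comment> \<open>The initial constraint prescribes \<open>v x\<close> itself, with centre 0, and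
    so makes the set of constraints nonempty. Infinity and 0, which have no value in the group, are
    substituted directly.\<close>
  let ?\<Gamma> = "{(Zero, Var j)} :: (('c, 'g option) trm \<times> ('c, 'g option) trm) set"
  define \<Psi> where "\<Psi> e \<longleftrightarrow> (\<exists>x. st (e(k := Some x)) g \<and> val_constraints ?\<Gamma> e x)" for e
  have def\<Psi>: "qf_definable ?A \<Psi>" unfolding \<Psi>_def
    by (rule qf_definable_ex_constrained[OF g(1,2)]) auto
  have gj: "st (e(j := w)) g = st e g" for e w using j by (intro sat_cong[OF g(1)]) auto
  have \<Psi>: "\<Psi> (e(j := Some h)) \<longleftrightarrow> (\<exists>x. st (e(k := Some x)) g \<and> v x = Some h)" for e h
  proof -
    have "st (e(j := Some h, k := Some x)) g = st (e(k := Some x)) g" for x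
      using gj[of "e(k := Some x)" "Some h"] j(1) by (simp add: fun_upd_twist)
    then show ?thesis unfolding \<Psi>_def val_constraints_def by simp
  qed
  have "st e (Ex k f) \<longleftrightarrow> st (e(k := ev e Infty)) g \<or> st (e(k := ev e Zero)) g \<or>
    (\<exists>h. v h = Some h \<and> \<Psi> (e(j := Some h)))" for e
  proof
    assume "st e (Ex k f)"
    then obtain u where u: "st (e(k := u)) g" by (auto simp: g(3))
    show "st (e(k := ev e Infty)) g \<or> st (e(k := ev e Zero)) g \<or> (\<exists>h. v h = Some h \<and> \<Psi> (e(j := Some h)))"
    proof (cases u)
      case None then show ?thesis using u by simp
    next
      case (Some x)
      show ?thesis
      proof (cases "v x")
        case None then show ?thesis using u Some by simp
      next
        case (Some h)
        then have "\<Psi> (e(j := Some h))" unfolding \<Psi> using u \<open>u = Some x\<close> by blast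
        then show ?thesis using v_idem[OF Some] by blast
      qed
    qed
  next
    assume "st (e(k := ev e Infty)) g \<or> st (e(k := ev e Zero)) g \<or> (\<exists>h. v h = Some h \<and> \<Psi> (e(j := Some h)))"
    then have "\<exists>u. st (e(k := u)) g" unfolding \<Psi> by blast
    then show "st e (Ex k f)" by (simp add: g(3))
  qed
  moreover have "qf_definable ?A (\<lambda>e. st (e(k := ev e Infty)) g \<or> st (e(k := ev e Zero)) g \<or>
    (\<exists>h. v h = Some h \<and> \<Psi> (e(j := Some h))))"
    by (intro qf_definable_disj qf_definable_subst[OF qf_definable_sat[OF g(1,2)]] qf_definable_ex_val[OF def\<Psi>]) auto
  ultimately show ?case by (simp only: params_fm.simps)
qed (rule qf_definable_sat; simp)+

text \<open>The form in which elimination is used below: distality only has to be checked on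
  atoms.\<close>

corollary agree_sat:
  fixes f :: "('c, 'g option) fm"
  assumes "agree {t. params_trm t \<subseteq> A} e e'" "params_fm f \<subseteq> A"
  shows "st e f = st e' f"
proof -
  obtain g :: "('c, 'g option) fm" where g: "qf g" "params_fm g \<subseteq> params_fm f" "\<And>e. st e g = st e f"
    using quantifier_elimination[of f] unfolding qf_definable_def by blast
  have "trms_fm g \<subseteq> {t. params_trm t \<subseteq> A}" using params_trms_fm g(2) assms(2) by blast
  then have "st e g = st e' g" using sat_agree[OF g(1)] agree_mono[OF assms(1)] by blast
  then show ?thesis using g(3) by simp
qed

end

section \<open>Distality\<close>

lemma seq_env_append:
  "seq_env n a (xs @ ys) q = (if q < length xs * n then seq_env n a xs q else seq_env n a ys (q - length xs * n))"
proof (cases "n = 0")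
  case True then show ?thesis by (simp add: seq_env_def)
next
  case False
  show ?thesis
  proof (cases "q < length xs * n")
    case True
    then have "q div n < length xs" using False by (simp add: div_less_iff_less_mult)
    then show ?thesis using True False by (auto simp: seq_env_def nth_append algebra_simps)
  next
    case nl: False
    then obtain p where p: "q = length xs * n + p" by (metis le_Suc_ex not_less)
    then show ?thesis using False by (auto simp: seq_env_def nth_append algebra_simps)
  qed
qed

text \<open>The resource count of the distality argument: every level of nested values costs one
  block on either side.\<close>

primrec val_depth :: "('c, 'u) trm \<Rightarrow> nat" where
  "val_depth (Var k) = 0"
| "val_depth (Cst u) = 0"
| "val_depth Zero = 0"
| "val_depth Infty = 0"
| "val_depth (Plus s t) = max (val_depth s) (val_depth t)"
| "val_depth (Scal c t) = val_depth t"
| "val_depth (Val t) = Suc (val_depth t)"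

text \<open>A finite list leaves finitely many gaps, so one of them contains infinitely many
  elements of \<open>L\<close>. That gap will receive the additional blocks.\<close>

lemma infinite_gap:
  fixes xs :: "'i::linorder list"
  assumes "sorted_wrt (<) xs" "infinite L" "L \<inter> set xs = {}"
  shows "\<exists>ys zs. xs = ys @ zs \<and> infinite {l \<in> L. (\<forall>x\<in>set ys. x < l) \<and> (\<forall>x\<in>set zs. l < x)}"
  using assms
proof (induction xs arbitrary: L)
  case Nil
  then show ?case by simp
next
  case (Cons x xs)
  show ?case
  proof (cases "finite {l \<in> L. l < x}")
    case False
    have "{l \<in> L. l < x} \<subseteq> {l \<in> L. (\<forall>y\<in>set []. y < l) \<and> (\<forall>y\<in>set (x # xs). l < y)}"
      using Cons.prems(1) by (auto intro: less_trans)
    then have "infinite {l \<in> L. (\<forall>y\<in>set []. y < l) \<and> (\<forall>y\<in>set (x # xs). l < y)}"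
      using False finite_subset by blast
    then show ?thesis by (intro exI[of _ "[]"] exI[of _ "x # xs"]) simp
  next
    case True
    have "L = {l \<in> L. l < x} \<union> {l \<in> L. x < l}" using Cons.prems(3) by auto
    then have "infinite {l \<in> L. x < l}" using True Cons.prems(2) by (metis finite_Un)
    then obtain ys zs where yz: "xs = ys @ zs"
      "infinite {l \<in> {l \<in> L. x < l}. (\<forall>x\<in>set ys. x < l) \<and> (\<forall>x\<in>set zs. l < x)}"
      using Cons.IH[of "{l \<in> L. x < l}"] Cons.prems by auto
    moreover have "{l \<in> {l \<in> L. x < l}. (\<forall>x\<in>set ys. x < l) \<and> (\<forall>x\<in>set zs. l < x)}
      = {l \<in> L. (\<forall>y\<in>set (x # ys). y < l) \<and> (\<forall>x\<in>set zs. l < x)}" by auto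
    ultimately show ?thesis by (intro exI[of _ "x # ys"] exI[of _ zs]) simp
  qed
qed

lemma blocks_exist:
  fixes J :: "'i::linorder set"
  assumes "infinite J"
  shows "\<exists>f :: nat \<Rightarrow> 'i list. (\<forall>q<M. length (f q) = r \<and> sorted_wrt (<) (f q) \<and> set (f q) \<subseteq> J) \<and>
    (\<forall>q q' x y. q < q' \<longrightarrow> q' < M \<longrightarrow> x \<in> set (f q) \<longrightarrow> y \<in> set (f q') \<longrightarrow> x < y)"
proof -
  obtain T where T: "finite T" "card T = M * r" "T \<subseteq> J" using infinite_arbitrarily_large[OF assms] by blast
  define l where "l = sorted_list_of_set T"
  have l: "sorted_wrt (<) l" "length l = M * r" "set l = T" using T by (auto simp: l_def)
  have less: "l ! i < l ! j" if "i < j" "j < M * r" for i j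
    using l that by (simp add: sorted_wrt_iff_nth_less)
  define f where "f q = map (\<lambda>p. l ! (q * r + p)) [0..<r]" for q
  have bound: "q * r + p < M * r" if "q < M" "p < r" for p q
  proof -
    have "q * r + p < Suc q * r" using that by simp
    also have "\<dots> \<le> M * r" using that by (intro mult_le_mono1) simp
    finally show ?thesis .
  qed
  show ?thesis
  proof (intro exI[of _ f] conjI allI impI)
    fix q assume q: "q < M"
    show "length (f q) = r" by (simp add: f_def)
    show "sorted_wrt (<) (f q)" unfolding f_def sorted_wrt_iff_nth_less using less bound q by auto
    show "set (f q) \<subseteq> J" using bound[OF q] l T by (auto simp: f_def)
  next
    fix q q' x y assume q: "q < q'" "q' < M" and x: "x \<in> set (f q)" and y: "y \<in> set (f q')"
    obtain p p' where p: "p < r" "x = l ! (q * r + p)" "p' < r" "y = l ! (q' * r + p')"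
      using x y by (auto simp: f_def)
    have "q * r + p < Suc q * r" using p by simp
    also have "\<dots> \<le> q' * r + p'" using q(1) by (metis Suc_leI le_add1 mult_le_mono1 order_trans)
    finally show "x < y" using less bound[OF q(2) p(3)] p by simp
  qed
qed

text \<open>The three points are monotone, so \<open>q\<close> lies between \<open>p\<close> and
  \<open>r\<close>; a point \<open>d\<close> that does not separate the outer two cannot separate
  \<open>q\<close> from them.\<close>

lemma (in ordered_space) between_cut:
  assumes "lt p q \<longleftrightarrow> lt q r" "lt q p \<longleftrightarrow> lt r q" "p = d \<longleftrightarrow> r = d" "lt p d \<longleftrightarrow> lt r d"
  shows "(q = d \<longleftrightarrow> r = d) \<and> (lt q d \<longleftrightarrow> lt r d)"
proof -
  consider "lt p q" "lt q r" | "lt q p" "lt r q" | "p = q" "q = r" using assms(1,2) less_linear by metis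
  then show ?thesis
    using assms(3,4) by cases (metis less_linear less_trans less_irrefl)+
qed

context hamel_model begin

text \<open>Since \<open>d\<close> does not cut through the sequence, the distances to
  \<open>d\<close> are monotone along \<open>t\<close>, and so are their values. Away from 0 these
  values are all equal or pairwise different. In the first case the value at 0 is squeezed between
  its neighbours. In the second, the extreme entry nearest to \<open>d\<close> is at the strictly
  largest value from \<open>d\<close>, so that it can replace \<open>d\<close> without changing the
  other values.\<close>

lemma increasing_val_dichotomy:
  fixes t :: "int \<Rightarrow> 'g" and M :: int
  assumes M: "2 \<le> M"
    and inc: "\<And>i j. - M \<le> i \<Longrightarrow> i < j \<Longrightarrow> j \<le> M \<Longrightarrow> lt1 (t i) (t j)"
    and cut: "\<And>i j. i \<in> {-M..M} - {0} \<Longrightarrow> j \<in> {-M..M} - {0} \<Longrightarrow> lt1 (t i) d \<longleftrightarrow> lt1 (t j) d"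
      "\<And>i j. i \<in> {-M..M} - {0} \<Longrightarrow> j \<in> {-M..M} - {0} \<Longrightarrow> t i = d \<longleftrightarrow> t j = d"
    and val: "\<And>i j i' j'. i \<in> {-M..M} - {0} \<Longrightarrow> j \<in> {-M..M} - {0} \<Longrightarrow> i' \<in> {-M..M} - {0} \<Longrightarrow> j' \<in> {-M..M} - {0} \<Longrightarrow>
      i < j \<Longrightarrow> i' < j' \<Longrightarrow> v (d - t i) = v (d - t j) \<longleftrightarrow> v (d - t i') = v (d - t j')"
  shows "(\<forall>k\<in>{-M..M}. v (d - t k) = v (d - t M)) \<or> (\<forall>k\<in>{-M<..<M}. v (d - t k) = v (t M - t k)) \<or>
    (\<forall>k\<in>{-M<..<M}. v (d - t k) = v (t (- M) - t k))"
proof -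
  have lin1: "lt1 (t (-1)) (t 1)" "lt1 (t (-1)) (t 0)" "lt1 (t 0) (t 1)" using inc M by auto
  have one: "1 \<in> {-M..M} - {0}" "-1 \<in> {-M..M} - {0}" "M \<in> {-M..M} - {0}" "-M \<in> {-M..M} - {0}" using M by auto
  have nd: "t k \<noteq> d" if "k \<in> {-M..M} - {0}" for k
    using cut(2)[OF that one(1)] cut(2)[OF that one(2)] lin1(1) by auto
  have eqs: "v (d - t k) = v (d - t k')" if "v (d - t (-1)) = v (d - t 1)" "k \<in> {-M..M} - {0}" "k' \<in> {-M..M} - {0}" for k k'
    using val[OF one(2,1) that(2,3)] val[OF one(2,1) that(3,2)] that(1) by (cases k k' rule: linorder_cases) auto
  show ?thesis
  proof (cases "lt1 (t 1) d")
    case True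
    have less: "lt1 (t k) d" if "k \<in> {-M..M}" for k
    proof (cases "k = 0")
      case 0: True then show ?thesis using lin1 True o1.less_trans by blast
    next
      case False then show ?thesis using cut(1)[of k 1] one that True by auto
    qed
    have mono: "le_inf lt0 (v (d - t i)) (v (d - t j))" if "i \<in> {-M..M}" "j \<in> {-M..M}" "i \<le> j" for i j
    proof (cases "i = j")
      case False
      then have "lt1 (t i) (t j)" using inc that by auto
      then show ?thesis using less that by (intro v_antimono) (auto simp: o1.le_def)
    qed simp
    show ?thesis
    proof (cases "v (d - t (-1)) = v (d - t 1)")
      case eq: True
      have "v (d - t k) = v (d - t M)" if "k \<in> {-M..M}" for k
      proof (cases "k = 0")
        case 0: True
        have "le_inf lt0 (v (d - t (-1))) (v (d - t 0))" "le_inf lt0 (v (d - t 0)) (v (d - t 1))"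
          using M by (auto intro!: mono)
        then have "v (d - t 0) = v (d - t 1)" using eq by simp
        then show ?thesis using 0 eqs[OF eq one(1,3)] by simp
      next
        case False then show ?thesis using that by (intro eqs[OF eq _ one(3)]) auto
      qed
      then show ?thesis by blast
    next
      case neq: False
      have "v (d - t k) = v (t M - t k)" if k: "k \<in> {-M<..<M}" for k
      proof -
        have *: "less_inf lt0 (v (d - t k)) (v (d - t M))" if "k \<in> {-M..M} - {0}" "k < M" for k
          using val[OF one(2,1) that(1) one(3)] that neq mono[of k M] M by (auto simp: i0.less_le)
        have "less_inf lt0 (v (d - t k)) (v (d - t M))"
        proof (cases "k = 0")
          case True
          then show ?thesis using *[OF one(1)] mono[of 0 1] M i0.le_less_trans by auto
        next
          case False then show ?thesis using * k by auto
        qed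
        then have "less_inf lt0 (v (d - t k)) (v (t M - d))" by (simp only: v_diff_commute[of "t M"])
        from v_add_less[OF this] show ?thesis by (simp add: algebra_simps)
      qed
      then show ?thesis by blast
    qed
  next
    case False
    have neg: "lt1 d (t k)" if "k \<in> {-M..M} - {0}" for k
      using cut(1)[OF that one(1)] False nd[OF that] o1.less_linear by blast
    have less: "lt1 d (t k)" if "k \<in> {-M..M}" for k
    proof (cases "k = 0")
      case 0: True then show ?thesis using lin1 neg[OF one(2)] o1.less_trans by blast
    next
      case False then show ?thesis using neg that by auto
    qed
    have mono: "le_inf lt0 (v (d - t j)) (v (d - t i))" if "i \<in> {-M..M}" "j \<in> {-M..M}" "i \<le> j" for i j
    proof (cases "i = j")
      case False
      then have "lt1 (t i) (t j)" using inc that by auto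
      then have "le_inf lt0 (v (t j - d)) (v (t i - d))" using less that by (intro v_antimono) (auto simp: o1.le_def)
      then show ?thesis by (simp only: v_diff_commute[of d])
    qed simp
    show ?thesis
    proof (cases "v (d - t (-1)) = v (d - t 1)")
      case eq: True
      have "v (d - t k) = v (d - t M)" if "k \<in> {-M..M}" for k
      proof (cases "k = 0")
        case 0: True
        have "le_inf lt0 (v (d - t 0)) (v (d - t (-1)))" "le_inf lt0 (v (d - t 1)) (v (d - t 0))"
          using M by (auto intro!: mono)
        then have "v (d - t 0) = v (d - t 1)" using eq by simp
        then show ?thesis using 0 eqs[OF eq one(1,3)] by simp
      next
        case False then show ?thesis using that by (intro eqs[OF eq _ one(3)]) auto
      qed
      then show ?thesis by blast
    next
      case neq: False
      have "v (d - t k) = v (t (-M) - t k)" if k: "k \<in> {-M<..<M}" for k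
      proof -
        have *: "less_inf lt0 (v (d - t k)) (v (d - t (-M)))" if "k \<in> {-M..M} - {0}" "- M < k" for k
          using val[OF one(2,1) one(4) that(1)] that neq mono[of "-M" k] M by (auto simp: i0.less_le)
        have "less_inf lt0 (v (d - t k)) (v (d - t (-M)))"
        proof (cases "k = 0")
          case True
          then show ?thesis using *[OF one(2)] mono[of "-1" 0] M i0.le_less_trans by auto
        next
          case False then show ?thesis using * k by auto
        qed
        then have "less_inf lt0 (v (d - t k)) (v (t (-M) - d))" by (simp only: v_diff_commute[of "t (-M)"])
        from v_add_less[OF this] show ?thesis by (simp add: algebra_simps)
      qed
      then show ?thesis by blast
    qed
  qed
qed

text \<open>The hypotheses are what indiscernibility of \<open>t\<close>, and indiscernibility over \<open>d\<close> away from
  the index \<open>0\<close>, provide.\<close>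

lemma val_dichotomy:
  fixes t :: "int \<Rightarrow> 'g" and M :: int
  assumes M: "2 \<le> M"
    and mono: "\<And>i j. - M \<le> i \<Longrightarrow> i < j \<Longrightarrow> j \<le> M \<Longrightarrow> lt1 (t i) (t j) \<longleftrightarrow> lt1 (t 0) (t 1)"
      "\<And>i j. - M \<le> i \<Longrightarrow> i < j \<Longrightarrow> j \<le> M \<Longrightarrow> t i = t j \<longleftrightarrow> t 0 = t 1"
    and cut: "\<And>i j. i \<in> {-M..M} - {0} \<Longrightarrow> j \<in> {-M..M} - {0} \<Longrightarrow> lt1 (t i) d \<longleftrightarrow> lt1 (t j) d"
      "\<And>i j. i \<in> {-M..M} - {0} \<Longrightarrow> j \<in> {-M..M} - {0} \<Longrightarrow> t i = d \<longleftrightarrow> t j = d"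
    and val: "\<And>i j i' j'. i \<in> {-M..M} - {0} \<Longrightarrow> j \<in> {-M..M} - {0} \<Longrightarrow> i' \<in> {-M..M} - {0} \<Longrightarrow> j' \<in> {-M..M} - {0} \<Longrightarrow>
      i < j \<Longrightarrow> i' < j' \<Longrightarrow> v (d - t i) = v (d - t j) \<longleftrightarrow> v (d - t i') = v (d - t j')"
  shows "(\<forall>k\<in>{-M..M}. v (d - t k) = v (d - t M)) \<or> (\<forall>k\<in>{-M<..<M}. v (d - t k) = v (t M - t k)) \<or>
    (\<forall>k\<in>{-M<..<M}. v (d - t k) = v (t (- M) - t k))"
proof -
  consider "lt1 (t 0) (t 1)" | "t 0 = t 1" | "lt1 (t 1) (t 0)" using o1.less_linear by blast
  then show ?thesis
  proof cases
    case 1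
    then have inc: "lt1 (t i) (t j)" if "- M \<le> i" "i < j" "j \<le> M" for i j using mono(1)[OF that] by blast
    show ?thesis by (rule increasing_val_dichotomy[OF M]) (rule inc cut val; assumption)+
  next
    case 2
    then have "t k = t M" if "k \<in> {-M..M}" for k using mono(2)[of k M] that by (cases "k = M") auto
    then have "v (d - t k) = v (d - t M)" if "k \<in> {-M..M}" for k using that by metis
    then show ?thesis by blast
  next
    case 3
    \<comment> \<open>A decreasing sequence becomes increasing when the signs of \<open>t\<close>
      and \<open>d\<close> are changed, and all values are preserved.\<close>
    have neg: "v (- x - - y) = v (x - y)" for x y by (metis minus_diff_minus v_minus)
    have "lt1 (t j) (t i)" if "- M \<le> i" "i < j" "j \<le> M" for i j
      using mono[OF that] 3 o1.less_asym o1.less_linear[of "t i" "t j"] by auto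
    then have inc: "lt1 (- t i) (- t j)" if "- M \<le> i" "i < j" "j \<le> M" for i j using that by simp
    have cut': "lt1 (- t i) (- d) \<longleftrightarrow> lt1 (- t j) (- d)" if "i \<in> {-M..M} - {0}" "j \<in> {-M..M} - {0}" for i j
      unfolding o1.neg_less_iff_less using cut(1)[OF that] cut(2)[OF that] by (metis o1.less_linear o1.less_asym)
    have "(\<forall>k\<in>{-M..M}. v (- d - - t k) = v (- d - - t M)) \<or> (\<forall>k\<in>{-M<..<M}. v (- d - - t k) = v (- t M - - t k)) \<or>
      (\<forall>k\<in>{-M<..<M}. v (- d - - t k) = v (- t (- M) - - t k))"
    proof (rule increasing_val_dichotomy[OF M])
      fix i j assume ij: "i \<in> {-M..M} - {0}" "j \<in> {-M..M} - {0}"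
      show "lt1 (- t i) (- d) \<longleftrightarrow> lt1 (- t j) (- d)" using ij by (rule cut')
      show "- t i = - d \<longleftrightarrow> - t j = - d" using cut(2)[OF ij] by simp
      fix i' j' assume "i' \<in> {-M..M} - {0}" "j' \<in> {-M..M} - {0}" "i < j" "i' < j'"
      then show "v (- d - - t i) = v (- d - - t j) \<longleftrightarrow> v (- d - - t i') = v (- d - - t j')"
        unfolding neg by (rule val[OF ij])
    qed (rule inc; assumption)
    then show ?thesis by (simp only: neg)
  qed
qed

end

section \<open>Blocks of the indiscernible sequence and terms along them\<close>

lemma sorted_concat_blocks:
  fixes blk :: "int \<Rightarrow> 'i::linorder list"
  assumes "sorted_wrt (<) ks" "\<And>k. k \<in> set ks \<Longrightarrow> sorted_wrt (<) (blk k)"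
    "\<And>i j x y. i \<in> set ks \<Longrightarrow> j \<in> set ks \<Longrightarrow> i < j \<Longrightarrow> x \<in> set (blk i) \<Longrightarrow> y \<in> set (blk j) \<Longrightarrow> x < y"
  shows "sorted_wrt (<) (concat (map blk ks))"
  using assms
proof (induction ks)
  case (Cons k ks)
  have "sorted_wrt (<) (concat (map blk ks))"
  proof (rule Cons.IH)
    show "x < y" if "i \<in> set ks" "j \<in> set ks" "i < j" "x \<in> set (blk i)" "y \<in> set (blk j)" for i j x y
      using Cons.prems(3)[of i j x y] that by simp
  qed (use Cons.prems(1,2) in auto)
  moreover have "x < y" if "x \<in> set (blk k)" "y \<in> set (concat (map blk ks))" for x y
    using that Cons.prems(1) Cons.prems(3)[of k _ x y] by auto
  ultimately show ?case using Cons.prems(2)[of k] by (auto simp: sorted_wrt_append)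
qed simp

text \<open>The sequence is regrouped into blocks \<open>blk (- N0), \<dots>, blk N0\<close> lying between the fixed tuples
  \<open>as\<close> and \<open>ds\<close>; only \<open>blk 0\<close> contains the index \<open>c\<close>.\<close>

locale hamel_blocks = hamel_model sc lt0 lt1 v
  for sc :: "'c::linordered_field \<Rightarrow> 'g::ab_group_add \<Rightarrow> 'g"
    and lt0 lt1 :: "'g \<Rightarrow> 'g \<Rightarrow> bool" and v :: "'g \<Rightarrow> 'g option" +
  fixes A :: "'g option set" and I :: "'i::linorder set" and c :: 'i and n :: nat
    and a :: "'i \<Rightarrow> 'g option list" and blk :: "int \<Rightarrow> 'i list" and as ds :: "'i list"
    and r :: nat and N0 :: int
  assumes ind0: "indiscernible sc lt0 lt1 v {} I n a"
    and indA: "indiscernible sc lt0 lt1 v A (I - {c}) n a"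
    and blk_length: "\<And>k. k \<in> {-N0..N0} \<Longrightarrow> length (blk k) = r"
    and blk_sorted: "\<And>k. k \<in> {-N0..N0} \<Longrightarrow> sorted_wrt (<) (blk k)"
    and blk_I: "\<And>k. k \<in> {-N0..N0} \<Longrightarrow> set (blk k) \<subseteq> I"
    and blk_c: "\<And>k. k \<in> {-N0..N0} - {0} \<Longrightarrow> c \<notin> set (blk k)"
    and blk_less: "\<And>i j x y. i \<in> {-N0..N0} \<Longrightarrow> j \<in> {-N0..N0} \<Longrightarrow> i < j \<Longrightarrow>
      x \<in> set (blk i) \<Longrightarrow> y \<in> set (blk j) \<Longrightarrow> x < y"
    and as: "sorted_wrt (<) as" "set as \<subseteq> I - {c}" and ds: "sorted_wrt (<) ds" "set ds \<subseteq> I - {c}"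
    and as_blk: "\<And>k x y. k \<in> {-N0..N0} \<Longrightarrow> x \<in> set as \<Longrightarrow> y \<in> set (blk k) \<Longrightarrow> x < y"
    and blk_ds: "\<And>k x y. k \<in> {-N0..N0} \<Longrightarrow> x \<in> set (blk k) \<Longrightarrow> y \<in> set ds \<Longrightarrow> x < y"
    and as_ds: "\<And>x y. x \<in> set as \<Longrightarrow> y \<in> set ds \<Longrightarrow> x < y"
begin

definition pos :: "int list \<Rightarrow> 'i list" where "pos ks = as @ concat (map blk ks) @ ds"

definition E :: "int list \<Rightarrow> nat \<Rightarrow> 'g option" where "E ks = seq_env n a (pos ks)"

lemma pos_sorted:
  assumes "sorted_wrt (<) ks" "set ks \<subseteq> {-N0..N0}" shows "sorted_wrt (<) (pos ks)"
proof -
  have "sorted_wrt (<) (concat (map blk ks))"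
    using assms by (intro sorted_concat_blocks) (auto intro: blk_sorted blk_less[of _ _])
  moreover have "x < y" if "x \<in> set as" "y \<in> set (concat (map blk ks))" for x y
    using that assms(2) as_blk by (auto simp: subset_iff)
  moreover have "x < y" if "x \<in> set (concat (map blk ks))" "y \<in> set ds" for x y
    using that assms(2) blk_ds by (auto simp: subset_iff)
  ultimately show ?thesis using as(1) ds(1) as_ds unfolding pos_def sorted_wrt_append by auto
qed

lemma pos_I: assumes "set ks \<subseteq> {-N0..N0}" shows "set (pos ks) \<subseteq> I"
proof -
  have "set (blk k) \<subseteq> I" if "k \<in> set ks" for k using that assms blk_I by blast
  then show ?thesis using as(2) ds(2) by (auto simp: pos_def)
qed

lemma pos_c: assumes "set ks \<subseteq> {-N0..N0} - {0}" shows "c \<notin> set (pos ks)"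
proof -
  have "c \<notin> set (blk k)" if "k \<in> set ks" for k using that assms blk_c by blast
  then show ?thesis using as(2) ds(2) by (auto simp: pos_def)
qed

lemma length_concat_blk: "set ks \<subseteq> {-N0..N0} \<Longrightarrow> length (concat (map blk ks)) = length ks * r"
  by (induction ks) (auto simp: blk_length)

lemma length_pos: "set ks \<subseteq> {-N0..N0} \<Longrightarrow> length (pos ks) = length as + length ks * r + length ds"
  by (simp add: pos_def length_concat_blk)

text \<open>Indiscernibility of the blocks in \<open>Z\<close> over \<open>B\<close>, for atomic
  formulas. It covers both hypotheses at once: all blocks over the empty set, and all blocks except
  the one at 0 over \<open>A\<close>. Blocks away from 0 are available in either case, so they may
  serve as constants.\<close>

definition compatible :: "'g option set \<Rightarrow> int set \<Rightarrow> bool" where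
  "compatible B Z \<longleftrightarrow> {-N0..N0} - {0} \<subseteq> Z \<and> Z \<subseteq> {-N0..N0} \<and>
    (\<forall>ks ks'. sorted_wrt (<) ks \<longrightarrow> sorted_wrt (<) ks' \<longrightarrow> set ks \<subseteq> Z \<longrightarrow> set ks' \<subseteq> Z \<longrightarrow>
      length ks = length ks' \<longrightarrow> agree {t. params_trm t \<subseteq> B} (E ks) (E ks'))"

lemma indiscernible_agree:
  assumes "indiscernible sc lt0 lt1 v B J n a" "sorted_wrt (<) is" "sorted_wrt (<) js"
    "set is \<subseteq> J" "set js \<subseteq> J" "length is = length js"
  shows "agree {t. params_trm t \<subseteq> B} (seq_env n a is) (seq_env n a js)"
proof -
  have *: "st (seq_env n a is) f \<longleftrightarrow> st (seq_env n a js) f" if "params_fm f \<subseteq> B" for f :: "('c, 'g option) fm"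
    using assms that unfolding indiscernible_def by blast
  show ?thesis unfolding agree_def
  proof (intro ballI)
    fix s t :: "('c, 'g option) trm" assume "s \<in> {t. params_trm t \<subseteq> B}" "t \<in> {t. params_trm t \<subseteq> B}"
    then show "(ev (seq_env n a is) s = ev (seq_env n a is) t \<longleftrightarrow> ev (seq_env n a js) s = ev (seq_env n a js) t) \<and>
      (less_inf lt0 (ev (seq_env n a is) s) (ev (seq_env n a is) t) \<longleftrightarrow> less_inf lt0 (ev (seq_env n a js) s) (ev (seq_env n a js) t)) \<and>
      (less_inf lt1 (ev (seq_env n a is) s) (ev (seq_env n a is) t) \<longleftrightarrow> less_inf lt1 (ev (seq_env n a js) s) (ev (seq_env n a js) t))"
      using *[of "Eq s t"] *[of "Less0 s t"] *[of "Less1 s t"] by simp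
  qed
qed

lemma compatible0: "compatible {} {-N0..N0}"
  unfolding compatible_def E_def
proof (intro conjI allI impI indiscernible_agree[OF ind0] pos_sorted)
  fix ks ks' assume ks: "set ks \<subseteq> {-N0..N0}" "set ks' \<subseteq> {-N0..N0}" "length ks = length ks'"
  show "set (pos ks) \<subseteq> I" "set (pos ks') \<subseteq> I" using pos_I ks by auto
  show "length (pos ks) = length (pos ks')" using ks by (auto simp: length_pos)
qed auto

lemma compatibleA: "compatible A ({-N0..N0} - {0})"
  unfolding compatible_def E_def
proof (intro conjI allI impI indiscernible_agree[OF indA] pos_sorted)
  fix ks ks' assume ks: "set ks \<subseteq> {-N0..N0} - {0}" "set ks' \<subseteq> {-N0..N0} - {0}" "length ks = length ks'"
  show "set (pos ks) \<subseteq> I - {c}" "set (pos ks') \<subseteq> I - {c}"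
    using pos_I[of ks] pos_I[of ks'] pos_c[OF ks(1)] pos_c[OF ks(2)] ks(1,2) by auto
  show "length (pos ks) = length (pos ks')" using ks by (auto simp: length_pos subset_iff)
qed auto

text \<open>The sequences \<open>k \<mapsto> \<tau> k\<close> given by one term \<open>\<tau>\<close> in the entries of \<open>blk k\<close>, of the blocks
  outside \<open>{-N..N}\<close>, of \<open>as\<close> and \<open>ds\<close>, and parameters from \<open>B\<close>.\<close>

inductive_set term_seq :: "'g option set \<Rightarrow> int \<Rightarrow> (int \<Rightarrow> 'g option) set" for B :: "'g option set" and N :: int where
  coord: "(\<lambda>k. seq_env n a (blk k) q) \<in> term_seq B N"
| left: "(\<lambda>k. seq_env n a as q) \<in> term_seq B N"
| right: "(\<lambda>k. seq_env n a ds q) \<in> term_seq B N"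
| outer: "l \<in> {-N0..N0} \<Longrightarrow> l \<notin> {-N..N} \<Longrightarrow> (\<lambda>k. seq_env n a (blk l) q) \<in> term_seq B N"
| const: "u \<in> B \<Longrightarrow> (\<lambda>k. u) \<in> term_seq B N"
| zero: "(\<lambda>k. Some 0) \<in> term_seq B N"
| infty: "(\<lambda>k. None) \<in> term_seq B N"
| plus: "s \<in> term_seq B N \<Longrightarrow> t \<in> term_seq B N \<Longrightarrow> (\<lambda>k. oplus (s k) (t k)) \<in> term_seq B N"
| scal: "s \<in> term_seq B N \<Longrightarrow> (\<lambda>k. map_option (sc l) (s k)) \<in> term_seq B N"
| val: "s \<in> term_seq B N \<Longrightarrow> (\<lambda>k. v_ext v (s k)) \<in> term_seq B N"

lemma term_seq_mono: "s \<in> term_seq B N \<Longrightarrow> B \<subseteq> B' \<Longrightarrow> N' \<le> N \<Longrightarrow> s \<in> term_seq B' N'"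
  by (induction rule: term_seq.induct) (simp_all add: term_seq.intros subset_iff, (rule term_seq.outer; auto))

text \<open>Freezing turns the entries of the moving block into entries of the outer block
  \<open>m\<close>; the price is the smaller range \<open>N'\<close>, which must not contain
  \<open>m\<close>.\<close>

lemma term_seq_freeze:
  "s \<in> term_seq B N \<Longrightarrow> N' \<le> N \<Longrightarrow> m \<in> {-N0..N0} \<Longrightarrow> m \<notin> {-N'..N'} \<Longrightarrow> (\<lambda>k. s m) \<in> term_seq B N'"
  by (induction rule: term_seq.induct) (simp_all add: term_seq.intros, (rule term_seq.outer; auto))

lemma slot_trm:
  "\<exists>t :: ('c, 'g option) trm. params_trm t = {} \<and>
    (\<forall>xs ys zs. length xs = lx \<longrightarrow> length ys = ly \<longrightarrow> ev (seq_env n a (xs @ ys @ zs)) t = seq_env n a ys q)"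
proof (cases "q < ly * n")
  case True
  then show ?thesis by (intro exI[of _ "Var (lx * n + q)"]) (auto simp: seq_env_append)
next
  case False
  \<comment> \<open>Beyond the end of the slot \<open>seq_env\<close> returns infinity by
    convention.\<close>
  then show ?thesis by (intro exI[of _ Infty]) (auto simp: seq_env_def)
qed

text \<open>All blocks have the same length, so the place of each entry in the flattened list
  depends only on how many blocks precede it. Hence one term works for all choices of the blocks.
  Leaving room for \<open>l1\<close> and \<open>l2\<close> others allows two sequences to be
  evaluated at different indices in a common environment.\<close>

lemma term_seq_trm:
  assumes "s \<in> term_seq B N" "0 \<le> N" "N \<le> N0"
  shows "\<exists>t :: ('c, 'g option) trm. params_trm t \<subseteq> B \<and>
    (\<forall>ks1 ks2 k. length ks1 = l1 \<longrightarrow> length ks2 = l2 \<longrightarrow> set ks1 \<union> set ks2 \<union> {k} \<subseteq> {-N0..N0} \<longrightarrow>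
      ev (E ([-N0..-N-1] @ ks1 @ [k] @ ks2 @ [N+1..N0])) t = s k)"
  using assms(1)
proof (induction rule: term_seq.induct)
  let ?X = "[-N0..-N-1]" and ?Y = "[N+1..N0]"
  have XY: "set ?X \<subseteq> {-N0..N0}" "set ?Y \<subseteq> {-N0..N0}" using assms(2,3) by auto
  let ?env = "\<lambda>ks1 ks2 k. E (?X @ ks1 @ [k] @ ks2 @ ?Y)"
  {
    case (coord q)
    obtain t :: "('c, 'g option) trm" where t: "params_trm t = {}"
      "\<And>xs ys zs. length xs = length as + (length ?X + l1) * r \<Longrightarrow> length ys = r \<Longrightarrow> ev (seq_env n a (xs @ ys @ zs)) t = seq_env n a ys q"
      using slot_trm by blast
    have "ev (?env ks1 ks2 k) t = seq_env n a (blk k) q"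
      if "length ks1 = l1" "set ks1 \<union> set ks2 \<union> {k} \<subseteq> {-N0..N0}" for ks1 ks2 k
    proof -
      have eq: "E (?X @ ks1 @ [k] @ ks2 @ ?Y) = seq_env n a ((as @ concat (map blk (?X @ ks1))) @ blk k @ (concat (map blk (ks2 @ ?Y)) @ ds))"
        by (simp add: E_def pos_def)
      have len: "length (as @ concat (map blk (?X @ ks1))) = length as + (length ?X + l1) * r"
        using that XY(1) length_concat_blk[of "?X @ ks1"] by simp
      have "length (blk k) = r" using blk_length[of k] that by auto
      then show ?thesis unfolding eq by (rule t(2)[OF len])
    qed
    then show ?case using t(1) by (intro exI[of _ t]) simp
  next
    case (left q)
    obtain t :: "('c, 'g option) trm" where t: "params_trm t = {}"
      "\<And>xs ys zs. length xs = 0 \<Longrightarrow> length ys = length as \<Longrightarrow> ev (seq_env n a (xs @ ys @ zs)) t = seq_env n a ys q"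
      using slot_trm by blast
    have "ev (E ks) t = seq_env n a as q" for ks
      using t(2)[of "[]" as] by (simp add: E_def pos_def)
    then show ?case using t(1) by (intro exI[of _ t]) simp
  next
    case (right q)
    obtain t :: "('c, 'g option) trm" where t: "params_trm t = {}"
      "\<And>xs ys zs. length xs = length as + (length ?X + l1 + 1 + l2 + length ?Y) * r \<Longrightarrow> length ys = length ds \<Longrightarrow>
        ev (seq_env n a (xs @ ys @ zs)) t = seq_env n a ys q"
      using slot_trm by blast
    have "ev (?env ks1 ks2 k) t = seq_env n a ds q"
      if "length ks1 = l1" "length ks2 = l2" "set ks1 \<union> set ks2 \<union> {k} \<subseteq> {-N0..N0}" for ks1 ks2 k
    proof -
      let ?ks = "?X @ ks1 @ [k] @ ks2 @ ?Y"
      have eq: "E ?ks = seq_env n a ((as @ concat (map blk ?ks)) @ ds @ [])"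
        by (simp add: E_def pos_def)
      have len: "length (as @ concat (map blk ?ks)) = length as + (length ?X + l1 + 1 + l2 + length ?Y) * r"
        using that XY length_concat_blk[of ?ks] by simp
      show ?thesis unfolding eq by (rule t(2)[OF len refl])
    qed
    then show ?case using t(1) by (intro exI[of _ t]) simp
  next
    case (outer l q)
    then consider "l \<in> set ?X" | "l \<in> set ?Y" by force
    then show ?case
    proof cases
      case 1
      then obtain X1 X2 where X: "?X = X1 @ l # X2" using split_list by metis
      obtain t :: "('c, 'g option) trm" where t: "params_trm t = {}"
        "\<And>xs ys zs. length xs = length as + length X1 * r \<Longrightarrow> length ys = r \<Longrightarrow> ev (seq_env n a (xs @ ys @ zs)) t = seq_env n a ys q"
        using slot_trm by blast
      have "ev (?env ks1 ks2 k) t = seq_env n a (blk l) q" for ks1 ks2 k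
      proof -
        have eq: "E (?X @ ks1 @ [k] @ ks2 @ ?Y) = seq_env n a ((as @ concat (map blk X1)) @ blk l @ (concat (map blk (X2 @ ks1 @ [k] @ ks2 @ ?Y)) @ ds))"
          by (simp add: E_def pos_def X)
        have len: "length (as @ concat (map blk X1)) = length as + length X1 * r"
          using XY(1) length_concat_blk[of X1] unfolding X by simp
        show ?thesis unfolding eq by (rule t(2)[OF len blk_length[OF outer(1)]])
      qed
      then show ?thesis using t(1) by (intro exI[of _ t]) simp
    next
      case 2
      then obtain Y1 Y2 where Y: "?Y = Y1 @ l # Y2" using split_list by metis
      obtain t :: "('c, 'g option) trm" where t: "params_trm t = {}"
        "\<And>xs ys zs. length xs = length as + (length ?X + l1 + 1 + l2 + length Y1) * r \<Longrightarrow> length ys = r \<Longrightarrow>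
          ev (seq_env n a (xs @ ys @ zs)) t = seq_env n a ys q"
        using slot_trm by blast
      have "ev (?env ks1 ks2 k) t = seq_env n a (blk l) q"
        if "length ks1 = l1" "length ks2 = l2" "set ks1 \<union> set ks2 \<union> {k} \<subseteq> {-N0..N0}" for ks1 ks2 k
      proof -
        let ?ks = "?X @ ks1 @ [k] @ ks2 @ Y1"
        have eq: "E (?X @ ks1 @ [k] @ ks2 @ ?Y) = seq_env n a ((as @ concat (map blk ?ks)) @ blk l @ (concat (map blk Y2) @ ds))"
          by (simp add: E_def pos_def Y)
        have "set Y1 \<subseteq> {-N0..N0}" using XY(2) unfolding Y by simp
        then have len: "length (as @ concat (map blk ?ks)) = length as + (length ?X + l1 + 1 + l2 + length Y1) * r"
          using that XY(1) length_concat_blk[of ?ks] by simp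
        show ?thesis unfolding eq by (rule t(2)[OF len blk_length[OF outer(1)]])
      qed
      then show ?thesis using t(1) by (intro exI[of _ t]) simp
    qed
  next
    case (const u)
    then show ?case by (intro exI[of _ "Cst u"]) simp
  next
    case zero
    then show ?case by (intro exI[of _ Zero]) simp
  next
    case infty
    then show ?case by (intro exI[of _ Infty]) simp
  next
    case (plus s1 s2)
    then obtain t1 t2 where "params_trm t1 \<subseteq> B" "params_trm t2 \<subseteq> B"
      "\<forall>ks1 ks2 k. length ks1 = l1 \<longrightarrow> length ks2 = l2 \<longrightarrow> set ks1 \<union> set ks2 \<union> {k} \<subseteq> {-N0..N0} \<longrightarrow> ev (?env ks1 ks2 k) t1 = s1 k"
      "\<forall>ks1 ks2 k. length ks1 = l1 \<longrightarrow> length ks2 = l2 \<longrightarrow> set ks1 \<union> set ks2 \<union> {k} \<subseteq> {-N0..N0} \<longrightarrow> ev (?env ks1 ks2 k) t2 = s2 k"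
      by blast
    then show ?case by (intro exI[of _ "Plus t1 t2"]) simp
  next
    case (scal s1 l)
    then obtain t1 where "params_trm t1 \<subseteq> B"
      "\<forall>ks1 ks2 k. length ks1 = l1 \<longrightarrow> length ks2 = l2 \<longrightarrow> set ks1 \<union> set ks2 \<union> {k} \<subseteq> {-N0..N0} \<longrightarrow> ev (?env ks1 ks2 k) t1 = s1 k"
      by blast
    then show ?case by (intro exI[of _ "Scal l t1"]) simp
  next
    case (val s1)
    then obtain t1 where "params_trm t1 \<subseteq> B"
      "\<forall>ks1 ks2 k. length ks1 = l1 \<longrightarrow> length ks2 = l2 \<longrightarrow> set ks1 \<union> set ks2 \<union> {k} \<subseteq> {-N0..N0} \<longrightarrow> ev (?env ks1 ks2 k) t1 = s1 k"
      by blast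
    then show ?case by (intro exI[of _ "Val t1"]) simp
  }
qed

section \<open>Decomposition of terms and comparison at the central block\<close>

definition same_cmp :: "'g option \<Rightarrow> 'g option \<Rightarrow> 'g option \<Rightarrow> 'g option \<Rightarrow> bool" where
  "same_cmp p q p' q' \<longleftrightarrow> (p = q \<longleftrightarrow> p' = q') \<and> (less_inf lt0 p q \<longleftrightarrow> less_inf lt0 p' q') \<and>
    (less_inf lt1 p q \<longleftrightarrow> less_inf lt1 p' q')"

lemma term_seq_single:
  assumes B: "compatible B Z" and s: "s \<in> term_seq B N" "s' \<in> term_seq B N" and N: "0 \<le> N" "N \<le> N0"
    and k: "k \<in> Z" "k' \<in> Z" "k \<in> {-N..N}" "k' \<in> {-N..N}"
  shows "same_cmp (s k) (s' k) (s k') (s' k')"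
proof -
  let ?L = "\<lambda>k. [-N0..-N-1] @ [] @ [k] @ [] @ [N+1..N0]"
  obtain t t' :: "('c, 'g option) trm" where t: "params_trm t \<subseteq> B" "params_trm t' \<subseteq> B"
    "\<And>k. k \<in> {-N0..N0} \<Longrightarrow> ev (E (?L k)) t = s k" "\<And>k. k \<in> {-N0..N0} \<Longrightarrow> ev (E (?L k)) t' = s' k"
    using term_seq_trm[OF s(1) N, of 0 0] term_seq_trm[OF s(2) N, of 0 0] by auto
  have sub: "{-N0..N0} - {0} \<subseteq> Z" "Z \<subseteq> {-N0..N0}" using B by (auto simp: compatible_def)
  have L: "sorted_wrt (<) (?L k)" "set (?L k) \<subseteq> Z" if "k \<in> Z" "k \<in> {-N..N}" for k
    using that sub(1) N by (auto simp: sorted_wrt_append)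
  have "agree {t. params_trm t \<subseteq> B} (E (?L k)) (E (?L k'))"
    using B L[OF k(1,3)] L[OF k(2,4)] unfolding compatible_def by auto
  moreover have "k \<in> {-N0..N0}" "k' \<in> {-N0..N0}" using k sub by auto
  ultimately show ?thesis using t agreeD[of _ "E (?L k)" "E (?L k')" t t'] unfolding same_cmp_def by auto
qed

lemma term_seq_pair:
  assumes B: "compatible B Z" and s: "s \<in> term_seq B N" "s' \<in> term_seq B N" and N: "0 \<le> N" "N \<le> N0"
    and i: "i \<in> Z" "i' \<in> Z" "j \<in> Z" "j' \<in> Z" "i \<in> {-N..N}" "i' \<in> {-N..N}" "j \<in> {-N..N}" "j' \<in> {-N..N}"
    and ij: "i < j" "i' < j'"
  shows "same_cmp (s i) (s' j) (s i') (s' j')" "same_cmp (s' j) (s i) (s' j') (s i')"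
proof -
  \<comment> \<open>Two moving blocks: \<open>s\<close> is read off the first and \<open>s'\<close>
    off the second.\<close>
  let ?L = "\<lambda>i j. [-N0..-N-1] @ [i, j] @ [N+1..N0]"
  obtain t :: "('c, 'g option) trm" where t: "params_trm t \<subseteq> B"
    "\<forall>ks1 ks2 k. length ks1 = 0 \<longrightarrow> length ks2 = 1 \<longrightarrow> set ks1 \<union> set ks2 \<union> {k} \<subseteq> {-N0..N0} \<longrightarrow>
      ev (E ([-N0..-N-1] @ ks1 @ [k] @ ks2 @ [N+1..N0])) t = s k"
    using term_seq_trm[OF s(1) N, of 0 1] by blast
  obtain t' :: "('c, 'g option) trm" where t': "params_trm t' \<subseteq> B"
    "\<forall>ks1 ks2 k. length ks1 = 1 \<longrightarrow> length ks2 = 0 \<longrightarrow> set ks1 \<union> set ks2 \<union> {k} \<subseteq> {-N0..N0} \<longrightarrow>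
      ev (E ([-N0..-N-1] @ ks1 @ [k] @ ks2 @ [N+1..N0])) t' = s' k"
    using term_seq_trm[OF s(2) N, of 1 0] by blast
  have sub: "{-N0..N0} - {0} \<subseteq> Z" "Z \<subseteq> {-N0..N0}" using B by (auto simp: compatible_def)
  have e: "ev (E (?L i j)) t = s i" "ev (E (?L i j)) t' = s' j" if "i \<in> {-N0..N0}" "j \<in> {-N0..N0}" for i j
    using t(2)[rule_format, of "[]" "[j]" i] t'(2)[rule_format, of "[i]" "[]" j] that by auto
  have L: "sorted_wrt (<) (?L i j)" "set (?L i j) \<subseteq> Z" if "i \<in> Z" "j \<in> Z" "i \<in> {-N..N}" "j \<in> {-N..N}" "i < j" for i j
    using that sub(1) N by (auto simp: sorted_wrt_append)
  have ag: "agree {t. params_trm t \<subseteq> B} (E (?L i j)) (E (?L i' j'))"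
    using B L[of i j] L[of i' j'] i ij unfolding compatible_def by auto
  have r: "i \<in> {-N0..N0}" "i' \<in> {-N0..N0}" "j \<in> {-N0..N0}" "j' \<in> {-N0..N0}" using i sub by auto
  have B: "t \<in> {t. params_trm t \<subseteq> B}" "t' \<in> {t. params_trm t \<subseteq> B}" using t(1) t'(1) by simp_all
  note eqs = e[OF r(1,3)] e[OF r(2,4)]
  show "same_cmp (s i) (s' j) (s i') (s' j')"
    unfolding same_cmp_def using agreeD[OF ag B] unfolding eqs by blast
  show "same_cmp (s' j) (s i) (s' j') (s i')"
    unfolding same_cmp_def using agreeD[OF ag B(2,1)] unfolding eqs by blast
qed

text \<open>All parameters from \<open>A\<close> are collected in one constant summand. Only
  \<open>Val\<close> mixes them with the moving block; \<open>val_dichotomy\<close> separates the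
  two again, at the cost of one unit of the range of \<open>k\<close>.\<close>

lemma ev_single_decompose:
  fixes t :: "('c, 'g option) trm"
  assumes "params_trm t \<subseteq> A" "1 \<le> N" "N + int (val_depth t) \<le> N0"
  shows "\<exists>s d. s \<in> term_seq {} N \<and> (\<lambda>_. d) \<in> term_seq A N \<and> (\<forall>k\<in>{-N..N}. ev (E [k]) t = oplus (s k) d)"
  using assms
proof (induction t arbitrary: N)
  case (Var q)
  let ?la = "length as * n" and ?lr = "r * n"
  \<comment> \<open>The variable belongs to \<open>as\<close>, to the moving block or to
    \<open>ds\<close>; past the end, the last branch already yields infinity.\<close>
  define s where "s = (\<lambda>k. if q < ?la then seq_env n a as q
    else if q - ?la < ?lr then seq_env n a (blk k) (q - ?la) else seq_env n a ds (q - ?la - ?lr))"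
  have s: "s \<in> term_seq {} N"
    unfolding s_def by (cases "q < ?la"; cases "q - ?la < ?lr") (auto intro: term_seq.intros)
  have "E [k] q = oplus (s k) (Some 0)" if k: "k \<in> {-N..N}" for k
  proof -
    have "length (blk k) = r" using blk_length[of k] k Var.prems by auto
    then have "E [k] q = s k" by (simp add: E_def pos_def s_def seq_env_append)
    then show ?thesis by (cases "s k") auto
  qed
  then show ?case using s term_seq.zero by (intro exI[of _ s] exI[of _ "Some 0"]) auto
next
  case (Cst u)
  have "oplus (Some 0) u = u" by (cases u) auto
  then show ?case using Cst.prems term_seq.zero term_seq.const[of u A N]
    by (intro exI[of _ "\<lambda>_. Some 0"] exI[of _ u]) auto
next
  case Zero
  then show ?case using term_seq.zero by (intro exI[of _ "\<lambda>_. Some 0"] exI[of _ "Some 0"]) auto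
next
  case Infty
  then show ?case using term_seq.zero term_seq.infty by (intro exI[of _ "\<lambda>_. Some 0"] exI[of _ None]) auto
next
  case (Plus t1 t2)
  have p: "params_trm t1 \<subseteq> A" "params_trm t2 \<subseteq> A" "N + int (val_depth t1) \<le> N0" "N + int (val_depth t2) \<le> N0"
    using Plus.prems by auto
  obtain s d where 1: "s \<in> term_seq {} N" "(\<lambda>_. d) \<in> term_seq A N" "\<forall>k\<in>{-N..N}. ev (E [k]) t1 = oplus (s k) d"
    using Plus.IH(1)[OF p(1) Plus.prems(2) p(3)] by blast
  obtain s' d' where 2: "s' \<in> term_seq {} N" "(\<lambda>_. d') \<in> term_seq A N" "\<forall>k\<in>{-N..N}. ev (E [k]) t2 = oplus (s' k) d'"
    using Plus.IH(2)[OF p(2) Plus.prems(2) p(4)] by blast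
  have "oplus (oplus p d) (oplus p' d') = oplus (oplus p p') (oplus d d')" for p p' d d' :: "'g option"
    by (cases p; cases p'; cases d; cases d') (auto simp: algebra_simps)
  then show ?case using term_seq.plus[OF 1(1) 2(1)] term_seq.plus[OF 1(2) 2(2)] 1(3) 2(3)
    by (intro exI[of _ "\<lambda>k. oplus (s k) (s' k)"] exI[of _ "oplus d d'"]) auto
next
  case (Scal l t)
  have p: "params_trm t \<subseteq> A" "N + int (val_depth t) \<le> N0" using Scal.prems by auto
  obtain s d where 1: "s \<in> term_seq {} N" "(\<lambda>_. d) \<in> term_seq A N" "\<forall>k\<in>{-N..N}. ev (E [k]) t = oplus (s k) d"
    using Scal.IH[OF p(1) Scal.prems(2) p(2)] by blast
  have "map_option (sc l) (oplus p d) = oplus (map_option (sc l) p) (map_option (sc l) d)" for p d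
    by (cases p; cases d) (auto simp: o0.vs.scale_right_distrib)
  then show ?case using term_seq.scal[OF 1(1), of l] term_seq.scal[OF 1(2), of l] 1(3)
    by (intro exI[of _ "\<lambda>k. map_option (sc l) (s k)"] exI[of _ "map_option (sc l) d"]) auto
next
  case (Val t)
  \<comment> \<open>The induction hypothesis is applied on a range larger by one, so that
    \<open>M\<close> and \<open>- M\<close> fall outside \<open>{-N..N}\<close> and can be frozen.
    The bound \<open>1 \<le> N\<close> yields the \<open>2 \<le> M\<close> required by the
    dichotomy.\<close>
  define M where "M = N + 1"
  have p: "params_trm t \<subseteq> A" "M + int (val_depth t) \<le> N0" "1 \<le> M" "2 \<le> M" "M \<le> N0" "0 \<le> M"
    using Val.prems by (auto simp: M_def)
  obtain s d where 1: "s \<in> term_seq {} M" "(\<lambda>_. d) \<in> term_seq A M" "\<forall>k\<in>{-M..M}. ev (E [k]) t = oplus (s k) d"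
    using Val.IH[OF p(1) p(3) p(2)] by blast
  have sA: "s \<in> term_seq A M" using term_seq_mono[OF 1(1)] by simp
  have sub: "{-N..N} \<subseteq> {-M..M}" "{-N..N} = {-M<..<M}" by (auto simp: M_def)
  have ends: "M \<in> {-N0..N0}" "M \<notin> {-N..N}" "- M \<in> {-N0..N0}" "- M \<notin> {-N..N}" "N \<le> M" using p Val.prems by (auto simp: M_def)
  have valt: "ev (E [k]) (Val t) = v_ext v (oplus (s k) d)" if "k \<in> {-N..N}" for k
    using 1(3) sub that by auto
  \<comment> \<open>Being infinite is a comparison with the constant sequence infinity, so it holds
    for all indices in the range or for none.\<close>
  have None: "s k = None \<longleftrightarrow> s k' = None" if "k \<in> {-M..M}" "k' \<in> {-M..M}" for k k'
    using term_seq_single[OF compatible0 1(1) term_seq.infty p(6,5), of k k'] that p(5) by (auto simp: same_cmp_def)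
  show ?case
  proof (cases "d = None \<or> s 0 = None")
    case True
    then have "v_ext v (oplus (s k) d) = None" if "k \<in> {-N..N}" for k
      using None[of k 0] that sub p(6) by (auto simp: v_ext_def)
    then show ?thesis using valt term_seq.infty term_seq.zero
      by (intro exI[of _ "\<lambda>_. None"] exI[of _ "Some 0"]) auto
  next
    case False
    then obtain d' where d: "d = Some d'" by auto
    \<comment> \<open>The sign turns the sum of \<open>s k\<close> and \<open>d\<close> into the
      difference \<open>d' - t' k\<close> of the dichotomy.\<close>
    define t' where "t' k = - the (s k)" for k
    have s: "s k = Some (- t' k)" if "k \<in> {-M..M}" for k
      using None[of k 0] that False p(6) by (auto simp: t'_def)
    have val: "v_ext v (oplus (s k) d) = v (d' - t' k)" if "k \<in> {-M..M}" for k
      using s[OF that] d by (simp add: v_ext_def)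
    let ?w = "\<lambda>k. map_option (sc (- 1)) (s k)" and ?u = "\<lambda>k. v_ext v (oplus (s k) d)"
    have w: "?w k = Some (t' k)" if "k \<in> {-M..M}" for k using s[OF that] by simp
    have w0: "?w \<in> term_seq {} M" by (rule term_seq.scal[OF 1(1)])
    have wA: "?w \<in> term_seq A M" by (rule term_seq.scal[OF sA])
    have u: "?u \<in> term_seq A M" by (rule term_seq.val[OF term_seq.plus[OF sA 1(2)]])
    have "(\<forall>k\<in>{-M..M}. v (d' - t' k) = v (d' - t' M)) \<or> (\<forall>k\<in>{-M<..<M}. v (d' - t' k) = v (t' M - t' k)) \<or>
      (\<forall>k\<in>{-M<..<M}. v (d' - t' k) = v (t' (- M) - t' k))"
    proof (rule val_dichotomy[OF p(4)])
      fix i j assume ij: "- M \<le> i" "i < j" "j \<le> M"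
      have "same_cmp (?w i) (?w j) (?w 0) (?w 1)"
        using ij p(3-5) by (intro term_seq_pair(1)[OF compatible0 w0 w0 p(6,5)]) auto
      then show "lt1 (t' i) (t' j) \<longleftrightarrow> lt1 (t' 0) (t' 1)" "t' i = t' j \<longleftrightarrow> t' 0 = t' 1"
        using w[of i] w[of j] w[of 0] w[of 1] ij p(3) unfolding same_cmp_def by auto
    next
      fix i j assume ij: "i \<in> {-M..M} - {0}" "j \<in> {-M..M} - {0}"
      have "same_cmp (?w i) d (?w j) d"
        using ij p(5) by (intro term_seq_single[OF compatibleA wA 1(2) p(6,5)]) auto
      then show "lt1 (t' i) d' \<longleftrightarrow> lt1 (t' j) d'" "t' i = d' \<longleftrightarrow> t' j = d'"
        using w[of i] w[of j] ij d unfolding same_cmp_def by auto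
    next
      fix i j i' j' assume ij: "i \<in> {-M..M} - {0}" "j \<in> {-M..M} - {0}" "i' \<in> {-M..M} - {0}" "j' \<in> {-M..M} - {0}" "i < j" "i' < j'"
      have "same_cmp (?u i) (?u j) (?u i') (?u j')"
        using ij p(5) by (intro term_seq_pair(1)[OF compatibleA u u p(6,5)]) auto
      then show "v (d' - t' i) = v (d' - t' j) \<longleftrightarrow> v (d' - t' i') = v (d' - t' j')"
        using val[of i] val[of j] val[of i'] val[of j'] ij unfolding same_cmp_def by simp
    qed
    then consider (const) "\<forall>k\<in>{-M..M}. v (d' - t' k) = v (d' - t' M)"
      | (upper) "\<forall>k\<in>{-N..N}. v (d' - t' k) = v (t' M - t' k)"
      | (lower) "\<forall>k\<in>{-N..N}. v (d' - t' k) = v (t' (- M) - t' k)" unfolding sub(2) by blast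
    then show ?thesis
    proof cases
      \<comment> \<open>The common value may involve \<open>A\<close>; frozen at the block
        \<open>M\<close>, it becomes the new constant summand.\<close>
      case const
      have "oplus (Some 0) (?u M) = ?u M" by (cases "?u M") auto
      moreover have "?u k = ?u M" if "k \<in> {-N..N}" for k
      proof -
        have kM: "k \<in> {-M..M}" "M \<in> {-M..M}" using that sub p(6) by auto
        show ?thesis unfolding val[OF kM(1)] val[OF kM(2)] using const kM(1) by blast
      qed
      ultimately have "ev (E [k]) (Val t) = oplus (Some 0) (?u M)" if "k \<in> {-N..N}" for k
        using valt[OF that] that by metis
      then show ?thesis using term_seq_freeze[OF u ends(5,1,2)] term_seq.zero
        by (intro exI[of _ "\<lambda>_. Some 0"] exI[of _ "?u M"]) blast
    next
      \<comment> \<open>The parameter has dropped out: what remains is the value of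
        \<open>t' M - t' k\<close>, which is parameter-free once the entry at \<open>M\<close> is
        frozen.\<close>
      case upper
      let ?s = "\<lambda>k. v_ext v (oplus (s k) (?w M))"
      have "?s \<in> term_seq {} N"
        by (intro term_seq.val term_seq.plus term_seq_mono[OF 1(1)] term_seq_freeze[OF w0 ends(5,1,2)]) (auto simp: M_def)
      moreover have "ev (E [k]) (Val t) = oplus (?s k) (Some 0)" if k: "k \<in> {-N..N}" for k
      proof -
        have kM: "k \<in> {-M..M}" "M \<in> {-M..M}" using k sub p(6) by auto
        have "?s k = v (t' M - t' k)" by (simp only: s[OF kM(1)] w[OF kM(2)]) (simp add: v_ext_def)
        then have "ev (E [k]) (Val t) = ?s k" using valt[OF k] val[OF kM(1)] upper k by simp
        moreover have "?s k = oplus (?s k) (Some 0)" by (cases "?s k") auto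
        ultimately show ?thesis by metis
      qed
      ultimately show ?thesis using term_seq.zero by (intro exI[of _ ?s] exI[of _ "Some 0"]) blast
    next
      case lower
      let ?s = "\<lambda>k. v_ext v (oplus (s k) (?w (- M)))"
      have "?s \<in> term_seq {} N"
        by (intro term_seq.val term_seq.plus term_seq_mono[OF 1(1)] term_seq_freeze[OF w0 ends(5,3,4)]) (auto simp: M_def)
      moreover have "ev (E [k]) (Val t) = oplus (?s k) (Some 0)" if k: "k \<in> {-N..N}" for k
      proof -
        have kM: "k \<in> {-M..M}" "- M \<in> {-M..M}" using k sub p(6) by auto
        have "?s k = v (t' (- M) - t' k)" by (simp only: s[OF kM(1)] w[OF kM(2)]) (simp add: v_ext_def)
        then have "ev (E [k]) (Val t) = ?s k" using valt[OF k] val[OF kM(1)] lower k by simp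
        moreover have "?s k = oplus (?s k) (Some 0)" by (cases "?s k") auto
        ultimately show ?thesis by metis
      qed
      ultimately show ?thesis using term_seq.zero by (intro exI[of _ ?s] exI[of _ "Some 0"]) blast
    qed
  qed
qed

text \<open>After moving everything to one side, both terms are compared through a parameter-free
  sequence \<open>y k\<close> and the constant \<open>x' - x\<close> over \<open>A\<close>. Only the
  blocks -1, 0 and 1 take part, so range 1 is enough for the decompositions.\<close>

lemma agree_center:
  fixes t t' :: "('c, 'g option) trm"
  assumes "params_trm t \<subseteq> A" "params_trm t' \<subseteq> A" "1 + int (val_depth t) \<le> N0" "1 + int (val_depth t') \<le> N0"
  shows "same_cmp (ev (E [0]) t) (ev (E [0]) t') (ev (E [1]) t) (ev (E [1]) t')"
proof -
  have N0: "1 \<le> N0" using assms(3) by linarith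
  then have b: "(0::int) \<le> 1" "1 \<le> N0" by auto
  obtain s d where s: "s \<in> term_seq {} 1" "(\<lambda>_. d) \<in> term_seq A 1" "\<forall>k\<in>{-1..1}. ev (E [k]) t = oplus (s k) d"
    using ev_single_decompose[OF assms(1) _ assms(3)] by auto
  obtain s' d' where s': "s' \<in> term_seq {} 1" "(\<lambda>_. d') \<in> term_seq A 1" "\<forall>k\<in>{-1..1}. ev (E [k]) t' = oplus (s' k) d'"
    using ev_single_decompose[OF assms(2) _ assms(4)] by auto
  have e: "ev (E [k]) t = oplus (s k) d" "ev (E [k]) t' = oplus (s' k) d'" if "k \<in> {-1..1}" for k
    using s(3) s'(3) that by auto
  have None: "u k = None \<longleftrightarrow> u 0 = None" if "u \<in> term_seq {} 1" "k \<in> {-1..1}" for u k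
    using term_seq_single[OF compatible0 that(1) term_seq.infty b, of k 0] that N0 by (auto simp: same_cmp_def)
  show ?thesis
  proof (cases "s 0 = None \<or> s' 0 = None \<or> d = None \<or> d' = None")
    case True
    then show ?thesis
      using e[of 0] e[of 1] None[OF s(1), of 1] None[OF s'(1), of 1] unfolding same_cmp_def
      by (cases "s 0"; cases "s' 0"; cases "s 1"; cases "s' 1"; cases d; cases d') auto
  next
    case False
    then obtain x x' where d: "d = Some x" "d' = Some x'" by auto
    define y where "y k = the (s k) - the (s' k)" for k
    have some: "s k = Some (the (s k))" "s' k = Some (the (s' k))" if "k \<in> {-1..1}" for k
      using None[OF s(1) that] None[OF s'(1) that] False by auto
    let ?z = "\<lambda>k. oplus (s k) (map_option (sc (- 1)) (s' k))"
    let ?D = "oplus d' (map_option (sc (- 1)) d)"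
    have z: "?z k = Some (y k)" if "k \<in> {-1..1}" for k
      using some[OF that] by (cases "s k"; cases "s' k") (auto simp: y_def)
    have D: "?D = Some (x' - x)" using d by simp
    have z0: "?z \<in> term_seq {} 1" by (intro term_seq.plus term_seq.scal s s')
    then have zA: "?z \<in> term_seq A 1" by (rule term_seq_mono) auto
    have DA: "(\<lambda>_. ?D) \<in> term_seq A 1" using term_seq.plus[OF s'(2) term_seq.scal[OF s(2)]] by simp
    have "same_cmp (?z (-1)) (?z 0) (?z 0) (?z 1)" "same_cmp (?z 0) (?z (-1)) (?z 1) (?z 0)"
      using N0 by (intro term_seq_pair[OF compatible0 z0 z0 b]; auto)+
    moreover have "same_cmp (?z (-1)) ?D (?z 1) ?D"
      using N0 by (intro term_seq_single[OF compatibleA zA DA b]) auto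
    ultimately have cmp: "same_cmp (Some (y (-1))) (Some (y 0)) (Some (y 0)) (Some (y 1))"
      "same_cmp (Some (y 0)) (Some (y (-1))) (Some (y 1)) (Some (y 0))"
      "same_cmp (Some (y (-1))) (Some (x' - x)) (Some (y 1)) (Some (x' - x))"
      using z[of 0] z[of 1] z[of "-1"] D by simp_all
    have "(y 0 = x' - x \<longleftrightarrow> y 1 = x' - x) \<and> (lt0 (y 0) (x' - x) \<longleftrightarrow> lt0 (y 1) (x' - x))"
      "(y 0 = x' - x \<longleftrightarrow> y 1 = x' - x) \<and> (lt1 (y 0) (x' - x) \<longleftrightarrow> lt1 (y 1) (x' - x))"
      using cmp unfolding same_cmp_def
      by (intro o0.between_cut[of "y (-1)"] o1.between_cut[of "y (-1)"]; simp)+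
    moreover have "ev (E [k]) t = ev (E [k]) t' \<longleftrightarrow> y k = x' - x"
      "less_inf lt0 (ev (E [k]) t) (ev (E [k]) t') \<longleftrightarrow> lt0 (y k) (x' - x)"
      "less_inf lt1 (ev (E [k]) t) (ev (E [k]) t') \<longleftrightarrow> lt1 (y k) (x' - x)" if "k \<in> {-1..1}" for k
    proof -
      have eq: "ev (E [k]) t = Some (the (s k) + x)" "ev (E [k]) t' = Some (the (s' k) + x')"
        using e[OF that] some[OF that] d by (metis oplus_simps(3))+
      have "y k - (x' - x) = (the (s k) + x) - (the (s' k) + x')" by (simp add: y_def)
      then show "ev (E [k]) t = ev (E [k]) t' \<longleftrightarrow> y k = x' - x"
        "less_inf lt0 (ev (E [k]) t) (ev (E [k]) t') \<longleftrightarrow> lt0 (y k) (x' - x)"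
        "less_inf lt1 (ev (E [k]) t) (ev (E [k]) t') \<longleftrightarrow> lt1 (y k) (x' - x)"
        unfolding eq using o0.diff_less_0_iff_less o1.diff_less_0_iff_less
        by (metis option.inject eq_iff_diff_eq_0, metis less_inf_simps(1), metis less_inf_simps(1))
    qed
    ultimately show ?thesis unfolding same_cmp_def by simp
  qed
qed

end

section \<open>Putting \<open>c\<close> back into the sequence\<close>

context hamel_model begin

text \<open>The tuple is cut at one roomy gap on each side of \<open>c\<close>: the entries between
  the gaps form block 0, those outside stay fixed. \<open>agree_center\<close> exchanges block 0 for
  block 1, after which the tuple avoids \<open>c\<close> and indiscernibility over \<open>A\<close>
  leads to \<open>js\<close>.\<close>

lemma indiscernible_agree_insert:
  fixes I :: "'i::linorder set" and c :: 'i
  assumes c: "c \<in> I" and inf: "infinite {i \<in> I. i < c}" "infinite {i \<in> I. c < i}"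
    and ind0: "indiscernible sc lt0 lt1 v {} I n a" and indA: "indiscernible sc lt0 lt1 v A (I - {c}) n a"
    and is': "sorted_wrt (<) is" "set is \<subseteq> I" "c \<in> set is"
    and js: "sorted_wrt (<) js" "set js \<subseteq> I - {c}" "length js = length is"
  shows "agree {t. params_trm t \<subseteq> A} (seq_env n a is) (seq_env n a js)"
proof (rule agree_pairs)
  fix t t' :: "('c, 'g option) trm" assume t: "t \<in> {t. params_trm t \<subseteq> A}" "t' \<in> {t. params_trm t \<subseteq> A}"
  \<comment> \<open>The blocks needed on either side: one for the final comparison and one for each
    level of nested values.\<close>
  define M where "M = Suc (max (val_depth t) (val_depth t'))"
  obtain xs ys where xy: "is = xs @ c # ys" using is'(3) split_list by metis
  have xs: "sorted_wrt (<) xs" "\<And>x. x \<in> set xs \<Longrightarrow> x < c" "set xs \<subseteq> I"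
    and ys: "sorted_wrt (<) ys" "\<And>y. y \<in> set ys \<Longrightarrow> c < y" "set ys \<subseteq> I"
    using is' unfolding xy by (auto simp: sorted_wrt_append)
  define L where "L = {i \<in> I. i < c} - set xs"
  define R where "R = {i \<in> I. c < i} - set ys"
  have L: "infinite L" "L \<inter> set xs = {}" and R: "infinite R" "R \<inter> set ys = {}"
    using inf by (auto simp: L_def R_def)
  obtain as bs where ab: "xs = as @ bs" "infinite {l \<in> L. (\<forall>x\<in>set as. x < l) \<and> (\<forall>x\<in>set bs. l < x)}"
    using infinite_gap[OF xs(1) L] by blast
  obtain gs ds where gd: "ys = gs @ ds" "infinite {l \<in> R. (\<forall>x\<in>set gs. x < l) \<and> (\<forall>x\<in>set ds. l < x)}"
    using infinite_gap[OF ys(1) R] by blast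
  let ?J = "{l \<in> L. (\<forall>x\<in>set as. x < l) \<and> (\<forall>x\<in>set bs. l < x)}"
  let ?K = "{l \<in> R. (\<forall>x\<in>set gs. x < l) \<and> (\<forall>x\<in>set ds. l < x)}"
  \<comment> \<open>Every block must be exchangeable with block 0, which consists of
    \<open>bs\<close>, \<open>c\<close> and \<open>gs\<close>.\<close>
  define r where "r = length bs + 1 + length gs"
  obtain f where "\<forall>q<M. length (f q) = r \<and> sorted_wrt (<) (f q) \<and> set (f q) \<subseteq> ?J"
    "\<forall>q q' x y. q < q' \<longrightarrow> q' < M \<longrightarrow> x \<in> set (f q) \<longrightarrow> y \<in> set (f q') \<longrightarrow> x < y"
    using blocks_exist[OF ab(2), of M r] by (elim exE conjE) (rule that)
  note f = this(1)[THEN spec, THEN mp] this(2)[rule_format]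
  obtain g where "\<forall>q<M. length (g q) = r \<and> sorted_wrt (<) (g q) \<and> set (g q) \<subseteq> ?K"
    "\<forall>q q' x y. q < q' \<longrightarrow> q' < M \<longrightarrow> x \<in> set (g q) \<longrightarrow> y \<in> set (g q') \<longrightarrow> x < y"
    using blocks_exist[OF gd(2), of M r] by (elim exE conjE) (rule that)
  note g = this(1)[THEN spec, THEN mp] this(2)[rule_format]
  \<comment> \<open>The families \<open>f\<close> and \<open>g\<close> are numbered from 0 to
    \<open>M - 1\<close>; thus block \<open>- M\<close> is \<open>f 0\<close> and block 1 is
    \<open>g 0\<close>.\<close>
  define blk where "blk k = (if k = 0 then bs @ c # gs else if k < 0 then f (nat (k + int M)) else g (nat (k - 1)))" for k :: int
  have blk_neg: "length (blk k) = r \<and> sorted_wrt (<) (blk k) \<and> set (blk k) \<subseteq> ?J" if "k \<in> {- int M..int M}" "k < 0" for k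
    using f(1)[of "nat (k + int M)"] that by (auto simp: blk_def)
  have blk_pos: "length (blk k) = r \<and> sorted_wrt (<) (blk k) \<and> set (blk k) \<subseteq> ?K" if "k \<in> {- int M..int M}" "0 < k" for k
    using g(1)[of "nat (k - 1)"] that by (auto simp: blk_def)
  have blk0: "blk 0 = bs @ c # gs" by (simp add: blk_def)
  have s0: "sorted_wrt (<) (bs @ c # gs)" using is'(1) unfolding xy ab(1) gd(1) by (auto simp: sorted_wrt_append)
  have srt: "\<And>x y. x \<in> set as \<Longrightarrow> y \<in> set bs \<union> {c} \<union> set gs \<union> set ds \<Longrightarrow> x < y"
    "\<And>x y. x \<in> set bs \<union> {c} \<union> set gs \<Longrightarrow> y \<in> set ds \<Longrightarrow> x < y"
    using is'(1) unfolding xy ab(1) gd(1) by (auto simp: sorted_wrt_append)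
  have J: "x \<in> I" "x < c" "\<And>y. y \<in> set as \<Longrightarrow> y < x" "\<And>y. y \<in> set bs \<Longrightarrow> x < y" "\<And>y. y \<in> set ys \<Longrightarrow> x < y"
    if "x \<in> ?J" for x using that by (auto simp: L_def intro: order.strict_trans[OF _ ys(2)])
  have K: "x \<in> I" "c < x" "\<And>y. y \<in> set gs \<Longrightarrow> y < x" "\<And>y. y \<in> set ds \<Longrightarrow> x < y" "\<And>y. y \<in> set xs \<Longrightarrow> y < x"
    if "x \<in> ?K" for x using that by (auto simp: R_def intro: order.strict_trans[OF xs(2)])
  interpret hamel_blocks sc lt0 lt1 v A I c n a blk as ds r "int M"
  proof
    show "indiscernible sc lt0 lt1 v {} I n a" "indiscernible sc lt0 lt1 v A (I - {c}) n a" by fact+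
    show "sorted_wrt (<) as" "sorted_wrt (<) ds" using xs(1) ys(1) by (auto simp: ab gd sorted_wrt_append)
    show "set as \<subseteq> I - {c}" "set ds \<subseteq> I - {c}" using xs(2,3) ys(2,3) by (auto simp: ab gd)
    show "\<And>x y. x \<in> set as \<Longrightarrow> y \<in> set ds \<Longrightarrow> x < y" using srt(1) by blast
  next
    fix k assume k: "k \<in> {- int M..int M}"
    consider "k < 0" | "k = 0" | "0 < k" by linarith
    then have "length (blk k) = r \<and> sorted_wrt (<) (blk k) \<and> set (blk k) \<subseteq> I \<and> (k \<noteq> 0 \<longrightarrow> c \<notin> set (blk k)) \<and>
      (\<forall>x\<in>set as. \<forall>y\<in>set (blk k). x < y) \<and> (\<forall>x\<in>set (blk k). \<forall>y\<in>set ds. x < y)"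
    proof cases
      case 1
      note b = blk_neg[OF k 1]
      then have sub: "\<And>x. x \<in> set (blk k) \<Longrightarrow> x \<in> ?J" by blast
      have "set (blk k) \<subseteq> I" "c \<notin> set (blk k)" using J(1,2)[OF sub] by blast+
      moreover have "set ds \<subseteq> set ys" by (simp add: gd)
      ultimately show ?thesis using b J(3,5)[OF sub] by blast
    next
      case 2
      have "set (bs @ c # gs) \<subseteq> I" using xs(3) ys(3) c by (auto simp: ab gd)
      moreover have "\<forall>x\<in>set as. \<forall>y\<in>set (bs @ c # gs). x < y" "\<forall>x\<in>set (bs @ c # gs). \<forall>y\<in>set ds. x < y"
        using srt by auto
      ultimately show ?thesis using s0 unfolding 2 blk0 by (simp add: r_def)
    next
      case 3
      note b = blk_pos[OF k 3]
      then have sub: "\<And>x. x \<in> set (blk k) \<Longrightarrow> x \<in> ?K" by blast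
      have "set (blk k) \<subseteq> I" "c \<notin> set (blk k)" using K(1,2)[OF sub] by blast+
      moreover have "set as \<subseteq> set xs" by (simp add: ab)
      ultimately show ?thesis using b K(4,5)[OF sub] by blast
    qed
    note * = this
    show "length (blk k) = r" "sorted_wrt (<) (blk k)" "set (blk k) \<subseteq> I" using * by blast+
    show "x < y" if "x \<in> set as" "y \<in> set (blk k)" for x y using * that by blast
    show "x < y" if "x \<in> set (blk k)" "y \<in> set ds" for x y using * that by blast
  next
    fix k assume "k \<in> {- int M..int M} - {0}"
    then consider "k \<in> {- int M..int M}" "k < 0" | "k \<in> {- int M..int M}" "0 < k" by force
    then show "c \<notin> set (blk k)"
    proof cases
      case 1 then show ?thesis using blk_neg[OF 1] J(2) by blast
    next
      case 2 then show ?thesis using blk_pos[OF 2] K(2) by blast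
    qed
  next
    fix i j x y assume i: "i \<in> {- int M..int M}" and j: "j \<in> {- int M..int M}" and ij: "i < j"
      and x: "x \<in> set (blk i)" and y: "y \<in> set (blk j)"
    consider "j < 0" | "i < 0" "j = 0" | "i < 0" "0 < j" | "i = 0" "0 < j" | "0 < i" using ij by linarith
    then show "x < y"
    proof cases
      case 1
      then show ?thesis using f(2)[of "nat (i + int M)" "nat (j + int M)" x y] x y i j ij by (auto simp: blk_def)
    next
      case 2
      then have xJ: "x \<in> ?J" using blk_neg[OF i] x by blast
      then show ?thesis using y J[OF xJ] 2 by (auto simp: blk0 gd)
    next
      case 3
      then have "x < c" "c < y" using blk_neg[OF i] blk_pos[OF j] x y J(2)[of x] K(2)[of y] by blast+
      then show ?thesis by simp
    next
      case 4
      then have yK: "y \<in> ?K" using blk_pos[OF j] y by blast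
      then show ?thesis using x K[OF yK] 4 by (auto simp: blk0 ab)
    next
      case 5
      then show ?thesis using g(2)[of "nat (i - 1)" "nat (j - 1)" x y] x y i j ij by (auto simp: blk_def)
    qed
  qed
  have E0: "E [0] = seq_env n a is" by (simp add: E_def pos_def blk0 xy ab gd)
  have M1: "set [1] \<subseteq> {- int M..int M} - {0}" by (simp add: M_def)
  have "length (pos [1]) = length js" using length_pos[of "[1]"] M1 js(3) by (simp add: xy ab gd r_def)
  moreover have "set (pos [1]) \<subseteq> I - {c}" using pos_I[of "[1]"] pos_c[OF M1] M1 by auto
  moreover have "sorted_wrt (<) (pos [1])" using M1 by (intro pos_sorted) auto
  ultimately have E1: "agree {t. params_trm t \<subseteq> A} (E [1]) (seq_env n a js)"
    unfolding E_def using js by (intro indiscernible_agree[OF indA]) auto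
  have d: "1 + int (val_depth t) \<le> int M" "1 + int (val_depth t') \<le> int M" by (auto simp: M_def)
  have "agree {t, t'} (E [0]) (E [1])"
    using t agree_center[OF _ _ d(1) d(2)] agree_center[OF _ _ d(2) d(1)] agree_center[OF _ _ d(1) d(1)]
      agree_center[OF _ _ d(2) d(2)] unfolding agree_def same_cmp_def by blast
  moreover have "agree {t, t'} (E [1]) (seq_env n a js)" using E1 t by (elim agree_mono) auto
  ultimately show "agree {t, t'} (seq_env n a is) (seq_env n a js)"
    unfolding E0[symmetric] agree_def by blast
qed

end

theorem theorem5p1:
  fixes sc :: "'c::linordered_field \<Rightarrow> 'g::ab_group_add \<Rightarrow> 'g"
    and lt0 lt1 :: "'g \<Rightarrow> 'g \<Rightarrow> bool"
    and v :: "'g \<Rightarrow> 'g option"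
    and A :: "'g option set"
    and I :: "'i::linorder set" and c :: 'i
    and n :: nat and a :: "'i \<Rightarrow> 'g option list"
  assumes "model_T_Ham sc lt0 lt1 v"
    and "c \<in> I" and "infinite {i \<in> I. i < c}" and "infinite {i \<in> I. c < i}"
    and "\<forall>i \<in> I. length (a i) = n"
    and "indiscernible sc lt0 lt1 v {} I n a"
    and "indiscernible sc lt0 lt1 v A (I - {c}) n a"
  shows "indiscernible sc lt0 lt1 v A I n a"
proof -
  interpret hamel_model sc lt0 lt1 v by unfold_locales (rule assms(1))
  note insert = indiscernible_agree_insert[OF assms(2,3,4,6,7)]
  \<comment> \<open>Two tuples that may both contain \<open>c\<close> are compared through a third
    one that avoids it.\<close>
  have avoid: "\<exists>ks. sorted_wrt (<) ks \<and> set ks \<subseteq> I - {c} \<and> length ks = m" for m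
  proof -
    have "{i \<in> I. i < c} \<subseteq> I - {c}" by auto
    then have "infinite (I - {c})" using assms(3) finite_subset by blast
    then obtain T where "finite T" "card T = m" "T \<subseteq> I - {c}" using infinite_arbitrarily_large by blast
    then show ?thesis by (intro exI[of _ "sorted_list_of_set T"]) auto
  qed
  have step: "sat sc lt0 lt1 v (seq_env n a is) \<phi> \<longleftrightarrow> sat sc lt0 lt1 v (seq_env n a ks) \<phi>"
    if "params_fm \<phi> \<subseteq> A" "sorted_wrt (<) is" "set is \<subseteq> I" "sorted_wrt (<) ks" "set ks \<subseteq> I - {c}" "length ks = length is"
    for \<phi> :: "('c, 'g option) fm" and "is" ks
  proof (cases "c \<in> set is")
    case True
    show ?thesis by (rule agree_sat[OF insert[OF that(2,3) True that(4,5,6)] that(1)])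
  next
    case False
    then have sub: "set is \<subseteq> I - {c}" using that(3) by blast
    show ?thesis
      by (rule assms(7)[unfolded indiscernible_def, rule_format, OF that(1,2,4) sub that(5) that(6)[symmetric]])
  qed
  show ?thesis unfolding indiscernible_def
  proof (intro allI impI)
    fix \<phi> :: "('c, 'g option) fm" and "is" js
    assume *: "params_fm \<phi> \<subseteq> A" "sorted_wrt (<) is" "sorted_wrt (<) js" "set is \<subseteq> I" "set js \<subseteq> I" "length is = length js"
    obtain ks where "sorted_wrt (<) ks" "set ks \<subseteq> I - {c}" "length ks = length is" using avoid by blast
    then show "sat sc lt0 lt1 v (seq_env n a is) \<phi> \<longleftrightarrow> sat sc lt0 lt1 v (seq_env n a js) \<phi>"
      using step[OF *(1,2,4), of ks] step[OF *(1,3,5), of ks] *(6) by simp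
  qed
qed

end
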